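(* Let $f:\mathbb{E}\to\mathbb{R}$ be convex and $p$-times differentiable, $p\ge2$, with $H_{f,p}(\nu)<+\infty$ for a known $\nu\in[0,1]$; let $\varphi:\mathbb{E}\to\mathbb{R}\cup\{+\infty\}$ be a closed convex function with $\mathrm{ri}(\mathrm{dom}\,\varphi)\ne\emptyset$; let $\tilde f=f+\varphi$ have a minimizer $x^*$; and let $S\ge\tilde f(x_0)-\tilde f(x^* )$ with $S\ge1$. Let $\epsilon\in(0,1)$. Then Algorithm 6 (described in the context) with $$\delta=\left[\frac{\epsilon}{2^{p+\nu}\left[2^{p+\nu-2}(p+\nu)S\right]^{\frac{p+\nu-1}{p+\nu}}}\right]^{p+\nu}$$ performs at most $$\mathcal{O}\left(\log_2\left(\frac{S}{\epsilon^{\frac{p+\nu-1}{p+\nu}}}\right)\left(\frac{S^{\frac{p+\nu-1}{p+\nu}}}{\epsilon}\right)\right)$$ iterations of Algorithm 5 in order to generate $u_T$ such that $\|\nabla\tilde f(u_T)\|_*\le\epsilon$. Here $\mathcal{O}$ is understood as $S/\epsilon\to\infty$, with constants depending only on $p,\nu,H_{f,p}(\nu),\theta$.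
   Context: **Notation.** $\mathbb{E}$ is a finite-dimensional real vector space with dual $\mathbb{E}^*$, $B:\mathbb{E}\to\mathbb{E}^*$ is a fixed self-adjoint positive definite operator, $\|x\|=\langle Bx,x\rangle^{1/2}$, $\|s\|_*=\langle s,B^{-1}s\rangle^{1/2}$. $D^if(x)[h]^i$ is the $i$th directional derivative along $h$; the norm of a symmetric $p$-linear form $A$ is $\max\{|A[h_1,\ldots,h_p]|:\|h_i\|\le1\}$; $H_{f,p}(\nu)=\sup_{x\ne y}\|D^pf(x)-D^pf(y)\|/\|x-y\|^\nu$. **Regularized problem.** Fix $x_0\in\mathbb{E}$, $\delta>0$. Let $F_\delta(x)=f(x)+\frac{\delta}{p+\nu}\|x-x_0\|^{p+\nu}$ and $\tilde F_\delta=F_\delta+\varphi$. Let $C_{p,\nu}=2\prod_{i=1}^p(\nu+i)$, $H_{F_\delta,p}(\nu)=H_{f,p}(\nu)+\frac{\delta}{p+\nu}C_{p,\nu}$ (a Hölder constant of $D^pF_\delta$), and, for $\theta\ge0$, $H_\delta=p\left(H_{F_\delta,p}(\nu)+3\theta(p-1)!\right)$. Models: $\Omega_y(x)=F_\delta(y)+\sum_{i=1}^p\frac1{i!}D^iF_\delta(y)[x-y]^i+\frac{H_\delta}{p!}\|x-y\|^{p+\nu}$ and $\tilde\Omega_y=\Omega_y+\varphi$. **Algorithm 5** (applied to $\min\tilde F_\delta$ from a starting point $w_0$; the center $x_0$ in $F_\delta$ stays fixed). Set $\psi_0(x)=\frac{1}{p+\nu}\|x-w_0\|^{p+\nu}$,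 $v_0=w_0$, $A_0=0$. For $t=0,1,\ldots$ (one iteration each): compute $a_t>0$ solving $a_t^{p+\nu}=\frac{1}{2^{3p-1}}\left[\frac{(p-1)!}{H_\delta}\right](A_t+a_t)^{p+\nu-1}$; set $A_{t+1}=A_t+a_t$, $\gamma_t=a_t/A_{t+1}$, $\eta_t=(1-\gamma_t)w_t+\gamma_tv_t$; compute $w_{t+1}$ with $\tilde\Omega_{\eta_t}(w_{t+1})\le\tilde F_\delta(\eta_t)$ and $\|\nabla\Omega_{\eta_t}(w_{t+1})+g_\varphi(w_{t+1})\|_*\le\theta\|w_{t+1}-\eta_t\|^{p+\nu-1}$ for some $g_\varphi(w_{t+1})\in\partial\varphi(w_{t+1})$; set $\psi_{t+1}(x)=\psi_t(x)+a_t[F_\delta(w_{t+1})+\langle\nabla F_\delta(w_{t+1}),x-w_{t+1}\rangle+\varphi(x)]$ and $v_{t+1}=\arg\min_x\psi_{t+1}(x)$. **Algorithm 6.** Step 0: given $x_0$, $\epsilon\in(0,1)$, $\theta\ge0$, $\delta>0$, let $$m=1+\left\lceil\left(\frac{2^{4p+\nu-2}(p+\nu)^{p+\nu}H_\delta}{\delta(p-1)!}\right)^{\frac{1}{p+\nu}}\right\rceil,$$ $y_0=u_0=x_0$, $k:=0$. Step 1: if $k>0$ and $\|\nabla\tilde F_\delta(u_k)\|_*\le\epsilon/2$, stop. Step 2: run $m$ iterations of Algorithm 5 from $w_0=y_k$. Step 3: set $y_{k+1}=w_m$ and compute $u_{k+1}$ with $\tilde\Omega_{y_{k+1}}(u_{k+1})\le\tilde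 F_\delta(y_{k+1})$ and $\|\nabla\Omega_{y_{k+1}}(u_{k+1})+g_\varphi(u_{k+1})\|_*\le\theta\|u_{k+1}-y_{k+1}\|^{p+\nu-1}$ for some $g_\varphi(u_{k+1})\in\partial\varphi(u_{k+1})$. Step 4: $k:=k+1$, go to Step 1. **Convention.** For $k\ge1$, with $g_\varphi(u_k)$ from Step 3, $\nabla\tilde F_\delta(u_k)=\nabla F_\delta(u_k)+g_\varphi(u_k)$ and $\nabla\tilde f(u_k)=\nabla f(u_k)+g_\varphi(u_k)$. $u_T$ is the point at which Algorithm 6 stops.
   Formalization: For ν = 0 and p odd, the p-th derivative of the regularizing term at x₀ does not exist, so the model Ω at x₀ is undefined; there the regularizer's p-th derivative is taken to be 0, while D^p f(x₀) is kept. All other cases are as stated. *)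

theory Defs
  imports "HOL-Analysis.Analysis"
begin

(* The space is a finite-dimensional linear subspace E of an arbitrary ambient type 'a rather
   than a whole type of class euclidean_space.  Constants that must not depend on the dimension
   can then be quantified before E: at an infinite-dimensional 'a, one statement covers all
   dimensions at once.  The ambient inner product serves only to supply the (unique) vector
   topology of E; all norms below are those induced by B.

   Elements of the dual of E are represented by functions 'a => real, of which only the values
   on E matter. *)

definition finite_dim_subspace :: "'a::real_vector set \<Rightarrow> bool" where
  "finite_dim_subspace E \<longleftrightarrow> (\<exists>b. finite b \<and> E = span b)"

(* B x is a functional, so B x y stands for the pairing of B x with y.  Any bilinear form on E
   extends to 'a, so bilinearity on all of 'a is no restriction. *)
definition pos_def_operator :: "'a::real_vector set \<Rightarrow> ('a \<Rightarrow> 'a \<Rightarrow> real) \<Rightarrow> bool" where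
  "pos_def_operator E B \<longleftrightarrow> bilinear B \<and> (\<forall>x\<in>E. \<forall>y\<in>E. B x y = B y x)
     \<and> (\<forall>x\<in>E. x \<noteq> 0 \<longrightarrow> 0 < B x x)"

definition nrm :: "('a \<Rightarrow> 'a \<Rightarrow> real) \<Rightarrow> 'a \<Rightarrow> real" where
  "nrm B x = sqrt (B x x)"

definition B_inv :: "'a set \<Rightarrow> ('a \<Rightarrow> 'a \<Rightarrow> real) \<Rightarrow> ('a \<Rightarrow> real) \<Rightarrow> 'a" where
  "B_inv E B s = (THE x. x \<in> E \<and> (\<forall>y\<in>E. B x y = s y))"

definition dual_nrm :: "'a set \<Rightarrow> ('a \<Rightarrow> 'a \<Rightarrow> real) \<Rightarrow> ('a \<Rightarrow> real) \<Rightarrow> real" where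
  "dual_nrm E B s = sqrt (s (B_inv E B s))"

definition grad :: "'a::real_inner set \<Rightarrow> ('a \<Rightarrow> real) \<Rightarrow> 'a \<Rightarrow> 'a \<Rightarrow> real" where
  "grad E f x = frechet_derivative f (at x within E)"

(* dderiv E f [h1,...,hi] x is D^i f(x)[h1,...,hi], with the value 0 where a derivative does
   not exist. *)
primrec dderiv :: "'a::real_inner set \<Rightarrow> ('a \<Rightarrow> real) \<Rightarrow> 'a list \<Rightarrow> 'a \<Rightarrow> real" where
  "dderiv E f [] = f"
| "dderiv E f (h # hs) = (\<lambda>x. if dderiv E f hs differentiable (at x within E)
     then frechet_derivative (dderiv E f hs) (at x within E) h else 0)"

(* E is finite-dimensional, so (Frechet) differentiability of the form-valued map
   x |-> D^i f(x) amounts to that of its evaluations at fixed arguments. *)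
definition times_differentiable :: "'a::real_inner set \<Rightarrow> nat \<Rightarrow> ('a \<Rightarrow> real) \<Rightarrow> bool" where
  "times_differentiable E p f \<longleftrightarrow> (\<forall>hs x. set hs \<subseteq> E \<and> length hs < p \<and> x \<in> E
     \<longrightarrow> dderiv E f hs differentiable (at x within E))"

(* p-linear forms are functions on argument lists of length p. *)
definition form_nrm ::
    "'a set \<Rightarrow> ('a \<Rightarrow> 'a \<Rightarrow> real) \<Rightarrow> nat \<Rightarrow> ('a list \<Rightarrow> real) \<Rightarrow> real" where
  "form_nrm E B p A = (SUP hs\<in>{hs. length hs = p \<and> set hs \<subseteq> {h \<in> E. nrm B h \<le> 1}}. \<bar>A hs\<bar>)"

definition holder :: "'a::real_inner set \<Rightarrow> ('a \<Rightarrow> 'a \<Rightarrow> real) \<Rightarrow> ('a \<Rightarrow> real)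
    \<Rightarrow> nat \<Rightarrow> real \<Rightarrow> ennreal" where
  "holder E B f p \<nu> = (SUP (x, y)\<in>{(x, y). x \<in> E \<and> y \<in> E \<and> x \<noteq> y}.
     ennreal (form_nrm E B p (\<lambda>hs. dderiv E f hs x - dderiv E f hs y) / nrm B (x - y) powr \<nu>))"

definition eff_dom :: "'a set \<Rightarrow> ('a \<Rightarrow> ereal) \<Rightarrow> 'a set" where
  "eff_dom E \<phi> = {x \<in> E. \<phi> x < \<infinity>}"

definition epi :: "'a set \<Rightarrow> ('a \<Rightarrow> ereal) \<Rightarrow> ('a \<times> real) set" where
  "epi E \<phi> = {(x, r). x \<in> E \<and> \<phi> x \<le> ereal r}"

definition closed_convex_fun :: "'a::real_inner set \<Rightarrow> ('a \<Rightarrow> ereal) \<Rightarrow> bool" where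
  "closed_convex_fun E \<phi> \<longleftrightarrow> (\<forall>x\<in>E. \<phi> x \<noteq> -\<infinity>) \<and> convex (epi E \<phi>)
     \<and> closedin (top_of_set (E \<times> UNIV)) (epi E \<phi>)"

definition subdiff :: "'a::real_vector set \<Rightarrow> ('a \<Rightarrow> ereal) \<Rightarrow> 'a \<Rightarrow> ('a \<Rightarrow> real) set" where
  "subdiff E \<phi> x = {g. linear g \<and> x \<in> eff_dom E \<phi> \<and> (\<forall>z\<in>E. \<phi> x + ereal (g (z - x)) \<le> \<phi> z)}"

definition C_const :: "nat \<Rightarrow> real \<Rightarrow> real" where
  "C_const p \<nu> = 2 * (\<Prod>i=1..p. \<nu> + real i)"

definition composite :: "('a \<Rightarrow> real) \<Rightarrow> ('a \<Rightarrow> ereal) \<Rightarrow> 'a \<Rightarrow> ereal" where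
  "composite f \<phi> x = ereal (f x) + \<phi> x"

context
  fixes E :: "'a::real_inner set" and B :: "'a \<Rightarrow> 'a \<Rightarrow> real"
    and f :: "'a \<Rightarrow> real" and \<phi> :: "'a \<Rightarrow> ereal"
    and p :: nat and \<nu> \<theta> \<delta> :: real and x0 :: 'a
begin

definition F_reg :: "'a \<Rightarrow> real" where
  "F_reg x = f x + \<delta> / (real p + \<nu>) * nrm B (x - x0) powr (real p + \<nu>)"

(* F_deriv i y h is D^i F_reg(y)[h]^i.  It is written as a sum because for \<nu> = 0, p odd and
   y = x0 the p-th derivative of the regularizing term does not exist; in this case that term
   contributes 0 by the convention of dderiv, while D^p f(x0) is kept.  In all other cases the
   sum is the i-th derivative of F_reg. *)
definition F_deriv :: "nat \<Rightarrow> 'a \<Rightarrow> 'a \<Rightarrow> real" where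
  "F_deriv i y h = dderiv E f (replicate i h) y
     + \<delta> / (real p + \<nu>) * dderiv E (\<lambda>x. nrm B (x - x0) powr (real p + \<nu>)) (replicate i h) y"

definition H_F :: real where
  "H_F = enn2real (holder E B f p \<nu>) + \<delta> / (real p + \<nu>) * C_const p \<nu>"

definition H_reg :: real where
  "H_reg = real p * (H_F + 3 * \<theta> * fact (p - 1))"

definition Omega :: "'a \<Rightarrow> 'a \<Rightarrow> real" where
  "Omega y x = F_reg y + (\<Sum>i=1..p. F_deriv i y (x - y) / fact i)
     + H_reg / fact p * nrm B (x - y) powr (real p + \<nu>)"

(* x is an admissible approximate minimizer of the model around y, certified by the
   subgradient g. *)
definition model_step :: "'a \<Rightarrow> 'a \<Rightarrow> ('a \<Rightarrow> real) \<Rightarrow> bool" where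
  "model_step y x g \<longleftrightarrow> x \<in> E \<and> g \<in> subdiff E \<phi> x
     \<and> composite (Omega y) \<phi> x \<le> composite F_reg \<phi> y
     \<and> dual_nrm E B (\<lambda>h. grad E (Omega y) x h + g h)
         \<le> \<theta> * nrm B (x - y) powr (real p + \<nu> - 1)"

(* w' is a possible value of the iterate w_m when Algorithm 5 is started at w0. *)
definition alg5 :: "nat \<Rightarrow> 'a \<Rightarrow> 'a \<Rightarrow> bool" where
  "alg5 m w0 w' \<longleftrightarrow> (\<exists>w v a A \<psi>.
     w 0 = w0 \<and> v 0 = w0 \<and> A 0 = (0::real)
     \<and> \<psi> 0 = (\<lambda>x. ereal (1 / (real p + \<nu>) * nrm B (x - w0) powr (real p + \<nu>)))
     \<and> (\<forall>t<m.
          0 < a t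
        \<and> a t powr (real p + \<nu>)
            = 1 / 2 ^ (3 * p - 1) * (fact (p - 1) / H_reg) * (A t + a t) powr (real p + \<nu> - 1)
        \<and> A (Suc t) = A t + a t
        \<and> (let \<gamma> = a t / A (Suc t); \<eta> = (1 - \<gamma>) *\<^sub>R w t + \<gamma> *\<^sub>R v t
           in \<exists>g. model_step \<eta> (w (Suc t)) g)
        \<and> \<psi> (Suc t) = (\<lambda>x. \<psi> t x + ereal (a t) *
             (ereal (F_reg (w (Suc t)) + grad E F_reg (w (Suc t)) (x - w (Suc t))) + \<phi> x))
        \<and> is_arg_min (\<psi> (Suc t)) (\<lambda>x. x \<in> E) (v (Suc t)))
     \<and> w' = w m)"

definition alg6_m :: nat where
  "alg6_m = 1 + nat \<lceil>(2 powr (4 * real p + \<nu> - 2) * (real p + \<nu>) powr (real p + \<nu>) * H_reg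
     / (\<delta> * fact (p - 1))) powr (1 / (real p + \<nu>))\<rceil>"

definition alg6_stop :: "real \<Rightarrow> (nat \<Rightarrow> 'a) \<Rightarrow> (nat \<Rightarrow> 'a \<Rightarrow> real) \<Rightarrow> nat \<Rightarrow> bool" where
  "alg6_stop \<epsilon> u g k \<longleftrightarrow> 0 < k \<and> dual_nrm E B (\<lambda>h. grad E F_reg (u k) h + g k h) \<le> \<epsilon> / 2"

(* An execution of Algorithm 6, g k being the subgradient g_\<phi>(u_k) of Step 3.  Steps 2 and 3
   are carried out in round k exactly as long as the test of Step 1 has not succeeded up to k;
   the sequences are unconstrained afterwards. *)
definition alg6_run ::
    "real \<Rightarrow> (nat \<Rightarrow> 'a) \<Rightarrow> (nat \<Rightarrow> 'a) \<Rightarrow> (nat \<Rightarrow> 'a \<Rightarrow> real) \<Rightarrow> bool" where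
  "alg6_run \<epsilon> y u g \<longleftrightarrow> y 0 = x0 \<and> u 0 = x0
     \<and> (\<forall>k. (\<forall>j\<le>k. \<not> alg6_stop \<epsilon> u g j) \<longrightarrow>
          alg5 alg6_m (y k) (y (Suc k)) \<and> model_step (y (Suc k)) (u (Suc k)) (g (Suc k)))"

(* T is the value of the counter k at which the execution stops; alg6_m iterations of
   Algorithm 5 have been performed in each of the rounds 0, ..., T - 1. *)
definition alg6_stops_at :: "real \<Rightarrow> (nat \<Rightarrow> 'a) \<Rightarrow> (nat \<Rightarrow> 'a \<Rightarrow> real) \<Rightarrow> nat \<Rightarrow> bool" where
  "alg6_stops_at \<epsilon> u g T \<longleftrightarrow> alg6_stop \<epsilon> u g T \<and> (\<forall>j<T. \<not> alg6_stop \<epsilon> u g j)"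

definition alg5_iterations :: "nat \<Rightarrow> nat" where
  "alg5_iterations T = T * alg6_m"

end

definition delta_choice :: "nat \<Rightarrow> real \<Rightarrow> real \<Rightarrow> real \<Rightarrow> real" where
  "delta_choice p \<nu> S \<epsilon> =
     (\<epsilon> / (2 powr (real p + \<nu>)
        * (2 powr (real p + \<nu> - 2) * (real p + \<nu>) * S) powr ((real p + \<nu> - 1) / (real p + \<nu>))))
     powr (real p + \<nu>)"

end

(* Write s = p + nu and F for the regularized smooth part.  The model step gives, for the composite
   gradient G at the new point w, the estimate |G + kappa r^(s-2) B(w - eta)| <= kappa' r^(s-1) with
   r = |w - eta|, where kappa' comes from the Taylor remainder of grad F and from the inexactness
   theta, and kappa >= 2 kappa'.  Hence <G, eta - w> >= (kappa/2) r^s and |G| <= (3/2) kappa r^(s-1).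
   By Young's inequality these two bounds, together with the uniform convexity of |x|^s, make the
   estimate sequence work, so m steps from y bring the objective gap below |x - y|^s / (s A_m) with
   A_m of order m^s.  The regularizer makes the objective uniformly convex of degree s, so with the
   chosen m each restart halves the gap; since the gradient norm after a model step is at most of
   order gap^((s-1)/s), logarithmically many restarts suffice, and the choice of delta keeps the
   gradient of the regularizer below epsilon / 2.

   The Taylor remainder of |x|^s needs the Hoelder constant of its p-th derivative.  In a plane,
   |x|^s is a multiple of the average of |<x, w>|^s over unit vectors w, which reduces the question
   to the real function |t|^s.

   A minimizer of the regularized objective is never used: points x with F(x) close to the infimum
   suffice, and the error is removed in a limit. *)
theory Submission
  imports Defs
begin

section \<open>Linear algebra and differentiation on the subspace\<close>

text \<open>The two parts of \<open>C_const\<close> have separate origins: the product is what p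
  differentiations of t^s leave in front, and the 2 is the Hoelder constant of a signed power on the
  line. Both pass to the plane unchanged because the averaging is sharp: by Young, the weight
  |cos|^(s-1) |<h, w>| integrates to at most the normalizing constant times |h|. The remainder of a
  gradient involves only mixed values D^p[d, ..., d, h], and h travels through the average as a test
  vector, so the mixed bound comes out directly.

  The obstacle is \<nu> = 0, where |x|^p has no p-th derivative at its centre for odd p. The Taylor
  argument therefore accepts a substitute for the top coefficient.

  The regularizer has two opposing effects. Its uniform convexity, proportional to \<delta>, bounds
  distances by gaps and fixes a restart length of order \<delta>^(-1/s); its gradient is a bias of
  order \<delta>^(1/s). Taking \<delta>^(1/s) of order \<epsilon> / S^((s-1)/s) makes the bias
  admissible, and the reciprocal is the main factor of the count.\<close>

text \<open>Gram-Schmidt inside an induction on the generators: the induction hypothesis, applied to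
  \<open>B a\<close>, yields the B-projection q of the new generator, and a - q is orthogonal to the
  old span. Either it vanishes and the span has not grown, or it supplies one new orthogonal
  direction.\<close>

lemma riesz_span:
  fixes B :: "'a::real_vector \<Rightarrow> 'a \<Rightarrow> real"
  assumes "finite b" and bil: "bilinear B"
    and "\<forall>x\<in>span b. \<forall>y\<in>span b. B x y = B y x"
    and "\<forall>x\<in>span b. x \<noteq> 0 \<longrightarrow> 0 < B x x"
    and "linear g"
  shows "\<exists>z\<in>span b. \<forall>y\<in>span b. B z y = g y"
  using assms(1,3,4,5)
proof (induction b arbitrary: g rule: finite_induct)
  case empty
  then show ?case
    using linear_0[OF \<open>linear g\<close>] bilinear_lzero[OF bil] by (auto simp: span_empty)
next
  case (insert a b)
  have sub: "span b \<subseteq> span (insert a b)"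
    by (intro span_mono) auto
  have sym: "\<forall>x\<in>span b. \<forall>y\<in>span b. B x y = B y x"
    and pos: "\<forall>x\<in>span b. x \<noteq> 0 \<longrightarrow> 0 < B x x"
    using insert.prems(1,2) sub by (meson subsetD)+
  obtain z0 where z0: "z0 \<in> span b" "\<forall>y\<in>span b. B z0 y = g y"
    using insert.IH[OF sym pos insert.prems(3)] by blast
  have "linear (B a)" using bil by (simp add: bilinear_def)
  from insert.IH[OF sym pos this] obtain q
    where q: "q \<in> span b" "\<forall>y\<in>span b. B q y = B a y"
    by blast
  define a' where "a' = a - q"
  have a'_in: "a' \<in> span (insert a b)"
    unfolding a'_def using q(1) sub by (meson insertI1 span_base span_diff subsetD)
  have orth: "B a' y = 0" if "y \<in> span b" for y
    using q(2) that by (simp add: a'_def bilinear_lsub[OF bil])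
  show ?case
  proof (cases "a' = 0")
    case True
    then have "span (insert a b) = span b"
      using q(1) by (simp add: a'_def span_redundant)
    show ?thesis unfolding \<open>span (insert a b) = span b\<close> using z0 by blast
  next
    case False
    then have pos': "0 < B a' a'" using insert.prems(2) a'_in by auto
    have z0a: "B z0 a' = 0"
      using orth[OF z0(1)] insert.prems(1) z0(1) sub a'_in by (metis subsetD)
    \<comment> \<open>The value of g on the new direction is matched by t; orthogonality leaves the
      values on the old span untouched.\<close>
    define t where "t = g a' / B a' a'"
    show ?thesis
    proof (intro bexI ballI)
      fix y assume "y \<in> span (insert a b)"
      then obtain k where "y - k *\<^sub>R a \<in> span b"
        by (meson span_breakdown_eq)
      then have k: "y - k *\<^sub>R a + k *\<^sub>R q \<in> span b"
        using q(1) by (simp add: span_add span_scale)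
      define y0 where "y0 = y - k *\<^sub>R a + k *\<^sub>R q"
      have y: "y = y0 + k *\<^sub>R a'"
        by (simp add: y0_def a'_def algebra_simps)
      have "y0 \<in> span b" using k by (simp add: y0_def)
      with z0 orth z0a pos' show "B (z0 + t *\<^sub>R a') y = g y"
        by (simp add: y t_def bilinear_ladd[OF bil] bilinear_radd[OF bil] bilinear_lmul[OF bil]
            bilinear_rmul[OF bil] linear_add[OF \<open>linear g\<close>] linear_cmul[OF \<open>linear g\<close>])
    next
      show "z0 + t *\<^sub>R a' \<in> span (insert a b)"
        using z0(1) a'_in sub by (meson span_add span_scale subsetD)
    qed
  qed
qed

section \<open>Inner product, Riesz representation and dual norm on the subspace\<close>

locale euclid =
  fixes E :: "'a::real_inner set" and B :: "'a \<Rightarrow> 'a \<Rightarrow> real"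
  assumes fd: "finite_dim_subspace E" and pd: "pos_def_operator E B"
begin

abbreviation N :: "'a \<Rightarrow> real" where "N \<equiv> nrm B"

lemma subE: "subspace E"
  using fd by (auto simp: finite_dim_subspace_def)

lemma E_add [intro, simp]: "x \<in> E \<Longrightarrow> y \<in> E \<Longrightarrow> x + y \<in> E"
  and E_diff [intro, simp]: "x \<in> E \<Longrightarrow> y \<in> E \<Longrightarrow> x - y \<in> E"
  and E_scale [intro, simp]: "x \<in> E \<Longrightarrow> c *\<^sub>R x \<in> E"
  and E_zero [intro, simp]: "0 \<in> E"
  and E_neg [intro, simp]: "x \<in> E \<Longrightarrow> - x \<in> E"
  using subE by (simp_all add: subspace_add subspace_diff subspace_scale subspace_0 subspace_neg)

lemma E_sum [intro, simp]: "(\<And>i. i \<in> I \<Longrightarrow> x i \<in> E) \<Longrightarrow> sum x I \<in> E"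
  by (rule subspace_sum[OF subE])

lemma bil: "bilinear B"
  using pd by (simp add: pos_def_operator_def)

lemmas B_simps = bilinear_ladd[OF bil] bilinear_radd[OF bil] bilinear_lmul[OF bil]
  bilinear_rmul[OF bil] bilinear_lsub[OF bil] bilinear_rsub[OF bil] bilinear_lneg[OF bil]
  bilinear_rneg[OF bil] bilinear_lzero[OF bil] bilinear_rzero[OF bil]

lemma linear_B: "linear (B x)" and linear_B': "linear (\<lambda>x. B x y)"
  using bil by (auto simp: bilinear_def)

lemma B_sym: "x \<in> E \<Longrightarrow> y \<in> E \<Longrightarrow> B x y = B y x"
  using pd by (simp add: pos_def_operator_def)

lemma B_pos: "x \<in> E \<Longrightarrow> x \<noteq> 0 \<Longrightarrow> 0 < B x x"
  using pd by (simp add: pos_def_operator_def)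

lemma B_nonneg: "x \<in> E \<Longrightarrow> 0 \<le> B x x"
  using B_pos[of x] by (cases "x = 0") (auto simp: B_simps)

lemma N_sq: "x \<in> E \<Longrightarrow> (N x)\<^sup>2 = B x x"
  by (simp add: nrm_def B_nonneg)

lemma N_nonneg [simp]: "x \<in> E \<Longrightarrow> 0 \<le> N x"
  by (simp add: nrm_def B_nonneg)

lemma N_pos: "x \<in> E \<Longrightarrow> x \<noteq> 0 \<Longrightarrow> 0 < N x"
  by (simp add: nrm_def B_pos)

lemma N_zero [simp]: "N 0 = 0"
  by (simp add: nrm_def B_simps)

lemma N_eq_0: "x \<in> E \<Longrightarrow> N x = 0 \<longleftrightarrow> x = 0"
  by (metis N_pos N_zero order_less_irrefl)

lemma N_scale: "N (c *\<^sub>R x) = \<bar>c\<bar> * N x"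
  by (simp add: nrm_def B_simps real_sqrt_mult flip: mult.assoc)

lemma N_neg [simp]: "N (- x) = N x"
  using N_scale[of "-1" x] by simp

lemma N_minus_commute: "N (x - y) = N (y - x)"
  using N_neg[of "x - y"] by simp

lemma N_expand: "x \<in> E \<Longrightarrow> y \<in> E \<Longrightarrow> (N (x + y))\<^sup>2 = (N x)\<^sup>2 + 2 * B x y + (N y)\<^sup>2"
  by (simp add: N_sq E_add) (simp add: B_simps B_sym[of y x])

lemma B_cauchy_schwarz:
  assumes "x \<in> E" "y \<in> E" shows "\<bar>B x y\<bar> \<le> N x * N y"
proof (cases "y = 0")
  case True then show ?thesis by (simp add: B_simps)
next
  case False
  have Ny: "0 < N y" "0 < B y y" using N_pos B_pos assms False by auto
  have "0 \<le> B (x - (B x y / B y y) *\<^sub>R y) (x - (B x y / B y y) *\<^sub>R y)"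
    using assms by (intro B_nonneg) auto
  also have "\<dots> = B x x - (B x y)\<^sup>2 / B y y"
    using Ny B_sym[OF assms] by (simp add: B_simps field_simps power2_eq_square)
  finally have "(B x y)\<^sup>2 \<le> B x x * B y y"
    using Ny by (simp add: field_simps)
  then have "(B x y)\<^sup>2 \<le> (N x * N y)\<^sup>2"
    using assms by (simp add: N_sq power_mult_distrib)
  then show ?thesis
    using assms by (simp add: power2_le_iff_abs_le)
qed

lemma N_triangle: assumes "x \<in> E" "y \<in> E" shows "N (x + y) \<le> N x + N y"
proof -
  have "(N (x + y))\<^sup>2 \<le> (N x + N y)\<^sup>2"
  proof -
    have "B x y \<le> N x * N y" using B_cauchy_schwarz[OF assms] by (rule order_trans[OF abs_ge_self])
    then have "(N x)\<^sup>2 + 2 * B x y + (N y)\<^sup>2 \<le> (N x)\<^sup>2 + (N y)\<^sup>2 + 2 * N x * N y"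
      by (simp add: mult.assoc)
    then show ?thesis by (simp only: N_expand[OF assms] power2_sum)
  qed
  then show ?thesis
    by (rule power2_le_imp_le) (use assms in simp)
qed

lemma N_triangle_diff: assumes "x \<in> E" "y \<in> E" shows "\<bar>N x - N y\<bar> \<le> N (x - y)"
  using N_triangle[of "x - y" y] N_triangle[of "y - x" x] assms N_minus_commute[of x y]
  by (simp add: E_diff abs_le_iff)

lemma riesz: assumes "linear g" obtains z where "z \<in> E" "\<And>y. y \<in> E \<Longrightarrow> B z y = g y"
proof -
  obtain b where "finite b" "E = span b" using fd by (auto simp: finite_dim_subspace_def)
  then show ?thesis
    using riesz_span[OF _ bil, of b g] that assms B_sym B_pos by blast
qed

lemma B_inv:
  assumes "linear g"
  shows "B_inv E B g \<in> E" "\<And>y. y \<in> E \<Longrightarrow> B (B_inv E B g) y = g y"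
proof -
  obtain z where z: "z \<in> E" "\<And>y. y \<in> E \<Longrightarrow> B z y = g y" using riesz[OF assms] by blast
  have "B_inv E B g = z"
    unfolding B_inv_def
  proof (rule the_equality)
    fix x assume x: "x \<in> E \<and> (\<forall>y\<in>E. B x y = g y)"
    then have "B (x - z) (x - z) = 0" using z by (simp add: B_simps E_diff)
    then show "x = z" using B_pos[of "x - z"] x z(1) by fastforce
  qed (use z in auto)
  with z show "B_inv E B g \<in> E" "\<And>y. y \<in> E \<Longrightarrow> B (B_inv E B g) y = g y" by auto
qed

lemma dual_nrm_eq: assumes "linear g" shows "dual_nrm E B g = N (B_inv E B g)"
  using B_inv[OF assms] by (simp add: dual_nrm_def nrm_def)

lemma dual_nrm_nonneg: "linear g \<Longrightarrow> 0 \<le> dual_nrm E B g"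
  by (simp add: dual_nrm_eq B_inv)

lemma dual_nrm_bound: assumes "linear g" "h \<in> E" shows "\<bar>g h\<bar> \<le> dual_nrm E B g * N h"
  using B_cauchy_schwarz[OF B_inv(1)[OF assms(1)] assms(2)] B_inv(2)[OF assms]
  by (simp add: dual_nrm_eq assms)

text \<open>The dual norm is attained at the Riesz representer of g, so a one-sided bound tested at
  that single vector is enough.\<close>

lemma dual_nrm_le:
  assumes "linear g" "0 \<le> M" "\<And>h. h \<in> E \<Longrightarrow> g h \<le> M * N h"
  shows "dual_nrm E B g \<le> M"
proof -
  let ?z = "B_inv E B g"
  have z: "?z \<in> E" "(N ?z)\<^sup>2 = g ?z" using B_inv[OF assms(1)] by (auto simp: N_sq)
  then have "N ?z * N ?z \<le> M * N ?z" using assms(3)[of ?z] by (simp add: power2_eq_square)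
  then show ?thesis
    using assms z by (cases "N ?z = 0") (auto simp: dual_nrm_eq mult_le_cancel_right dest: leD N_nonneg)
qed

text \<open>The bridge from the algebra of E to the ambient topology: a basis orthogonal for the
  ambient inner product has coordinate functionals that are bounded on the whole space. A zero
  vector in C is harmless, since its quotient is 0 by the convention on division.\<close>

lemma coords:
  obtains C and c :: "'a \<Rightarrow> 'a \<Rightarrow> real"
  where "finite C" "C \<subseteq> E" "\<And>b. bounded_linear (c b)" "\<And>x. x \<in> E \<Longrightarrow> x = (\<Sum>b\<in>C. c b x *\<^sub>R b)"
proof -
  obtain b where "finite b" "E = span b" using fd by (auto simp: finite_dim_subspace_def)
  then obtain C where C: "finite C" "span C = E" "pairwise orthogonal C"
    using basis_orthogonal[of b] by auto
  have eq: "x = (\<Sum>b\<in>C. (x \<bullet> b / (b \<bullet> b)) *\<^sub>R b)" if "x \<in> E" for x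
  proof -
    define s where "s = (\<Sum>b\<in>C. (x \<bullet> b / (b \<bullet> b)) *\<^sub>R b)"
    have y: "x - s \<in> span C"
      unfolding s_def using that C by (intro span_diff span_sum span_scale) (auto intro: span_base)
    have orth: "orthogonal (x - s) d" if d: "d \<in> C" for d
    proof -
      have "s \<bullet> d = (\<Sum>b\<in>C. if b = d then x \<bullet> d else 0)"
        unfolding inner_sum_left s_def
        using C(3) d by (intro sum.cong) (auto simp: pairwise_def orthogonal_def)
      then show ?thesis using C(1) d by (simp add: inner_diff_left orthogonal_def)
    qed
    have "orthogonal (x - s) (x - s)"
      by (rule orthogonal_to_span[OF y orth])
    then show ?thesis by (simp add: orthogonal_self s_def)
  qed
  show ?thesis
  proof (rule that[of C "\<lambda>b x. x \<bullet> b / (b \<bullet> b)"])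
    show "bounded_linear (\<lambda>x. x \<bullet> b / (b \<bullet> b))" for b :: 'a
      by (rule bounded_linear_compose[OF bounded_linear_divide bounded_linear_inner_left])
    show "finite C" "C \<subseteq> E" using C(1,2) span_superset by auto
  qed (rule eq)
qed

text \<open>A linear functional on the ambient space need not be continuous off \<open>E\<close>.\<close>
lemma linear_restrict:
  assumes "linear (g :: 'a \<Rightarrow> real)"
  obtains g' where "bounded_linear g'" "\<And>x. x \<in> E \<Longrightarrow> g' x = g x"
proof -
  obtain C c where C: "finite C" "C \<subseteq> E" "\<And>b. bounded_linear (c b :: 'a \<Rightarrow> real)"
    "\<And>x. x \<in> E \<Longrightarrow> x = (\<Sum>b\<in>C. c b x *\<^sub>R b)"
    using coords by blast
  show ?thesis
  proof (rule that[of "\<lambda>x. \<Sum>b\<in>C. c b x * g b"])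
    show "bounded_linear (\<lambda>x. \<Sum>b\<in>C. c b x * g b)"
      by (intro bounded_linear_sum bounded_linear_mult_const C(3))
    show "(\<Sum>b\<in>C. c b x * g b) = g x" if "x \<in> E" for x
      by (subst (2) C(4)[OF that]) (simp add: linear_sum[OF assms] linear_cmul[OF assms])
  qed
qed

text \<open>Differentiability is measured with the ambient norm, estimates with \<open>N\<close>;
  this comparison turns the latter into the former.\<close>

lemma N_le_norm: obtains K where "0 < K" "\<And>x. x \<in> E \<Longrightarrow> N x \<le> K * norm x"
proof -
  obtain C c where C: "finite C" "C \<subseteq> E" "\<And>b. bounded_linear (c b :: 'a \<Rightarrow> real)"
    "\<And>x. x \<in> E \<Longrightarrow> x = (\<Sum>b\<in>C. c b x *\<^sub>R b)"
    using coords by blast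
  have tri: "N (\<Sum>b\<in>D. c b x *\<^sub>R b) \<le> (\<Sum>b\<in>D. onorm (c b) * N b) * norm x" if "D \<subseteq> C" for D x
    using finite_subset[OF that C(1)] that
  proof (induction D rule: finite_induct)
    case (insert d D)
    have "N (c d x *\<^sub>R d) \<le> onorm (c d) * N d * norm x"
      using onorm[OF C(3), of d x] insert.prems C(2) mult_right_mono[of "\<bar>c d x\<bar>" "onorm (c d) * norm x" "N d"]
      by (auto simp: N_scale mult_ac)
    moreover have "N (\<Sum>b\<in>insert d D. c b x *\<^sub>R b) \<le> N (c d x *\<^sub>R d) + N (\<Sum>b\<in>D. c b x *\<^sub>R b)"
      using insert C(2) by (auto intro!: N_triangle)
    ultimately show ?case using insert by (auto simp: algebra_simps)
  qed auto
  let ?K = "\<Sum>b\<in>C. onorm (c b) * N b"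
  have K: "0 \<le> ?K" using C by (intro sum_nonneg mult_nonneg_nonneg onorm_pos_le) auto
  show ?thesis
  proof (rule that[of "?K + 1"])
    fix x assume x: "x \<in> E"
    have "N x = N (\<Sum>b\<in>C. c b x *\<^sub>R b)" by (rule arg_cong[OF C(4)[OF x]])
    also have "\<dots> \<le> ?K * norm x" by (rule tri) simp
    finally have "N x \<le> ?K * norm x" .
    moreover have "(?K + 1) * norm x = ?K * norm x + norm x" by (simp only: distrib_right mult_1)
    ultimately show "N x \<le> (?K + 1) * norm x" using norm_ge_zero[of x] by linarith
  qed (use K in simp)
qed

section \<open>Derivatives along the subspace\<close>

text \<open>\<open>has_derivative\<close> asks for a linear map that is bounded on the ambient
  space, while natural formulas such as \<open>B (x - a)\<close> may be unbounded off E. Agreement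
  on E alone is what matters, so the bounded map is hidden behind an existential.\<close>

definition der :: "('a \<Rightarrow> real) \<Rightarrow> ('a \<Rightarrow> real) \<Rightarrow> 'a \<Rightarrow> bool" where
  "der G D x \<longleftrightarrow> (\<exists>D'. (G has_derivative D') (at x within E) \<and> (\<forall>h\<in>E. D' h = D h))"

lemma der_line:
  assumes "der G D (x + t *\<^sub>R d)" "x \<in> E" "d \<in> E"
  shows "((\<lambda>t. G (x + t *\<^sub>R d)) has_real_derivative D d) (at t)"
proof -
  obtain D' where D': "(G has_derivative D') (at (x + t *\<^sub>R d) within E)" "\<forall>h\<in>E. D' h = D h"
    using assms(1) by (auto simp: der_def)
  have "((\<lambda>t. x + t *\<^sub>R d) has_derivative (\<lambda>u. u *\<^sub>R d)) (at t)"
    by (auto intro!: derivative_eq_intros)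
  then have "((\<lambda>t. G (x + t *\<^sub>R d)) has_derivative (\<lambda>u. D' (u *\<^sub>R d))) (at t)"
  proof (rule has_derivative_in_compose)
    show "(G has_derivative D') (at (x + t *\<^sub>R d) within range (\<lambda>t. x + t *\<^sub>R d))"
      by (rule has_derivative_subset[OF D'(1)]) (use assms in auto)
  qed
  moreover have "(\<lambda>u. D' (u *\<^sub>R d)) = (*) (D d)"
    using D'(2) assms(3) linear_cmul[OF has_derivative_linear[OF D'(1)]] by (simp add: fun_eq_iff mult.commute)
  ultimately show ?thesis by (simp add: has_field_derivative_def)
qed

lemma der_line0:
  assumes "der G D x" "x \<in> E" "d \<in> E"
  shows "((\<lambda>t. G (x + t *\<^sub>R d)) has_real_derivative D d) (at 0)"
  using der_line[of G D x 0 d] assms by simp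

text \<open>E contains the whole line through x in direction h, so the value at h is an ordinary
  derivative in one variable. This pins down on E the otherwise arbitrary choice made by
  \<open>frechet_derivative\<close>.\<close>

lemma der_unique: "der G D x \<Longrightarrow> der G D' x \<Longrightarrow> x \<in> E \<Longrightarrow> h \<in> E \<Longrightarrow> D h = D' h"
  by (rule DERIV_unique[OF der_line0 der_line0])

lemma der_differentiable: "der G D x \<Longrightarrow> G differentiable (at x within E)"
  by (auto simp: der_def differentiable_def)

lemma der_frechet: "G differentiable (at x within E) \<Longrightarrow> der G (frechet_derivative G (at x within E)) x"
  by (auto simp: der_def frechet_derivative_works)

lemma frechet_der: "der G D x \<Longrightarrow> x \<in> E \<Longrightarrow> h \<in> E \<Longrightarrow> frechet_derivative G (at x within E) h = D h"
  by (rule der_unique[OF der_frechet[OF der_differentiable]])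

lemma der_cong:
  assumes "der G D x" "x \<in> E" "\<And>y. y \<in> E \<Longrightarrow> G y = G' y" "\<And>h. h \<in> E \<Longrightarrow> D h = D' h"
  shows "der G' D' x"
proof -
  obtain F where F: "(G has_derivative F) (at x within E)" "\<forall>h\<in>E. F h = D h"
    using assms(1) unfolding der_def by blast
  have "(G' has_derivative F) (at x within E)"
    by (rule has_derivative_transform[OF assms(2) _ F(1)]) (simp add: assms(3))
  with F(2) assms(4) show ?thesis unfolding der_def by auto
qed

lemma der_const: "der (\<lambda>_. c) (\<lambda>_. 0) x"
  unfolding der_def by (intro exI[of _ "\<lambda>_. 0"]) auto

lemma der_linear: assumes "linear g" "x \<in> E" shows "der g g x"
proof -
  obtain g' where g': "bounded_linear g'" "\<And>x. x \<in> E \<Longrightarrow> g' x = g x"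
    using linear_restrict[OF assms(1)] by blast
  show ?thesis
  proof (rule der_cong[of g' g'])
    show "der g' g' x"
      unfolding der_def by (intro exI[of _ g']) (simp add: bounded_linear_imp_has_derivative g'(1))
  qed (use g' assms(2) in auto)
qed

lemma der_add:
  assumes "der G D x" "der G' D' x" shows "der (\<lambda>x. G x + G' x) (\<lambda>h. D h + D' h) x"
proof -
  obtain F F' where F: "(G has_derivative F) (at x within E)" "\<forall>h\<in>E. F h = D h"
    and F': "(G' has_derivative F') (at x within E)" "\<forall>h\<in>E. F' h = D' h"
    using assms unfolding der_def by blast
  show ?thesis
    unfolding der_def using has_derivative_add[OF F(1) F'(1)] F(2) F'(2)
    by (intro exI[of _ "\<lambda>h. F h + F' h"]) simp
qed

lemma der_mult:
  assumes "der G D x" "der G' D' x" shows "der (\<lambda>x. G x * G' x) (\<lambda>h. G x * D' h + D h * G' x) x"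
proof -
  obtain F F' where F: "(G has_derivative F) (at x within E)" "\<forall>h\<in>E. F h = D h"
    and F': "(G' has_derivative F') (at x within E)" "\<forall>h\<in>E. F' h = D' h"
    using assms unfolding der_def by blast
  show ?thesis
    unfolding der_def using has_derivative_mult[OF F(1) F'(1)] F(2) F'(2)
    by (intro exI[of _ "\<lambda>h. G x * F' h + F h * G' x"]) simp
qed

lemma der_cmult: "der G D x \<Longrightarrow> der (\<lambda>x. c * G x) (\<lambda>h. c * D h) x"
  using der_mult[OF der_const[of c x]] by simp

lemma der_sum:
  assumes "\<And>i. i \<in> I \<Longrightarrow> der (G i) (D i) x"
  shows "der (\<lambda>x. \<Sum>i\<in>I. G i x) (\<lambda>h. \<Sum>i\<in>I. D i h) x"
  using assms by (induction I rule: infinite_finite_induct) (auto intro: der_const der_add)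

lemma der_chain:
  assumes "der G D x" "(f has_real_derivative f') (at (G x))"
  shows "der (\<lambda>x. f (G x)) (\<lambda>h. f' * D h) x"
proof -
  obtain F where F: "(G has_derivative F) (at x within E)" "\<forall>h\<in>E. F h = D h"
    using assms(1) unfolding der_def by blast
  have "((\<lambda>x. f (G x)) has_derivative (\<lambda>h. f' * F h)) (at x within E)"
    by (rule has_derivative_compose[OF F(1) assms(2)[unfolded has_field_derivative_def]])
  with F(2) show ?thesis unfolding der_def by (intro exI[of _ "\<lambda>h. f' * F h"]) simp
qed

lemma der_B: assumes "x \<in> E" "a \<in> E" shows "der (\<lambda>x. B (x - a) h) (\<lambda>v. B v h) x"
  using der_add[OF der_linear[OF linear_B' assms(1)] der_const[of "- B a h"]]
  by (simp add: B_simps)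

text \<open>B need not be bounded as a form on the ambient space. Expanding one argument in
  coordinates leaves a finite sum of products of differentiable functions.\<close>

lemma der_Bsq:
  assumes "x \<in> E" "a \<in> E" shows "der (\<lambda>x. B (x - a) (x - a)) (\<lambda>v. 2 * B (x - a) v) x"
proof -
  obtain C c where C: "finite C" "C \<subseteq> E" "\<And>b. bounded_linear (c b :: 'a \<Rightarrow> real)"
    "\<And>x. x \<in> E \<Longrightarrow> x = (\<Sum>b\<in>C. c b x *\<^sub>R b)"
    using coords by blast
  have lin: "linear (c b)" for b using C(3) bounded_linear.linear by blast
  have Bsum: "(\<Sum>b\<in>C. c b v * B w b) = B w v" if "v \<in> E" for v w
    by (subst (2) C(4)[OF that]) (simp add: linear_sum[OF linear_B] B_simps)
  have "der (\<lambda>x. c b (x - a)) (c b) x" for b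
    using der_add[OF der_linear[OF lin[of b] assms(1)] der_const[of "- c b a"]]
    by (simp add: linear_diff[OF lin])
  then have "der (\<lambda>x. \<Sum>b\<in>C. c b (x - a) * B (x - a) b)
     (\<lambda>v. \<Sum>b\<in>C. c b (x - a) * B v b + c b v * B (x - a) b) x"
    using assms by (intro der_sum der_mult der_B) auto
  then show ?thesis
    by (rule der_cong[OF _ assms(1)])
      (use assms B_sym in \<open>auto simp: Bsum E_diff sum.distrib\<close>)
qed

lemma der_N_powr:
  assumes "x \<in> E" "a \<in> E" "x \<noteq> a"
  shows "der (\<lambda>x. N (x - a) powr b) (\<lambda>v. b * N (x - a) powr (b - 2) * B (x - a) v) x"
proof -
  have pos: "0 < B (x - a) (x - a)" using assms by (intro B_pos) auto
  have eq: "N y powr c = B y y powr (c / 2)" if "y \<in> E" for y c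
    using B_nonneg[OF that] by (simp add: nrm_def powr_half_sqrt[symmetric] powr_powr)
  have "der (\<lambda>x. B (x - a) (x - a) powr (b/2))
     (\<lambda>v. (b/2 * B (x - a) (x - a) powr (b/2 - 1)) * (2 * B (x - a) v)) x"
    using pos assms by (intro der_chain[OF der_Bsq has_real_derivative_powr]) auto
  then show ?thesis
    by (rule der_cong[OF _ assms(1)]) (use assms in \<open>auto simp: eq E_diff diff_divide_distrib\<close>)
qed

text \<open>Supplies the derivative at the centre of a norm power, where the chain rule through the
  square root breaks down.\<close>

lemma der_zero_of_bound:
  assumes "a \<in> E" "1 < b" "\<And>x. x \<in> E \<Longrightarrow> \<bar>G x - G a\<bar> \<le> K * N (x - a) powr b"
  shows "der G (\<lambda>_. 0) a"
proof -
  obtain M where M: "0 < M" "\<And>x. x \<in> E \<Longrightarrow> N x \<le> M * norm x" using N_le_norm by blast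
  have "((\<lambda>y. \<bar>K\<bar> * (M * norm (y - a)) powr b / norm (y - a)) \<longlongrightarrow> 0) (at a within E)"
  proof (rule Lim_transform_eventually)
    have "((\<lambda>y. \<bar>K\<bar> * M powr b * norm (y - a) powr (b - 1)) \<longlongrightarrow> \<bar>K\<bar> * M powr b * 0) (at a within E)"
      using assms(2) by (intro tendsto_intros tendsto_eq_intros | simp)+
    then show "((\<lambda>y. \<bar>K\<bar> * M powr b * norm (y - a) powr (b - 1)) \<longlongrightarrow> 0) (at a within E)" by simp
    show "\<forall>\<^sub>F y in at a within E. \<bar>K\<bar> * M powr b * norm (y - a) powr (b - 1)
        = \<bar>K\<bar> * (M * norm (y - a)) powr b / norm (y - a)"
      unfolding eventually_at_topological using M(1)
      by (auto intro!: exI[of _ UNIV] simp: powr_mult powr_diff)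
  qed
  moreover have "\<forall>\<^sub>F y in at a within E. norm (norm ((G y - G a - 0) /\<^sub>R norm (y - a)))
       \<le> \<bar>K\<bar> * (M * norm (y - a)) powr b / norm (y - a)"
    unfolding eventually_at_topological
  proof (intro exI[of _ UNIV] conjI ballI impI)
    fix y assume y: "y \<in> E"
    have "\<bar>G y - G a\<bar> \<le> \<bar>K\<bar> * N (y - a) powr b"
      using assms(3)[OF y] by (smt (verit) mult_right_mono powr_ge_zero)
    also have "\<dots> \<le> \<bar>K\<bar> * (M * norm (y - a)) powr b"
      using M y assms by (intro mult_left_mono powr_mono2) auto
    finally show "norm (norm ((G y - G a - 0) /\<^sub>R norm (y - a))) \<le> \<bar>K\<bar> * (M * norm (y - a)) powr b / norm (y - a)"
      by (simp add: divide_inverse abs_mult mult.commute mult_left_mono)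
  qed auto
  ultimately have "((\<lambda>y. norm ((G y - G a - 0) /\<^sub>R norm (y - a))) \<longlongrightarrow> 0) (at a within E)"
    by (rule Lim_null_comparison[rotated])
  then have "(G has_derivative (\<lambda>_. 0)) (at a within E)"
    unfolding has_derivative_at_within by (rule conjI[OF bounded_linear_zero tendsto_norm_zero_cancel])
  then show ?thesis unfolding der_def by (intro exI[of _ "\<lambda>_. 0"]) simp
qed

lemma der_N_powr':
  assumes "x \<in> E" "a \<in> E" "1 < b"
  shows "der (\<lambda>x. N (x - a) powr b) (\<lambda>v. b * N (x - a) powr (b - 2) * B (x - a) v) x"
proof (cases "x = a")
  case True
  have "der (\<lambda>x. N (x - a) powr b) (\<lambda>_. 0) a"
    by (rule der_zero_of_bound[of _ b _ 1]) (use assms in auto)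
  with True show ?thesis by simp
qed (use der_N_powr assms in blast)

end

section \<open>Iterated directional derivatives and Taylor models\<close>

lemma powr_integral_bound:
  fixes f f' :: "real \<Rightarrow> real"
  assumes "0 \<le> a" "0 \<le> t" "t \<le> 1" "f 0 = 0"
    and der: "\<And>\<tau>. 0 \<le> \<tau> \<Longrightarrow> \<tau> \<le> 1 \<Longrightarrow> (f has_real_derivative f' \<tau>) (at \<tau>)"
    and bound: "\<And>\<tau>. 0 \<le> \<tau> \<Longrightarrow> \<tau> \<le> 1 \<Longrightarrow> \<bar>f' \<tau>\<bar> \<le> M * \<tau> powr a"
  shows "\<bar>f t\<bar> \<le> M * t powr (a + 1) / (a + 1)"
proof (cases "t = 0")
  case False
  then have t: "0 < t" using assms by simp
  have cont: "continuous_on {0..t} f"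
    using assms(3) by (intro continuous_at_imp_continuous_on ballI DERIV_isCont[OF der]) auto
  \<comment> \<open>Monotonicity of the majorant minus c f, for both signs c, replaces integration.
    It is tested on the open interval because the power may fail to be differentiable at 0.\<close>
  have aux: "c * f t \<le> M * t powr (a + 1) / (a + 1)" if c: "\<bar>c\<bar> = 1" for c :: real
  proof -
    let ?F = "\<lambda>\<tau>. M * \<tau> powr (a + 1) / (a + 1) - c * f \<tau>"
    have "?F 0 \<le> ?F t"
    proof (rule DERIV_nonneg_imp_increasing_open[OF less_imp_le[OF t]])
      fix \<tau> :: real assume \<tau>: "0 < \<tau>" "\<tau> < t"
      have "((\<lambda>\<tau>. \<tau> powr (a + 1)) has_real_derivative (a + 1) * \<tau> powr a) (at \<tau>)"
        using has_real_derivative_powr[of \<tau> "a + 1"] \<tau> by simp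
      then have "(?F has_real_derivative M * ((a + 1) * \<tau> powr a) / (a + 1) - c * f' \<tau>) (at \<tau>)"
        using \<tau> assms by (intro DERIV_diff DERIV_cmult DERIV_cdivide der) auto
      moreover have "\<bar>c * f' \<tau>\<bar> \<le> M * \<tau> powr a"
        using bound[of \<tau>] \<tau> assms c by (simp add: abs_mult)
      then have "0 \<le> M * ((a + 1) * \<tau> powr a) / (a + 1) - c * f' \<tau>"
        using assms(1) by (simp add: abs_le_iff)
      ultimately show "\<exists>y. (?F has_real_derivative y) (at \<tau>) \<and> 0 \<le> y" by blast
    next
      show "continuous_on {0..t} ?F"
        using assms(1) by (intro continuous_intros continuous_on_powr' cont) auto
    qed
    then show ?thesis using assms(1,4) by simp
  qed
  show ?thesis using aux[of 1] aux[of "-1"] by (simp add: abs_le_iff)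
qed (use assms in simp)

text \<open>Repeated integration from the top derivative down. Each integration gains a divisor of
  the form k + \<nu>, weakened to the integer k, so that the divisors multiply up to a
  factorial.\<close>

lemma iterated_powr_bound:
  fixes R :: "nat \<Rightarrow> real \<Rightarrow> real"
  assumes "0 \<le> \<nu>" "0 \<le> M"
    and "\<And>k \<tau>. k < n \<Longrightarrow> 0 \<le> \<tau> \<Longrightarrow> \<tau> \<le> 1 \<Longrightarrow> (R k has_real_derivative R (Suc k) \<tau>) (at \<tau>)"
    and "\<And>k. k < n \<Longrightarrow> R k 0 = 0"
    and "\<And>\<tau>. 0 \<le> \<tau> \<Longrightarrow> \<tau> \<le> 1 \<Longrightarrow> \<bar>R n \<tau>\<bar> \<le> M * \<tau> powr (1 + \<nu>)"
    and "0 \<le> t" "t \<le> 1"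
  shows "\<bar>R 0 t\<bar> \<le> M * t powr (real n + 1 + \<nu>) / fact (n + 1)"
  using assms(3-)
proof (induction n arbitrary: R t)
  case (Suc n)
  have IH: "\<bar>R 1 \<tau>\<bar> \<le> M / fact (n + 1) * \<tau> powr (real n + 1 + \<nu>)" if "0 \<le> \<tau>" "\<tau> \<le> 1" for \<tau>
    using Suc.IH[of "\<lambda>k. R (Suc k)" \<tau>] Suc.prems(1-3) that by simp
  have "\<bar>R 0 t\<bar> \<le> M / fact (n + 1) * t powr (real n + 1 + \<nu> + 1) / (real n + 1 + \<nu> + 1)"
    by (rule powr_integral_bound[where f' = "R 1"])
      (use Suc.prems assms(1) IH in auto)
  also have "\<dots> \<le> M / fact (n + 1) * t powr (real n + 1 + \<nu> + 1) / (real n + 2)"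
    using assms(1,2) by (intro divide_left_mono mult_nonneg_nonneg divide_nonneg_nonneg) auto
  also have "\<dots> = M * t powr (real (Suc n) + 1 + \<nu>) / fact (Suc n + 1)"
    by (simp add: field_simps)
  finally show ?case .
qed auto

context euclid
begin

lemma der_shift:
  assumes "der G D (x - a)" "x \<in> E" "a \<in> E"
  shows "der (\<lambda>x. G (x - a)) D x"
proof -
  obtain F where F: "(G has_derivative F) (at (x - a) within E)" "\<forall>h\<in>E. F h = D h"
    using assms(1) by (auto simp: der_def)
  have "((\<lambda>x. x - a) has_derivative (\<lambda>h. h)) (at x within E)"
    by (auto intro!: derivative_eq_intros)
  moreover have "(G has_derivative F) (at (x - a) within (\<lambda>x. x - a) ` E)"
    by (rule has_derivative_subset[OF F(1)]) (use assms in auto)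
  ultimately have "((\<lambda>x. G (x - a)) has_derivative (\<lambda>h. F h)) (at x within E)"
    by (rule has_derivative_in_compose)
  then show ?thesis using F(2) by (auto simp: der_def)
qed

lemma has_derivative_cong_E:
  assumes "\<And>y. y \<in> E \<Longrightarrow> F y = F' y" "x \<in> E"
  shows "(F has_derivative D) (at x within E) \<longleftrightarrow> (F' has_derivative D) (at x within E)"
  using has_derivative_transform[OF assms(2), of F F' D] has_derivative_transform[OF assms(2), of F' F D]
    assms(1) by metis

lemma dderiv_cong:
  assumes "\<And>y. y \<in> E \<Longrightarrow> G y = G' y" "x \<in> E"
  shows "dderiv E G hs x = dderiv E G' hs x"
  using assms(2)
proof (induction hs arbitrary: x)
  case (Cons h hs)
  have "(dderiv E G hs has_derivative D) (at x within E) \<longleftrightarrow> (dderiv E G' hs has_derivative D) (at x within E)" for D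
    by (rule has_derivative_cong_E) (use Cons in auto)
  then show ?case by (simp add: differentiable_def frechet_derivative_def)
qed (use assms in simp)

lemma der_dderiv:
  assumes "dderiv E G hs differentiable (at x within E)"
  shows "der (dderiv E G hs) (\<lambda>h. dderiv E G (h # hs) x) x"
  using der_frechet[OF assms] assms by simp

lemma dderiv_Cons_eq: "der (dderiv E G hs) D x \<Longrightarrow> x \<in> E \<Longrightarrow> h \<in> E \<Longrightarrow> dderiv E G (h # hs) x = D h"
  using frechet_der[of "dderiv E G hs" D x h] der_differentiable by simp

section \<open>Symmetry and multilinearity of iterated derivatives\<close>

text \<open>The order n derivative is demanded at y alone, lower orders everywhere. For \<nu> = 0 a
  norm power meets this with n = p off its centre although its p-th derivative may be missing at the
  centre.\<close>

definition smooth_at :: "nat \<Rightarrow> ('a \<Rightarrow> real) \<Rightarrow> 'a \<Rightarrow> bool" where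
  "smooth_at n G y \<longleftrightarrow> times_differentiable E (n - 1) G
     \<and> (\<forall>hs. set hs \<subseteq> E \<and> length hs < n \<longrightarrow> dderiv E G hs differentiable (at y within E))"

lemma smooth_at_D: "smooth_at n G y \<Longrightarrow> set hs \<subseteq> E \<Longrightarrow> length hs < n \<Longrightarrow> dderiv E G hs differentiable (at y within E)"
  by (simp add: smooth_at_def)

lemma times_differentiable_D:
  "times_differentiable E n G \<Longrightarrow> set hs \<subseteq> E \<Longrightarrow> length hs < n \<Longrightarrow> x \<in> E \<Longrightarrow> dderiv E G hs differentiable (at x within E)"
  by (simp add: times_differentiable_def)

lemma times_differentiable_mono: "times_differentiable E n G \<Longrightarrow> m \<le> n \<Longrightarrow> times_differentiable E m G"
  by (meson times_differentiable_def order_less_le_trans)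

lemma smooth_at_of_times: "times_differentiable E n G \<Longrightarrow> y \<in> E \<Longrightarrow> smooth_at n G y"
  using times_differentiable_mono[of n G "n - 1"] by (simp add: smooth_at_def times_differentiable_D)

lemma smooth_at_pred: "smooth_at n G y \<Longrightarrow> x \<in> E \<Longrightarrow> smooth_at (n - 1) G x"
  by (rule smooth_at_of_times) (simp_all add: smooth_at_def)

text \<open>The second difference over a parallelogram of size t equals t^2 D b up to o(t^2).
  Differentiability of F1 a at the single point y suffices: the mean value theorem reduces the
  difference to two values of F1 a near y, each expanded to first order at y.\<close>

lemma schwarz_quotient:
  assumes F: "\<And>x. x \<in> E \<Longrightarrow> der F (\<lambda>h. F1 h x) x" and Fa: "der (F1 a) D y"
    and mem: "y \<in> E" "a \<in> E" "b \<in> E" and e: "0 < e"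
  shows "\<exists>d>0. \<forall>t. 0 < t \<and> t < d \<longrightarrow>
    \<bar>F (y + t *\<^sub>R a + t *\<^sub>R b) - F (y + t *\<^sub>R a) - F (y + t *\<^sub>R b) + F y - t\<^sup>2 * D b\<bar> \<le> e * t\<^sup>2"
proof -
  \<comment> \<open>The two expansion errors are proportional to |a| + |b| and |a|; K exceeds their
    sum, and the 1 keeps it positive.\<close>
  define K where "K = 2 * norm a + norm b + 1"
  have K: "0 < K" by (simp add: K_def add_nonneg_pos)
  obtain D' where D': "(F1 a has_derivative D') (at y within E)" "\<forall>h\<in>E. D' h = D h"
    using Fa by (auto simp: der_def)
  have lin: "linear D'" using D'(1) has_derivative_linear by blast
  obtain d where d: "0 < d" "\<And>x. x \<in> E \<Longrightarrow> norm (x - y) < d \<Longrightarrow>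
      norm (F1 a x - F1 a y - D' (x - y)) \<le> e / K * norm (x - y)"
    using D'(1) e K unfolding has_derivative_within_alt by (meson divide_pos_pos)
  show ?thesis
  proof (intro exI[of _ "d / K"] conjI allI impI)
    show "0 < d / K" using d(1) K by simp
    fix t assume "0 < t \<and> t < d / K"
    then have t: "0 < t" "t * K < d" using K by (auto simp: field_simps)
    let ?p = "\<lambda>\<sigma>. F (y + t *\<^sub>R b + \<sigma> *\<^sub>R a) - F (y + \<sigma> *\<^sub>R a)"
    have pd: "(?p has_real_derivative F1 a (y + t *\<^sub>R b + \<sigma> *\<^sub>R a) - F1 a (y + \<sigma> *\<^sub>R a)) (at \<sigma>)" for \<sigma>
      using mem by (intro DERIV_diff der_line F) auto
    obtain \<xi> where \<xi>: "0 < \<xi>" "\<xi> < t"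
      "?p t - ?p 0 = (t - 0) * (F1 a (y + t *\<^sub>R b + \<xi> *\<^sub>R a) - F1 a (y + \<xi> *\<^sub>R a))"
      using MVT2[OF t(1), of ?p, OF pd] by blast
    define u where "u = F1 a (y + t *\<^sub>R b + \<xi> *\<^sub>R a) - F1 a y - D' (t *\<^sub>R b + \<xi> *\<^sub>R a)"
    define v where "v = F1 a (y + \<xi> *\<^sub>R a) - F1 a y - D' (\<xi> *\<^sub>R a)"
    have n1: "norm (t *\<^sub>R b + \<xi> *\<^sub>R a) \<le> t * (norm a + norm b)"
    proof -
      have "norm (t *\<^sub>R b + \<xi> *\<^sub>R a) \<le> t * norm b + \<xi> * norm a"
        using t \<xi> norm_triangle_ineq[of "t *\<^sub>R b" "\<xi> *\<^sub>R a"] by simp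
      also have "\<xi> * norm a \<le> t * norm a" using \<xi> by (intro mult_right_mono) auto
      finally show ?thesis by (simp add: algebra_simps)
    qed
    have n2: "norm (\<xi> *\<^sub>R a) \<le> t * norm a" using \<xi> by (simp add: mult_right_mono)
    have le: "t * (norm a + norm b) \<le> t * K" "t * norm a \<le> t * K"
      using t by (auto simp: K_def intro!: mult_left_mono)
    have "\<bar>u\<bar> \<le> e / K * norm (t *\<^sub>R b + \<xi> *\<^sub>R a)"
      using d(2)[of "y + t *\<^sub>R b + \<xi> *\<^sub>R a"] mem n1 le t by (auto simp: u_def algebra_simps)
    also have "\<dots> \<le> e / K * (t * (norm a + norm b))"
      using n1 e K by (intro mult_left_mono) auto
    finally have u: "\<bar>u\<bar> \<le> e / K * (t * (norm a + norm b))" .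
    have "\<bar>v\<bar> \<le> e / K * norm (\<xi> *\<^sub>R a)"
    proof -
      have "norm (\<xi> *\<^sub>R a) < d" using n2 le(2) t(2) by linarith
      then show ?thesis using d(2)[of "y + \<xi> *\<^sub>R a"] mem by (simp add: v_def)
    qed
    also have "\<dots> \<le> e / K * (t * norm a)"
      using n2 e K by (intro mult_left_mono) auto
    finally have v: "\<bar>v\<bar> \<le> e / K * (t * norm a)" .
    have "e / K * (t * (norm a + norm b)) + e / K * (t * norm a) = e * t * ((norm a + norm b + norm a) / K)"
      by (simp add: algebra_simps add_divide_distrib)
    also have "\<dots> = e * t * ((K - 1) / K)" by (simp add: K_def)
    also have "\<dots> \<le> e * t * 1"
      using e t K by (intro mult_left_mono) auto
    finally have uv: "\<bar>u - v\<bar> \<le> e * t" using u v by linarith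
    have "F (y + t *\<^sub>R a + t *\<^sub>R b) - F (y + t *\<^sub>R a) - F (y + t *\<^sub>R b) + F y = ?p t - ?p 0"
      by (simp add: algebra_simps)
    also have "\<dots> = t * (u - v + t * D b)"
      using \<xi>(3) D'(2) mem by (simp add: u_def v_def linear_add[OF lin] linear_cmul[OF lin])
    finally have "F (y + t *\<^sub>R a + t *\<^sub>R b) - F (y + t *\<^sub>R a) - F (y + t *\<^sub>R b) + F y - t\<^sup>2 * D b = t * (u - v)"
      by (simp add: algebra_simps power2_eq_square)
    then show "\<bar>F (y + t *\<^sub>R a + t *\<^sub>R b) - F (y + t *\<^sub>R a) - F (y + t *\<^sub>R b) + F y - t\<^sup>2 * D b\<bar> \<le> e * t\<^sup>2"
      using uv t by (simp add: abs_mult power2_eq_square)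
  qed
qed

text \<open>The second difference is symmetric in a and b, hence so is its leading
  coefficient.\<close>

lemma schwarz_symmetry:
  assumes F: "\<And>x. x \<in> E \<Longrightarrow> der F (\<lambda>h. F1 h x) x" and Fa: "der (F1 a) Da y" and Fb: "der (F1 b) Db y"
    and mem: "y \<in> E" "a \<in> E" "b \<in> E"
  shows "Da b = Db a"
proof -
  have "\<bar>Da b - Db a\<bar> \<le> e" if e: "0 < e" for e
  proof -
    have e2: "0 < e / 2" using e by simp
    obtain d1 where d1: "0 < d1" "\<And>t. 0 < t \<Longrightarrow> t < d1 \<Longrightarrow>
      \<bar>F (y + t *\<^sub>R a + t *\<^sub>R b) - F (y + t *\<^sub>R a) - F (y + t *\<^sub>R b) + F y - t\<^sup>2 * Da b\<bar> \<le> e/2 * t\<^sup>2"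
      using schwarz_quotient[where ?F1.0 = F1, OF F Fa mem e2] by blast
    obtain d2 where d2: "0 < d2" "\<And>t. 0 < t \<Longrightarrow> t < d2 \<Longrightarrow>
      \<bar>F (y + t *\<^sub>R b + t *\<^sub>R a) - F (y + t *\<^sub>R b) - F (y + t *\<^sub>R a) + F y - t\<^sup>2 * Db a\<bar> \<le> e/2 * t\<^sup>2"
      using schwarz_quotient[where ?F1.0 = F1, OF F Fb mem(1,3,2) e2] by blast
    define t where "t = min d1 d2 / 2"
    have t: "0 < t" "t < d1" "t < d2" using d1(1) d2(1) by (auto simp: t_def)
    have sw: "y + t *\<^sub>R b + t *\<^sub>R a = y + t *\<^sub>R a + t *\<^sub>R b" by (simp add: algebra_simps)
    have "\<bar>t\<^sup>2 * Da b - t\<^sup>2 * Db a\<bar> \<le> e * t\<^sup>2"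
      using d1(2)[OF t(1,2)] d2(2)[OF t(1,3)] unfolding sw by linarith
    moreover have "t\<^sup>2 * Da b - t\<^sup>2 * Db a = (Da b - Db a) * t\<^sup>2" by (simp add: algebra_simps)
    ultimately have "\<bar>Da b - Db a\<bar> * t\<^sup>2 \<le> e * t\<^sup>2" by (simp add: abs_mult)
    then show ?thesis using t(1) by simp
  qed
  then have "\<bar>Da b - Db a\<bar> \<le> 0" by (rule field_le_epsilon[of _ 0, simplified])
  then show ?thesis by simp
qed

text \<open>In the outermost slot this is linearity of a Frechet derivative. An inner slot is
  reached by differentiating the identity of one order less, which holds at every point and not only
  at y. The swap of neighbouring arguments below is propagated in the same way.\<close>

lemma dderiv_linear:
  assumes "smooth_at n G y" "y \<in> E" "set hs \<subseteq> E" "set ks \<subseteq> E" "a \<in> E" "b \<in> E"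
    and "length hs + length ks < n"
  shows "dderiv E G (hs @ (c *\<^sub>R a + d *\<^sub>R b) # ks) y
    = c * dderiv E G (hs @ a # ks) y + d * dderiv E G (hs @ b # ks) y"
  using assms(1,2,3,7)
proof (induction hs arbitrary: y n)
  case Nil
  have diff: "dderiv E G ks differentiable (at y within E)"
    using Nil assms by (intro smooth_at_D) auto
  then have "linear (frechet_derivative (dderiv E G ks) (at y within E))"
    using frechet_derivative_works has_derivative_linear by blast
  with diff show ?case by (simp add: linear_add linear_cmul)
next
  case (Cons h hs)
  let ?L = "hs @ (c *\<^sub>R a + d *\<^sub>R b) # ks"
  have eq: "dderiv E G ?L x = c * dderiv E G (hs @ a # ks) x + d * dderiv E G (hs @ b # ks) x"
    if "x \<in> E" for x
    using Cons.IH[OF smooth_at_pred[OF Cons.prems(1) that] that] Cons.prems by simp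
  have "der (\<lambda>x. c * dderiv E G (hs @ a # ks) x + d * dderiv E G (hs @ b # ks) x)
     (\<lambda>h. c * dderiv E G (h # hs @ a # ks) y + d * dderiv E G (h # hs @ b # ks) y) y"
    using Cons.prems assms
    by (intro der_add der_cmult der_dderiv smooth_at_D[OF Cons.prems(1)]) auto
  then have "der (dderiv E G ?L)
     (\<lambda>h. c * dderiv E G (h # hs @ a # ks) y + d * dderiv E G (h # hs @ b # ks) y) y"
    by (rule der_cong) (use Cons.prems eq in auto)
  from dderiv_Cons_eq[OF this, of h] Cons.prems show ?case by simp
qed

lemma dderiv_swap:
  assumes "smooth_at n G y" "y \<in> E" "set hs \<subseteq> E" "set ks \<subseteq> E" "a \<in> E" "b \<in> E"
    and "length hs + length ks + 1 < n"
  shows "dderiv E G (hs @ a # b # ks) y = dderiv E G (hs @ b # a # ks) y"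
  using assms(1,2,3,7)
proof (induction hs arbitrary: y n)
  case Nil
  have td: "times_differentiable E (n - 1) G" using Nil by (simp add: smooth_at_def)
  have F: "der (dderiv E G ks) (\<lambda>h. dderiv E G (h # ks) x) x" if "x \<in> E" for x
    using Nil assms(4) that by (intro der_dderiv times_differentiable_D[OF td]) auto
  have Fc: "der (dderiv E G (c # ks)) (\<lambda>h. dderiv E G (h # c # ks) y) y" if "c \<in> E" for c
    using Nil assms(4) that by (intro der_dderiv smooth_at_D[OF Nil(1)]) auto
  have "dderiv E G (b # a # ks) y = dderiv E G (a # b # ks) y"
    by (rule schwarz_symmetry[where ?F1.0 = "\<lambda>h. dderiv E G (h # ks)", OF F Fc Fc Nil(2) assms(5,6)])
      (use assms in auto)
  then show ?case by simp
next
  case (Cons h hs)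
  have eq: "dderiv E G (hs @ a # b # ks) x = dderiv E G (hs @ b # a # ks) x" if "x \<in> E" for x
    using Cons.IH[OF smooth_at_pred[OF Cons.prems(1) that] that] Cons.prems by simp
  have "der (dderiv E G (hs @ b # a # ks)) (\<lambda>h. dderiv E G (h # hs @ b # a # ks) y) y"
    using Cons.prems assms by (intro der_dderiv smooth_at_D[OF Cons.prems(1)]) auto
  then have "der (dderiv E G (hs @ a # b # ks)) (\<lambda>h. dderiv E G (h # hs @ b # a # ks) y) y"
    by (rule der_cong) (use Cons.prems eq in auto)
  from dderiv_Cons_eq[OF this, of h] Cons.prems show ?case by simp
qed

lemma dderiv_replicate_move:
  assumes "smooth_at n G y" "y \<in> E" "d \<in> E" "h \<in> E" "j + k < n"
  shows "dderiv E G (replicate j d @ h # replicate k d) y = dderiv E G (replicate (j + k) d @ [h]) y"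
  using assms(5)
proof (induction k arbitrary: j)
  case (Suc k)
  have "dderiv E G (replicate j d @ h # d # replicate k d) y = dderiv E G (replicate j d @ d # h # replicate k d) y"
    using assms Suc.prems by (intro dderiv_swap[OF assms(1)]) auto
  also have "replicate j d @ d # h # replicate k d = replicate (Suc j) d @ h # replicate k d"
    by (simp add: replicate_app_Cons_same)
  finally show ?case using Suc.IH[of "Suc j"] Suc.prems by simp
qed simp

section \<open>Multilinear forms, their norm and their diagonal\<close>

definition mlin :: "nat \<Rightarrow> ('a list \<Rightarrow> real) \<Rightarrow> bool" where
  "mlin n A \<longleftrightarrow> (\<forall>hs ks a b c d. set hs \<subseteq> E \<and> set ks \<subseteq> E \<and> a \<in> E \<and> b \<in> E \<and> length hs + length ks + 1 = n \<longrightarrow>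
     A (hs @ (c *\<^sub>R a + d *\<^sub>R b) # ks) = c * A (hs @ a # ks) + d * A (hs @ b # ks))"

lemma mlin_D:
  "mlin n A \<Longrightarrow> set hs \<subseteq> E \<Longrightarrow> set ks \<subseteq> E \<Longrightarrow> a \<in> E \<Longrightarrow> b \<in> E \<Longrightarrow> length hs + length ks + 1 = n \<Longrightarrow>
   A (hs @ (c *\<^sub>R a + d *\<^sub>R b) # ks) = c * A (hs @ a # ks) + d * A (hs @ b # ks)"
  by (simp add: mlin_def)

lemma mlin_scale:
  "mlin n A \<Longrightarrow> set hs \<subseteq> E \<Longrightarrow> set ks \<subseteq> E \<Longrightarrow> a \<in> E \<Longrightarrow> length hs + length ks + 1 = n \<Longrightarrow>
   A (hs @ (c *\<^sub>R a) # ks) = c * A (hs @ a # ks)"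
  using mlin_D[of n A hs ks a 0 c 0] by simp

lemma mlin_Cons: "mlin (Suc n) A \<Longrightarrow> b \<in> E \<Longrightarrow> mlin n (\<lambda>ks. A (b # ks))"
  unfolding mlin_def
proof (intro allI impI, goal_cases)
  case (1 hs ks a b' c d)
  then show ?case using spec[OF 1(1), of "b # hs"] by auto
qed

lemma mlin_sum_Cons:
  assumes "mlin (Suc n) A" "finite C" "C \<subseteq> E" "set ks \<subseteq> E" "length ks = n"
  shows "A ((\<Sum>b\<in>C. c b *\<^sub>R b) # ks) = (\<Sum>b\<in>C. c b * A (b # ks))"
  using assms(2,3)
proof (induction C rule: finite_induct)
  case empty
  then show ?case using mlin_scale[OF assms(1), of "[]" ks 0 0] assms by simp
next
  case (insert b C)
  have "A ((c b *\<^sub>R b + 1 *\<^sub>R (\<Sum>b\<in>C. c b *\<^sub>R b)) # ks) = c b * A (b # ks) + 1 * A ((\<Sum>b\<in>C. c b *\<^sub>R b) # ks)"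
    using mlin_D[OF assms(1), of "[]" ks b "\<Sum>b\<in>C. c b *\<^sub>R b" "c b" 1] insert.prems assms
    by (simp add: E_sum subset_iff)
  then show ?case using insert by simp
qed

text \<open>\<open>form_nrm\<close> is a supremum of reals and carries information only when the set
  is bounded above; finite dimension provides this.\<close>

lemma mlin_bounded:
  assumes "mlin n A"
  shows "\<exists>M\<ge>0. \<forall>hs. length hs = n \<and> set hs \<subseteq> E \<longrightarrow> \<bar>A hs\<bar> \<le> M * prod_list (map N hs)"
  using assms
proof (induction n arbitrary: A)
  case 0
  show ?case by (intro exI[of _ "\<bar>A []\<bar>"]) auto
next
  case (Suc n)
  obtain C c where C: "finite C" "C \<subseteq> E" "\<And>b. bounded_linear (c b :: 'a \<Rightarrow> real)"
    "\<And>x. x \<in> E \<Longrightarrow> x = (\<Sum>b\<in>C. c b x *\<^sub>R b)"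
    using coords by blast
  have lin: "linear (c b)" for b using C(3) bounded_linear.linear by blast
  have "\<forall>b\<in>C. \<exists>M\<ge>0. \<forall>hs. length hs = n \<and> set hs \<subseteq> E \<longrightarrow> \<bar>A (b # hs)\<bar> \<le> M * prod_list (map N hs)"
    using Suc.IH[OF mlin_Cons[OF Suc.prems]] C(2) by blast
  then obtain M where M: "\<And>b. b \<in> C \<Longrightarrow> 0 \<le> M b"
    "\<And>b hs. b \<in> C \<Longrightarrow> length hs = n \<Longrightarrow> set hs \<subseteq> E \<Longrightarrow> \<bar>A (b # hs)\<bar> \<le> M b * prod_list (map N hs)"
    by metis
  let ?K = "\<Sum>b\<in>C. dual_nrm E B (c b) * M b"
  have "\<bar>A hs\<bar> \<le> ?K * prod_list (map N hs)" if hs: "length hs = Suc n" "set hs \<subseteq> E" for hs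
  proof -
    obtain h ks where hk: "hs = h # ks" using hs by (cases hs) auto
    then have h: "h \<in> E" "set ks \<subseteq> E" "length ks = n" using hs by auto
    have "A hs = A ((\<Sum>b\<in>C. c b h *\<^sub>R b) # ks)"
      using arg_cong[OF C(4)[OF h(1)], of "\<lambda>v. A (v # ks)"] by (simp only: hk)
    also have "\<bar>\<dots>\<bar> \<le> (\<Sum>b\<in>C. \<bar>c b h * A (b # ks)\<bar>)"
      by (subst mlin_sum_Cons[OF Suc.prems C(1,2) h(2,3)]) (rule sum_abs)
    also have "\<dots> \<le> (\<Sum>b\<in>C. (dual_nrm E B (c b) * N h) * (M b * prod_list (map N ks)))"
      unfolding abs_mult
      using M h dual_nrm_nonneg[OF lin]
      by (intro sum_mono mult_mono dual_nrm_bound[OF lin]) auto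
    also have "\<dots> = ?K * prod_list (map N hs)"
      by (simp add: hk sum_distrib_left mult_ac)
    finally show ?thesis .
  qed
  moreover have "0 \<le> ?K"
    using M(1) dual_nrm_nonneg[OF lin] by (intro sum_nonneg mult_nonneg_nonneg) auto
  ultimately show ?case by blast
qed

text \<open>The prefix ks is there for the induction, which normalizes one slot after the other.
  Zero vectors are covered: 1 / 0 = 0 sends them to 0, and rescaling by N h = 0 restores
  them.\<close>

lemma mlin_normalize:
  assumes "mlin n A" "set ks \<subseteq> E" "set hs \<subseteq> E" "length ks + length hs = n"
  shows "A (ks @ hs) = A (ks @ map (\<lambda>h. (1 / N h) *\<^sub>R h) hs) * prod_list (map N hs)"
  using assms(2-)
proof (induction hs arbitrary: ks)
  case (Cons h hs)
  let ?u = "\<lambda>h. (1 / N h) *\<^sub>R h"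
  have h: "N h *\<^sub>R ?u h = h" using Cons.prems N_eq_0[of h] by auto
  have set: "set (map ?u hs) \<subseteq> E" using Cons.prems by auto
  have "A ((ks @ [h]) @ hs) = A ((ks @ [h]) @ map ?u hs) * prod_list (map N hs)"
    using Cons.prems by (intro Cons.IH) auto
  also have "A ((ks @ [h]) @ map ?u hs) = A (ks @ (N h *\<^sub>R ?u h) # map ?u hs)" using h by simp
  also have "\<dots> = N h * A (ks @ ?u h # map ?u hs)"
    using Cons.prems set by (intro mlin_scale[OF assms(1)]) auto
  finally show ?case by (simp add: mult_ac)
qed simp

lemma form_nrm_bound:
  assumes "mlin n A" "set hs \<subseteq> E" "length hs = n"
  shows "\<bar>A hs\<bar> \<le> form_nrm E B n A * prod_list (map N hs)"
proof -
  let ?S = "{hs. length hs = n \<and> set hs \<subseteq> {h \<in> E. N h \<le> 1}}"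
  let ?u = "\<lambda>h. (1 / N h) *\<^sub>R h"
  obtain M where M: "0 \<le> M" "\<And>hs. length hs = n \<Longrightarrow> set hs \<subseteq> E \<Longrightarrow> \<bar>A hs\<bar> \<le> M * prod_list (map N hs)"
    using mlin_bounded[OF assms(1)] by blast
  have prod1: "0 \<le> prod_list (map N hs) \<and> prod_list (map N hs) \<le> 1" if "set hs \<subseteq> {h \<in> E. N h \<le> 1}" for hs
    using that by (induction hs) (auto intro: mult_le_one)
  have "bdd_above ((\<lambda>hs. \<bar>A hs\<bar>) ` ?S)"
  proof (rule bdd_aboveI2)
    fix hs assume "hs \<in> ?S"
    then have "\<bar>A hs\<bar> \<le> M * prod_list (map N hs)" "prod_list (map N hs) \<le> 1" using M(2)[of hs] prod1[of hs] by auto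
    then show "\<bar>A hs\<bar> \<le> M" using mult_left_le[of "prod_list (map N hs)" M] M(1) by linarith
  qed
  moreover have "map ?u hs \<in> ?S"
  proof -
    have "N (?u h) \<le> 1" if "h \<in> E" for h
      using that by (cases "N h = 0") (auto simp: N_scale)
    then show ?thesis using assms(2,3) by auto
  qed
  ultimately have "\<bar>A (map ?u hs)\<bar> \<le> form_nrm E B n A"
    unfolding form_nrm_def by (rule cSUP_upper[rotated])
  moreover have "0 \<le> prod_list (map N hs)"
    using assms(2) by (induction hs) auto
  ultimately show ?thesis
    using mlin_normalize[OF assms(1), of "[]" hs] assms by (simp add: abs_mult mult_right_mono)
qed

lemma mlin_dderiv:
  assumes "smooth_at n G y" "y \<in> E" "i \<le> n"
  shows "mlin i (\<lambda>hs. dderiv E G hs y)"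
  unfolding mlin_def using dderiv_linear[OF assms(1,2)] assms(3) by auto

lemma mlin_diff: "mlin n A \<Longrightarrow> mlin n A' \<Longrightarrow> mlin n (\<lambda>hs. A hs - A' hs)"
  unfolding mlin_def by (simp add: algebra_simps)

lemma holder_bound:
  assumes "times_differentiable E p G" "holder E B G p \<nu> = ennreal H" "0 \<le> H"
    and "x \<in> E" "y \<in> E" "x \<noteq> y" "set hs \<subseteq> E" "length hs = p"
  shows "\<bar>dderiv E G hs x - dderiv E G hs y\<bar> \<le> H * N (x - y) powr \<nu> * prod_list (map N hs)"
proof -
  let ?A = "\<lambda>hs. dderiv E G hs x - dderiv E G hs y"
  have "0 < N (x - y)" using assms by (intro N_pos) auto
  then have pos: "0 < N (x - y) powr \<nu>" by simp
  have "ennreal (form_nrm E B p ?A / N (x - y) powr \<nu>) \<le> ennreal H"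
    unfolding assms(2)[symmetric] holder_def
    by (rule SUP_upper2[of "(x, y)"]) (use assms in auto)
  then have "form_nrm E B p ?A / N (x - y) powr \<nu> \<le> H"
    using assms(3) by (simp add: ennreal_le_iff)
  then have "form_nrm E B p ?A \<le> H * N (x - y) powr \<nu>" using pos by (simp add: field_simps)
  moreover have "mlin p ?A"
    using assms by (intro mlin_diff mlin_dderiv[of p] smooth_at_of_times) auto
  from form_nrm_bound[OF this assms(7,8)]
  have "\<bar>?A hs\<bar> \<le> form_nrm E B p ?A * prod_list (map N hs)" .
  moreover have "0 \<le> prod_list (map N hs)"
    using assms(7) by (induction hs) auto
  ultimately show ?thesis by (meson mult_right_mono order_trans)
qed

text \<open>Leibniz rule by induction on the number of slots: expanding the first slot in
  coordinates gives a sum of products of a linear function with a form that has one slot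
  less.\<close>

lemma der_mlin_replicate:
  assumes "mlin n A" "x \<in> E"
  shows "der (\<lambda>x. A (replicate n x)) (\<lambda>h. \<Sum>j<n. A (replicate j x @ h # replicate (n - 1 - j) x)) x"
  using assms(1)
proof (induction n arbitrary: A)
  case 0
  then show ?case by (simp add: der_const)
next
  case (Suc n)
  obtain C c where C: "finite C" "C \<subseteq> E" "\<And>b. bounded_linear (c b :: 'a \<Rightarrow> real)"
    "\<And>x. x \<in> E \<Longrightarrow> x = (\<Sum>b\<in>C. c b x *\<^sub>R b)"
    using coords by blast
  have lin: "linear (c b)" for b using C(3) bounded_linear.linear by blast
  have expand: "(\<Sum>b\<in>C. c b v * A (b # ks)) = A (v # ks)" if "v \<in> E" "set ks \<subseteq> E" "length ks = n" for v ks
    using arg_cong[OF C(4)[OF that(1)], of "\<lambda>v. A (v # ks)"] mlin_sum_Cons[OF Suc.prems C(1,2) that(2,3), of "\<lambda>b. c b v"]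
    by simp
  have "der (\<lambda>x. \<Sum>b\<in>C. c b x * A (b # replicate n x))
    (\<lambda>h. \<Sum>b\<in>C. c b x * (\<Sum>j<n. A (b # replicate j x @ h # replicate (n - 1 - j) x)) + c b h * A (b # replicate n x)) x"
    using C(2) by (intro der_sum der_mult der_linear lin assms(2) Suc.IH mlin_Cons[OF Suc.prems]) auto
  then show ?case
  proof (rule der_cong[OF _ assms(2)])
    fix y assume "y \<in> E"
    then show "(\<Sum>b\<in>C. c b y * A (b # replicate n y)) = A (replicate (Suc n) y)"
      using expand[of y "replicate n y"] set_replicate_conv_if[of n y] by auto
  next
    fix h assume h: "h \<in> E"
    have "(\<Sum>b\<in>C. c b x * (\<Sum>j<n. A (b # replicate j x @ h # replicate (n - 1 - j) x)) + c b h * A (b # replicate n x))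
      = (\<Sum>j<n. \<Sum>b\<in>C. c b x * A (b # replicate j x @ h # replicate (n - 1 - j) x)) + (\<Sum>b\<in>C. c b h * A (b # replicate n x))"
      by (simp add: sum.distrib sum_distrib_left) (rule sum.swap)
    also have "\<dots> = (\<Sum>j<n. A (x # replicate j x @ h # replicate (n - 1 - j) x)) + A (h # replicate n x)"
      using h assms(2) by (intro arg_cong2[of _ _ _ _ "(+)"] sum.cong expand) auto
    also have "\<dots> = (\<Sum>j<Suc n. A (replicate j x @ h # replicate (Suc n - 1 - j) x))"
      by (subst sum.lessThan_Suc_shift) (simp add: add.commute)
    finally show "(\<Sum>b\<in>C. c b x * (\<Sum>j<n. A (b # replicate j x @ h # replicate (n - 1 - j) x)) + c b h * A (b # replicate n x))
      = (\<Sum>j<Suc n. A (replicate j x @ h # replicate (Suc n - 1 - j) x))" .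
  qed
qed

lemma der_dderiv_replicate:
  assumes "smooth_at n G y" "y \<in> E" "x \<in> E" "i \<le> n"
  shows "der (\<lambda>x. dderiv E G (replicate i (x - y)) y)
    (\<lambda>h. real i * dderiv E G (replicate (i - 1) (x - y) @ [h]) y) x"
proof (rule der_shift[OF _ assms(3,2)])
  let ?d = "x - y"
  have d: "?d \<in> E" using assms by auto
  have "der (\<lambda>x. dderiv E G (replicate i x) y)
     (\<lambda>h. \<Sum>j<i. dderiv E G (replicate j ?d @ h # replicate (i - 1 - j) ?d) y) ?d"
    by (rule der_mlin_replicate[OF mlin_dderiv[OF assms(1,2,4)] d])
  then show "der (\<lambda>x. dderiv E G (replicate i x) y)
     (\<lambda>h. real i * dderiv E G (replicate (i - 1) ?d @ [h]) y) ?d"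
  proof (rule der_cong[OF _ d])
    fix h assume h: "h \<in> E"
    \<comment> \<open>By symmetry all i terms of the Leibniz sum coincide, which produces the factor
      i.\<close>
    have "(\<Sum>j<i. dderiv E G (replicate j ?d @ h # replicate (i - 1 - j) ?d) y)
       = (\<Sum>j<i. dderiv E G (replicate (i - 1) ?d @ [h]) y)"
    proof (intro sum.cong refl)
      fix j assume "j \<in> {..<i}"
      then have j: "j + (i - 1 - j) = i - 1" "j + (i - 1 - j) < n" using assms(4) by auto
      show "dderiv E G (replicate j ?d @ h # replicate (i - 1 - j) ?d) y = dderiv E G (replicate (i - 1) ?d @ [h]) y"
        using dderiv_replicate_move[OF assms(1,2) d h j(2)] unfolding j(1) .
    qed
    then show "(\<Sum>j<i. dderiv E G (replicate j ?d @ h # replicate (i - 1 - j) ?d) y)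
      = real i * dderiv E G (replicate (i - 1) ?d @ [h]) y" by simp
  qed auto
qed

text \<open>\<open>Q h\<close> stands for \<open>D\<^sup>p G(y)[x - y, \<dots>, x - y, h]\<close>, but is kept separate because that
  derivative may fail to exist at \<open>y\<close>.\<close>
lemma taylor_gradient:
  assumes td: "times_differentiable E (p - 1) G" and p: "2 \<le> p" and "0 \<le> \<nu>" "0 \<le> M"
    and xy: "x \<in> E" "y \<in> E"
    and Q: "der (\<lambda>x. dderiv E G (replicate p (x - y)) y) (\<lambda>h. real p * Q h) x"
    and rem: "\<And>h \<tau>. h \<in> E \<Longrightarrow> 0 \<le> \<tau> \<Longrightarrow> \<tau> \<le> 1 \<Longrightarrow>
       \<bar>dderiv E G (replicate (p - 2) (x - y) @ [h]) (y + \<tau> *\<^sub>R (x - y))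
         - dderiv E G (replicate (p - 2) (x - y) @ [h]) y - \<tau> * Q h\<bar> \<le> M * \<tau> powr (1 + \<nu>) * N h"
  shows "\<exists>D. der (\<lambda>x. \<Sum>i=1..p. dderiv E G (replicate i (x - y)) y / fact i) D x \<and>
    (\<forall>h\<in>E. \<bar>dderiv E G [h] x - D h\<bar> \<le> M / fact (p - 1) * N h)"
proof -
  define d where "d = x - y"
  have d: "d \<in> E" using xy by (auto simp: d_def)
  \<comment> \<open>Taylor coefficients of the gradient in direction h along the segment; only the
    top one is replaced by Q.\<close>
  define c where "c k h = (if k = p - 1 then Q h else dderiv E G (replicate k d @ [h]) y)" for k h
  have der_i: "der (\<lambda>x. dderiv E G (replicate i (x - y)) y / fact i) (\<lambda>h. c (i - 1) h / fact (i - 1)) x"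
    if i: "i \<in> {1..p}" for i
  proof -
    have "der (\<lambda>x. dderiv E G (replicate i (x - y)) y) (\<lambda>h. real i * c (i - 1) h) x"
    proof (cases "i = p")
      case True then show ?thesis using Q by (simp add: c_def)
    next
      case False
      then have "i \<le> p - 1" "i - 1 \<noteq> p - 1" using i p by auto
      then show ?thesis
        using der_dderiv_replicate[OF smooth_at_of_times[OF td xy(2)] xy(2,1), of i] by (simp add: c_def d_def)
    qed
    from der_cmult[OF this, of "1 / fact i"]
    have "der (\<lambda>x. dderiv E G (replicate i (x - y)) y / fact i) (\<lambda>h. real i * c (i - 1) h / fact i) x" by simp
    moreover have "real i * r / fact i = r / fact (i - 1)" for r :: real
      using i fact_reduce[of i, where 'a = real] by simp
    ultimately show ?thesis by simp
  qed
  have "der (\<lambda>x. \<Sum>i=1..p. dderiv E G (replicate i (x - y)) y / fact i)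
     (\<lambda>h. \<Sum>i=1..p. c (i - 1) h / fact (i - 1)) x"
    by (intro der_sum der_i)
  moreover have "\<bar>dderiv E G [h] x - (\<Sum>i=1..p. c (i - 1) h / fact (i - 1))\<bar> \<le> M / fact (p - 1) * N h" if h: "h \<in> E" for h
  proof -
    \<comment> \<open>Along the segment the gradient in direction h is the function g 0, and R k is
      the k-th derivative of its remainder after the Taylor polynomial of degree p - 1. The orders
      below p - 2 vanish at 0 and order p - 2 is bounded by \<open>rem\<close>, so p - 2
      integrations give 1 / (p - 1)!.\<close>
    define g where "g k \<tau> = dderiv E G (replicate k d @ [h]) (y + \<tau> *\<^sub>R d)" for k \<tau>
    define R where "R k \<tau> = g k \<tau> - (\<Sum>j<p - k. c (k + j) h * \<tau> ^ j / fact j)" for k \<tau>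
    have g0: "g k 0 = c k h" if "k < p - 1" for k using that by (simp add: g_def c_def)
    have g_der: "(g k has_real_derivative g (Suc k) \<tau>) (at \<tau>)" if "k < p - 2" for k \<tau>
    proof -
      have "der (dderiv E G (replicate k d @ [h])) (\<lambda>v. dderiv E G (v # replicate k d @ [h]) (y + \<tau> *\<^sub>R d)) (y + \<tau> *\<^sub>R d)"
        using that d h xy by (intro der_dderiv times_differentiable_D[OF td]) auto
      from der_line[OF this xy(2) d] show ?thesis by (simp add: g_def[abs_def])
    qed
    have R_der: "(R k has_real_derivative R (Suc k) \<tau>) (at \<tau>)" if k: "k < p - 2" for k \<tau>
    proof -
      obtain n where n: "p - k = Suc n" "p - Suc k = n" using k by (metis Suc_diff_Suc diff_less_mono2 less_diff_conv not_less_eq Suc_lessD add_2_eq_Suc' zero_less_diff)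
      have "((\<lambda>\<tau>. \<Sum>j<Suc n. c (k + j) h * \<tau> ^ j / fact j) has_real_derivative (\<Sum>j<n. c (Suc k + j) h * \<tau> ^ j / fact j)) (at \<tau>)"
      proof -
        have "((\<lambda>\<tau>. c k h + (\<Sum>j<n. c (k + Suc j) h * \<tau> ^ Suc j / fact (Suc j))) has_real_derivative
            0 + (\<Sum>j<n. c (k + Suc j) h * (real (Suc j) * \<tau> ^ j) / fact (Suc j))) (at \<tau>)"
        proof (intro DERIV_add DERIV_const DERIV_sum DERIV_cdivide DERIV_cmult)
          show "((\<lambda>\<tau>. \<tau> ^ Suc j) has_real_derivative real (Suc j) * \<tau> ^ j) (at \<tau>)" for j
            using DERIV_pow[of "Suc j" \<tau>] by simp
        qed
        moreover have "c (k + Suc j) h * (real (Suc j) * \<tau> ^ j) / fact (Suc j) = c (Suc k + j) h * \<tau> ^ j / fact j" for j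
          by (simp add: field_simps del: of_nat_Suc)
        ultimately show ?thesis by (simp only: sum.lessThan_Suc_shift add_0) simp
      qed
      from DERIV_diff[OF g_der[OF k] this] show ?thesis by (simp only: R_def[abs_def] n)
    qed
    have R0: "R k 0 = 0" if k: "k < p - 2" for k
    proof -
      obtain n where n: "p - k = Suc n" using k by (cases "p - k") auto
      show ?thesis unfolding R_def n sum.lessThan_Suc_shift using g0[of k] k by simp
    qed
    have two: "p - (p - 2) = 2" using p by simp
    have Rp: "\<bar>R (p - 2) \<tau>\<bar> \<le> M * N h * \<tau> powr (1 + \<nu>)" if "0 \<le> \<tau>" "\<tau> \<le> 1" for \<tau>
    proof -
      have "R (p - 2) \<tau> = g (p - 2) \<tau> - c (p - 2) h - \<tau> * c (p - 2 + 1) h"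
        unfolding R_def two by (simp add: numeral_2_eq_2)
      also have "p - 2 + 1 = p - 1" using p by simp
      also have "c (p - 1) h = Q h" by (simp add: c_def)
      also have "c (p - 2) h = dderiv E G (replicate (p - 2) d @ [h]) y"
      proof -
        have "p - 2 \<noteq> p - 1" using p by simp
        then show ?thesis by (simp only: c_def if_False)
      qed
      finally show ?thesis using rem[OF h that] by (simp add: g_def d_def mult_ac)
    qed
    have "\<bar>R 0 1\<bar> \<le> M * N h * 1 powr (real (p - 2) + 1 + \<nu>) / fact (p - 2 + 1)"
      by (rule iterated_powr_bound) (use R_der R0 Rp assms h in auto)
    moreover have "p - 2 + 1 = p - 1" using p by simp
    ultimately have "\<bar>R 0 1\<bar> \<le> M / fact (p - 1) * N h" by (simp only: powr_one_eq_one) simp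
    moreover have "R 0 1 = dderiv E G [h] x - (\<Sum>j<p. c j h / fact j)"
      by (simp add: R_def g_def d_def)
    moreover have "(\<Sum>j<p. c j h / fact j) = (\<Sum>i=1..p. c (i - 1) h / fact (i - 1))"
      by (rule sum.reindex_bij_witness[of _ "\<lambda>i. i - 1" Suc]) auto
    ultimately show ?thesis by (simp only:)
  qed
  ultimately show ?thesis by blast
qed

end

section \<open>Circle averages of powers\<close>

text \<open>The even power |t|^b and the odd power sgn(t) |t|^b in one family: a derivative lowers
  the exponent by one and flips the parity, so all derivatives of |t|^s stay inside it.\<close>

definition spow :: "real \<Rightarrow> bool \<Rightarrow> real \<Rightarrow> real" where
  "spow b e t = \<bar>t\<bar> powr b * (if e then 1 else sgn t)"

lemma spow_0 [simp]: "spow b e 0 = 0"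
  by (simp add: spow_def)

lemma abs_spow: "\<bar>spow b e t\<bar> = \<bar>t\<bar> powr b"
  by (simp add: spow_def abs_mult abs_sgn_eq)

lemma spow_mult_pos: "0 \<le> r \<Longrightarrow> spow b e (r * t) = r powr b * spow b e t"
  by (cases "r = 0") (auto simp: spow_def abs_mult powr_mult sgn_mult)

lemma continuous_on_spow [continuous_intros]:
  assumes "0 < b" "continuous_on S g"
  shows "continuous_on S (\<lambda>x. spow b e (g x))"
proof -
  have "isCont (spow b e) t" for t
  proof (cases "t = 0")
    case True
    have "((\<lambda>t. \<bar>t\<bar> powr b) \<longlongrightarrow> 0 powr b) (at (0::real))"
      using assms(1) by (intro tendsto_powr' tendsto_const tendsto_rabs_zero tendsto_ident_at) auto
    then have "((\<lambda>t. \<bar>spow b e t\<bar>) \<longlongrightarrow> 0) (at 0)" by (simp add: abs_spow)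
    then show ?thesis unfolding True by (simp add: isCont_def tendsto_rabs_zero_iff)
  next
    case False
    have "\<forall>\<^sub>F u in nhds t. \<bar>u\<bar> powr b * (if e then 1 else sgn t) = spow b e u"
    proof (cases "0 < t")
      case True
      then show ?thesis by (auto intro!: eventually_nhds_in_open[of "{0<..}", THEN eventually_mono] simp: spow_def)
    next
      case F: False
      then show ?thesis using False by (auto intro!: eventually_nhds_in_open[of "{..<0}", THEN eventually_mono] simp: spow_def)
    qed
    moreover have "isCont (\<lambda>u. \<bar>u\<bar> powr b * (if e then 1 else sgn t)) t"
      using False by (intro continuous_intros) auto
    ultimately show ?thesis using isCont_cong by fast
  qed
  then show ?thesis
    using continuous_on_compose2[OF continuous_at_imp_continuous_on[of UNIV "spow b e"] assms(2)] by simp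
qed

lemma DERIV_spow:
  assumes "1 < b" shows "(spow b e has_real_derivative b * spow (b - 1) (\<not> e) t) (at t)"
proof (cases "t = 0")
  case True
  have "((\<lambda>h. \<bar>h\<bar> powr (b - 1)) \<longlongrightarrow> 0 powr (b - 1)) (at (0::real))"
    using assms by (intro tendsto_powr' tendsto_const tendsto_rabs_zero tendsto_ident_at) auto
  then have "((\<lambda>h. \<bar>h\<bar> powr (b - 1)) \<longlongrightarrow> 0) (at (0::real))" by simp
  moreover have "\<forall>\<^sub>F h in at 0. \<bar>h\<bar> powr (b - 1) = \<bar>spow b e h / h\<bar>"
    by (auto simp: eventually_at_filter abs_spow powr_diff)
  ultimately have "((\<lambda>h. \<bar>spow b e h / h\<bar>) \<longlongrightarrow> 0) (at 0)" by (rule Lim_transform_eventually)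
  then have "((\<lambda>h. spow b e h / h) \<longlongrightarrow> 0) (at 0)" by (rule tendsto_rabs_zero_cancel)
  then show ?thesis unfolding True DERIV_def by simp
next
  case False
  \<comment> \<open>Near t the sign is constant, so |u| is the linear function sgn(t) u.\<close>
  have "((\<lambda>u. (sgn t * u) powr b * (if e then 1 else sgn t)) has_real_derivative
      (b * (sgn t * t) powr (b - 1) * sgn t) * (if e then 1 else sgn t)) (at t)"
    using False by (auto intro!: derivative_eq_intros simp: sgn_if)
  then show ?thesis
  proof (rule has_field_derivative_transform_within_open[where S = "if 0 < t then {0<..} else {..<0}", THEN DERIV_cong])
    show "(b * (sgn t * t) powr (b - 1) * sgn t) * (if e then 1 else sgn t) = b * spow (b - 1) (\<not> e) t"
      using False by (auto simp: spow_def sgn_if)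
  qed (use False in \<open>auto simp: spow_def sgn_if split: if_splits\<close>)
qed

lemma powr_add_le:
  fixes x y :: real
  assumes "0 \<le> x" "0 \<le> y" "0 \<le> \<nu>" "\<nu> \<le> 1" shows "(x + y) powr \<nu> \<le> x powr \<nu> + y powr \<nu>"
proof (cases "x + y = 0")
  case False
  then have pos: "0 < x + y" using assms by simp
  have le: "z / (x + y) \<le> (z / (x + y)) powr \<nu>" if "0 \<le> z" "z \<le> x + y" for z
    using that pos assms powr_mono'[of \<nu> 1 "z / (x + y)"] by auto
  have "1 = x / (x + y) + y / (x + y)" using pos by (simp flip: add_divide_distrib)
  also have "\<dots> \<le> (x / (x + y)) powr \<nu> + (y / (x + y)) powr \<nu>"
    using le[of x] le[of y] assms by simp
  also have "\<dots> = (x powr \<nu> + y powr \<nu>) / (x + y) powr \<nu>"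
    using assms by (simp add: powr_divide add_divide_distrib)
  finally show ?thesis using pos by (simp add: field_simps)
qed (use assms in simp)

lemma powr_diff_le:
  fixes x y :: real
  assumes "0 \<le> x" "0 \<le> y" "0 \<le> \<nu>" "\<nu> \<le> 1" shows "\<bar>x powr \<nu> - y powr \<nu>\<bar> \<le> \<bar>x - y\<bar> powr \<nu>"
proof -
  have *: "v powr \<nu> - u powr \<nu> \<le> \<bar>v - u\<bar> powr \<nu>" "u powr \<nu> \<le> v powr \<nu>" if "0 \<le> u" "u \<le> v" for u v
    using powr_add_le[of u "v - u" \<nu>] that assms powr_mono2[of \<nu> u v] by auto
  show ?thesis
    using *[of x y] *[of y x] assms by (cases "x \<le> y") (auto simp: abs_minus_commute)
qed

text \<open>For equal signs the constant is 1 by subadditivity of the power; for opposite signs both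
  |x| and |y| are at most |x - y|, which costs the 2 that reappears in
  \<open>C_const\<close>.\<close>

lemma spow_holder:
  assumes "0 < \<nu>" "\<nu> \<le> 1"
  shows "\<bar>spow \<nu> e x - spow \<nu> e y\<bar> \<le> 2 * \<bar>x - y\<bar> powr \<nu>"
proof (cases "x * y > 0")
  case True
  then have "sgn x = sgn y" by (auto simp: sgn_if zero_less_mult_iff)
  moreover have "\<bar>\<bar>x\<bar> - \<bar>y\<bar>\<bar> = \<bar>x - y\<bar>" using True by (auto simp: zero_less_mult_iff)
  ultimately have "\<bar>spow \<nu> e x - spow \<nu> e y\<bar> = \<bar>\<bar>x\<bar> powr \<nu> - \<bar>y\<bar> powr \<nu>\<bar>"
    using True by (auto simp: spow_def abs_mult abs_sgn_eq simp flip: left_diff_distrib)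
  also have "\<dots> \<le> \<bar>x - y\<bar> powr \<nu>"
    using powr_diff_le[of "\<bar>x\<bar>" "\<bar>y\<bar>" \<nu>] \<open>\<bar>\<bar>x\<bar> - \<bar>y\<bar>\<bar> = \<bar>x - y\<bar>\<close> assms by simp
  finally show ?thesis using powr_ge_zero[of "\<bar>x - y\<bar>" \<nu>] by linarith
next
  case False
  then have "\<bar>x\<bar> \<le> \<bar>x - y\<bar>" "\<bar>y\<bar> \<le> \<bar>x - y\<bar>" by (auto simp: zero_less_mult_iff)
  then have "\<bar>x\<bar> powr \<nu> \<le> \<bar>x - y\<bar> powr \<nu>" "\<bar>y\<bar> powr \<nu> \<le> \<bar>x - y\<bar> powr \<nu>"
    using assms by (auto intro: powr_mono2)
  moreover have "\<bar>spow \<nu> e x - spow \<nu> e y\<bar> \<le> \<bar>x\<bar> powr \<nu> + \<bar>y\<bar> powr \<nu>"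
    using abs_triangle_ineq4[of "spow \<nu> e x" "spow \<nu> e y"] by (simp add: abs_spow)
  ultimately show ?thesis by linarith
qed

text \<open>For exponent 1 the constant is 1 instead of 2. The case \<nu> = 0 of the remainder
  spends this bound twice and must still fit under the factor 2 in \<open>C_const\<close>.\<close>

lemma spow_lipschitz: "\<bar>spow 1 e x - spow 1 e y\<bar> \<le> \<bar>x - y\<bar>"
  by (auto simp: spow_def sgn_if)

section \<open>Averages over the circle\<close>

lemma integral_period_shift:
  fixes q :: "real \<Rightarrow> real"
  assumes cont: "continuous_on UNIV q" and per: "\<And>x. q (x + 2 * pi) = q x" and \<phi>: "0 \<le> \<phi>" "\<phi> \<le> 2 * pi"
  shows "integral {0..2*pi} (\<lambda>x. q (x - \<phi>)) = integral {0..2*pi} q"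
proof -
  have int: "q integrable_on {a..b}" for a b
    by (rule integrable_continuous_real) (rule continuous_on_subset[OF cont], simp)
  have "integral {0..2*pi} (\<lambda>x. q (x - \<phi>)) = integral {-\<phi>..2*pi-\<phi>} q"
    using integral_shift_real_ivl[of "-\<phi>" "-\<phi>" "2*pi-\<phi>" q] by simp
  also have "\<dots> = integral {-\<phi>..0} q + integral {0..2*pi-\<phi>} q"
    using \<phi> by (intro Henstock_Kurzweil_Integration.integral_combine[symmetric] int) auto
  also have "integral {-\<phi>..0} q = integral {2*pi-\<phi>..2*pi} q"
    using integral_shift_real_ivl[of "2*pi-\<phi>" "2*pi" "2*pi" q] per by simp
  also have "\<dots> + integral {0..2*pi-\<phi>} q = integral {0..2*pi-\<phi>} q + integral {2*pi-\<phi>..2*pi} q" by simp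
  also have "\<dots> = integral {0..2*pi} q"
    using \<phi> by (intro Henstock_Kurzweil_Integration.integral_combine int) auto
  finally show ?thesis .
qed

definition circle_int :: "real \<Rightarrow> real" where
  "circle_int s = integral {0..2*pi} (\<lambda>\<omega>. \<bar>cos \<omega>\<bar> powr s)"

lemma circle_int_pos: assumes "0 < s" shows "0 < circle_int s"
proof -
  have cont: "continuous_on {0..2*pi} (\<lambda>\<omega>. \<bar>cos \<omega>\<bar> powr s)"
    using assms by (intro continuous_on_powr' continuous_intros) auto
  have "0 \<le> circle_int s"
    unfolding circle_int_def by (intro integral_nonneg integrable_continuous_real cont) auto
  moreover have "circle_int s \<noteq> 0"
  proof
    assume "circle_int s = 0"
    then have "((\<lambda>\<omega>. \<bar>cos \<omega>\<bar> powr s) has_integral 0) (cbox 0 (2*pi))"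
      using integrable_integral[OF integrable_continuous_real[OF cont]] by (simp add: circle_int_def)
    moreover have "box 0 (2*pi) \<noteq> {}" "(0::real) \<in> cbox 0 (2*pi)"
      using pi_gt_zero by (auto simp: box_ne_empty simp del: pi_gt_zero)
    ultimately show False
      using has_integral_0_cbox_imp_0[of 0 "2*pi" "\<lambda>\<omega>. \<bar>cos \<omega>\<bar> powr s" 0] cont by simp
  qed
  ultimately show ?thesis by linarith
qed

lemma polar: obtains \<rho> \<phi> where "0 \<le> \<rho>" "0 \<le> \<phi>" "\<phi> \<le> 2 * pi" "x = \<rho> * cos \<phi>" "y = \<rho> * sin \<phi>" "\<rho> = sqrt (x\<^sup>2 + y\<^sup>2)"
proof (cases "x\<^sup>2 + y\<^sup>2 = 0")
  case True
  then show ?thesis using that[of 0 0] by (simp add: sum_power2_eq_zero_iff)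
next
  case False
  define \<rho> where "\<rho> = sqrt (x\<^sup>2 + y\<^sup>2)"
  have pos: "0 < x\<^sup>2 + y\<^sup>2" using False sum_power2_ge_zero[of x y] by linarith
  then have \<rho>: "0 < \<rho>" "\<rho>\<^sup>2 = x\<^sup>2 + y\<^sup>2" by (simp_all add: \<rho>_def)
  have "(x / \<rho>)\<^sup>2 + (y / \<rho>)\<^sup>2 = 1"
    using \<rho> False by (simp add: power_divide flip: add_divide_distrib)
  then obtain t where t: "0 \<le> t" "t < 2*pi" "x / \<rho> = cos t" "y / \<rho> = sin t"
    by (rule sincos_total_2pi)
  have xy: "x = \<rho> * cos t" "y = \<rho> * sin t"
    using \<rho>(1) by (simp_all flip: t(3,4))
  show ?thesis
    by (rule that[OF _ _ _ xy \<rho>_def]) (use \<rho>(1) t(1,2) in auto)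
qed

text \<open>The gradient of the averaging formula for |x|^s, in direction (h1, h2). It starts from
  the gradient because that is the function which is differentiated further later on.\<close>

lemma circle_average:
  assumes s: "1 < s"
  shows "integral {0..2*pi} (\<lambda>\<omega>. spow (s - 1) False (x * cos \<omega> + y * sin \<omega>) * (h1 * cos \<omega> + h2 * sin \<omega>))
    = circle_int s * (sqrt (x\<^sup>2 + y\<^sup>2) powr (s - 2) * (x * h1 + y * h2))"
proof -
  obtain \<rho> \<phi> where p: "0 \<le> \<rho>" "0 \<le> \<phi>" "\<phi> \<le> 2 * pi" "x = \<rho> * cos \<phi>" "y = \<rho> * sin \<phi>" "\<rho> = sqrt (x\<^sup>2 + y\<^sup>2)"
    by (rule polar)
  \<comment> \<open>Components of the test vector along (x, y) and perpendicular to it, after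
    rotating by the polar angle. The perpendicular one integrates to 0, its integrand being the
    derivative of a periodic function.\<close>
  define a b where "a = h1 * cos \<phi> + h2 * sin \<phi>" and "b = h2 * cos \<phi> - h1 * sin \<phi>"
  define q where "q \<omega> = spow (s - 1) False (cos \<omega>) * (a * cos \<omega> + b * sin \<omega>)" for \<omega>
  have cont: "continuous_on S (\<lambda>\<omega>. spow (s - 1) False (cos \<omega>))" for S
    using s by (intro continuous_intros) auto
  have contq: "continuous_on UNIV q"
    unfolding q_def[abs_def] by (intro continuous_intros cont)
  have spow1: "spow (s - 1) False t * t = \<bar>t\<bar> powr s" for t
    using powr_add[of "\<bar>t\<bar>" "s - 1" 1] by (cases "t = 0") (auto simp: spow_def sgn_mult_abs mult.assoc sgn_if)
  have int1: "integral {0..2*pi} (\<lambda>\<omega>. spow (s - 1) False (cos \<omega>) * cos \<omega>) = circle_int s"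
    by (simp add: spow1 circle_int_def)
  have "((\<lambda>\<omega>. spow (s - 1) False (cos \<omega>) * sin \<omega>) has_integral
      (- spow s True (cos (2*pi)) / s) - (- spow s True (cos 0) / s)) {0..2*pi}"
  proof (rule fundamental_theorem_of_calculus)
    fix \<omega> :: real
    have "((\<lambda>\<omega>. - spow s True (cos \<omega>) / s) has_real_derivative
       - ((s * spow (s - 1) (\<not> True) (cos \<omega>)) * - sin \<omega>) / s) (at \<omega>)"
      by (intro DERIV_cdivide DERIV_minus DERIV_chain2[OF DERIV_spow[OF s]] DERIV_cos)
    then have "((\<lambda>\<omega>. - spow s True (cos \<omega>) / s) has_real_derivative spow (s - 1) False (cos \<omega>) * sin \<omega>) (at \<omega>)"
      using s by simp
    then show "((\<lambda>\<omega>. - spow s True (cos \<omega>) / s) has_vector_derivative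
       spow (s - 1) False (cos \<omega>) * sin \<omega>) (at \<omega> within {0..2*pi})"
      unfolding has_real_derivative_iff_has_vector_derivative by (rule has_vector_derivative_at_within)
  qed simp
  then have int2: "integral {0..2*pi} (\<lambda>\<omega>. spow (s - 1) False (cos \<omega>) * sin \<omega>) = 0"
    by (simp add: integral_unique)
  have "integral {0..2*pi} q = integral {0..2*pi} (\<lambda>\<omega>. a * (spow (s - 1) False (cos \<omega>) * cos \<omega>) + b * (spow (s - 1) False (cos \<omega>) * sin \<omega>))"
    unfolding q_def by (simp add: algebra_simps)
  also have "\<dots> = a * circle_int s"
    by (subst Henstock_Kurzweil_Integration.integral_add)
      (auto intro!: integrable_continuous_real continuous_intros cont simp: int1 int2)
  finally have intq: "integral {0..2*pi} q = a * circle_int s" .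
  have "spow (s - 1) False (x * cos \<omega> + y * sin \<omega>) * (h1 * cos \<omega> + h2 * sin \<omega>) = \<rho> powr (s - 1) * q (\<omega> - \<phi>)" for \<omega>
  proof -
    have "x * cos \<omega> + y * sin \<omega> = \<rho> * cos (\<omega> - \<phi>)" unfolding p(4,5) by (simp add: cos_diff algebra_simps)
    moreover have "h1 * cos \<omega> + h2 * sin \<omega> = a * cos (\<omega> - \<phi>) + b * sin (\<omega> - \<phi>)"
    proof -
      have "cos \<omega> = cos (\<omega> - \<phi>) * cos \<phi> - sin (\<omega> - \<phi>) * sin \<phi>" "sin \<omega> = sin (\<omega> - \<phi>) * cos \<phi> + cos (\<omega> - \<phi>) * sin \<phi>"
        using cos_add[of "\<omega> - \<phi>" \<phi>] sin_add[of "\<omega> - \<phi>" \<phi>] by simp_all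
      then show ?thesis by (simp only: a_def b_def) (simp add: algebra_simps)
    qed
    ultimately show ?thesis using p(1) by (simp add: spow_mult_pos q_def)
  qed
  then have "integral {0..2*pi} (\<lambda>\<omega>. spow (s - 1) False (x * cos \<omega> + y * sin \<omega>) * (h1 * cos \<omega> + h2 * sin \<omega>))
     = \<rho> powr (s - 1) * integral {0..2*pi} (\<lambda>\<omega>. q (\<omega> - \<phi>))"
    by simp
  also have "\<dots> = \<rho> powr (s - 1) * (a * circle_int s)"
    using integral_period_shift[OF contq _ p(2,3)] intq by (simp add: q_def)
  also have "\<dots> = circle_int s * (\<rho> powr (s - 2) * (\<rho> * a))"
    using p(1) powr_add[of \<rho> "s - 2" 1] by (cases "\<rho> = 0") (simp_all add: mult_ac)
  also have "\<rho> * a = x * h1 + y * h2" unfolding p(4,5) by (simp add: a_def algebra_simps)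
  finally show ?thesis by (simp only: p(6)[symmetric])
qed

text \<open>Young's inequality with weights (s - 1) / s and 1 / s: both resulting terms are
  rotations of |cos|^s with the same integral, so the weights add up to 1. The normalizing constant
  then cancels exactly and the planar Hoelder constant is no worse than the one on the line.\<close>

lemma circle_holder:
  assumes s: "1 < s"
  shows "integral {0..2*pi} (\<lambda>\<omega>. \<bar>cos \<omega>\<bar> powr (s - 1) * \<bar>h1 * cos \<omega> + h2 * sin \<omega>\<bar>) \<le> circle_int s * sqrt (h1\<^sup>2 + h2\<^sup>2)"
proof -
  obtain \<eta> \<phi> where p: "0 \<le> \<eta>" "0 \<le> \<phi>" "\<phi> \<le> 2 * pi" "h1 = \<eta> * cos \<phi>" "h2 = \<eta> * sin \<phi>" "\<eta> = sqrt (h1\<^sup>2 + h2\<^sup>2)"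
    by (rule polar)
  have cont: "continuous_on S (\<lambda>\<omega>. \<bar>cos (\<omega> - c)\<bar> powr r)" if "0 < r" for S and c r :: real
    by (intro continuous_on_powr' continuous_intros) (use that in auto)
  have cont0: "continuous_on S (\<lambda>\<omega>. \<bar>cos \<omega>\<bar> powr r)" if "0 < r" for S and r :: real
    using cont[OF that, of S 0] by simp
  have h: "h1 * cos \<omega> + h2 * sin \<omega> = \<eta> * cos (\<omega> - \<phi>)" for \<omega>
    unfolding p(4,5) by (simp add: cos_diff algebra_simps)
  have young: "\<bar>cos \<omega>\<bar> powr (s - 1) * \<bar>cos (\<omega> - \<phi>)\<bar> \<le> (s - 1) / s * \<bar>cos \<omega>\<bar> powr s + 1 / s * \<bar>cos (\<omega> - \<phi>)\<bar> powr s" for \<omega>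
  proof -
    have "1 / (s / (s - 1)) + 1 / s = 1" "1 < s / (s - 1)" using s by (simp_all add: field_simps)
    from Youngs_inequality[OF this(2) s this(1), of "\<bar>cos \<omega>\<bar> powr (s - 1)" "\<bar>cos (\<omega> - \<phi>)\<bar>"]
    have "\<bar>cos \<omega>\<bar> powr (s - 1) * \<bar>cos (\<omega> - \<phi>)\<bar> \<le>
      (\<bar>cos \<omega>\<bar> powr (s - 1)) powr (s / (s - 1)) / (s / (s - 1)) + \<bar>cos (\<omega> - \<phi>)\<bar> powr s / s" by simp
    moreover have "(s - 1) * (s / (s - 1)) = s" using s by simp
    ultimately show ?thesis unfolding powr_powr by (simp add: mult.commute)
  qed
  have int2: "integral {0..2*pi} (\<lambda>\<omega>. \<bar>cos (\<omega> - \<phi>)\<bar> powr s) = circle_int s"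
    unfolding circle_int_def
    using integral_period_shift[OF cont0 _ p(2,3), of s] s by simp
  have "integral {0..2*pi} (\<lambda>\<omega>. \<bar>cos \<omega>\<bar> powr (s - 1) * \<bar>h1 * cos \<omega> + h2 * sin \<omega>\<bar>)
     \<le> integral {0..2*pi} (\<lambda>\<omega>. \<eta> * ((s - 1) / s * \<bar>cos \<omega>\<bar> powr s + 1 / s * \<bar>cos (\<omega> - \<phi>)\<bar> powr s))"
  proof (rule integral_le)
    show "(\<lambda>\<omega>. \<bar>cos \<omega>\<bar> powr (s - 1) * \<bar>h1 * cos \<omega> + h2 * sin \<omega>\<bar>) integrable_on {0..2*pi}"
      using s by (intro integrable_continuous_real continuous_intros cont0) auto
    show "(\<lambda>\<omega>. \<eta> * ((s - 1) / s * \<bar>cos \<omega>\<bar> powr s + 1 / s * \<bar>cos (\<omega> - \<phi>)\<bar> powr s)) integrable_on {0..2*pi}"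
      using s by (intro integrable_continuous_real continuous_on_add continuous_on_mult continuous_on_const cont0 cont) auto
    show "\<bar>cos \<omega>\<bar> powr (s - 1) * \<bar>h1 * cos \<omega> + h2 * sin \<omega>\<bar> \<le> \<eta> * ((s - 1) / s * \<bar>cos \<omega>\<bar> powr s + 1 / s * \<bar>cos (\<omega> - \<phi>)\<bar> powr s)" for \<omega>
      using mult_left_mono[OF young[of \<omega>] p(1)] p(1) by (simp add: h abs_mult mult_ac)
  qed
  also have "\<dots> = \<eta> * ((s - 1) / s * circle_int s + 1 / s * circle_int s)"
    unfolding Henstock_Kurzweil_Integration.integral_mult_right
    by (subst Henstock_Kurzweil_Integration.integral_add)
      (use s in \<open>auto intro!: integrable_continuous_real continuous_on_mult continuous_on_const cont0 cont simp: int2 circle_int_def\<close>)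
  also have "\<dots> = circle_int s * \<eta>" using s by (simp add: field_simps)
  finally show ?thesis by (simp only: p(6)[symmetric])
qed

text \<open>\<open>\<parallel>x\<parallel>\<^sup>s\<close> in a plane is an average of \<open>|\<langle>x, \<omega>\<rangle>|\<^sup>s\<close> over unit vectors \<open>\<omega>\<close>, so the
  Hoelder constant of its derivatives reduces to that of \<open>|t|\<^sup>s\<close> on the line.\<close>
lemma planar_power_holder:
  fixes g :: "nat \<Rightarrow> real \<Rightarrow> real"
  assumes "1 \<le> p" "0 < \<nu>" and s: "s = real p + \<nu>" and r: "0 \<le> r"
    and g0: "\<And>\<tau>. g 0 \<tau> = s * (sqrt ((x + \<tau> * r)\<^sup>2 + y\<^sup>2) powr (s - 2) * ((x + \<tau> * r) * h1 + y * h2))"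
    and g_der: "\<And>k \<tau>. k < p - 1 \<Longrightarrow> (g k has_real_derivative g (Suc k) \<tau>) (at \<tau>)"
    and K: "\<And>u v. \<bar>spow \<nu> (even p) u - spow \<nu> (even p) v\<bar> \<le> K * \<bar>u - v\<bar> powr \<nu>" "0 \<le> K" and \<tau>: "0 \<le> \<tau>"
  shows "\<bar>g (p - 1) \<tau> - g (p - 1) 0\<bar> \<le> K * (\<Prod>i=1..p. \<nu> + real i) * r powr (s - 1) * \<tau> powr \<nu> * sqrt (h1\<^sup>2 + h2\<^sup>2)"
proof -
  \<comment> \<open>c k is the falling factorial of s - 1 and W k is the k-th derivative in \<tau>
    of the integrand: L is affine in \<tau> with slope r cos \<omega>, and each derivative flips the
    parity.\<close>
  define c where "c k = (\<Prod>i<k. s - 1 - real i)" for k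
  define L where "L \<omega> \<tau> = (x + \<tau> * r) * cos \<omega> + y * sin \<omega>" for \<omega> \<tau>
  define w where "w \<omega> = h1 * cos \<omega> + h2 * sin \<omega>" for \<omega>
  define W where "W k \<tau> \<omega> = c k * spow (s - 1 - real k) (odd k) (L \<omega> \<tau>) * (r * cos \<omega>) ^ k * w \<omega>" for k \<tau> \<omega>
  have s1: "1 < s" using assms by simp
  have cont: "continuous_on (UNIV \<times> cbox 0 (2*pi)) (\<lambda>(\<tau>, \<omega>). W k \<tau> \<omega>)" if "k \<le> p - 1" for k
  proof -
    have "0 < s - 1 - real k" using that assms by linarith
    then show ?thesis unfolding W_def L_def w_def case_prod_unfold by (intro continuous_intros) auto
  qed
  have cont1: "continuous_on {0..2*pi} (W k \<tau>)" if "k \<le> p - 1" for k \<tau>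
  proof -
    have "0 < s - 1 - real k" using that assms by linarith
    then show ?thesis unfolding W_def[abs_def] L_def w_def by (intro continuous_intros) auto
  qed
  have W_der: "((\<lambda>\<tau>. W k \<tau> \<omega>) has_real_derivative W (Suc k) \<tau> \<omega>) (at \<tau>)" if "k < p - 1" for k \<tau> \<omega>
  proof -
    have k: "1 < s - 1 - real k" using that assms by linarith
    have "((\<lambda>\<tau>. L \<omega> \<tau>) has_real_derivative r * cos \<omega>) (at \<tau>)"
      unfolding L_def by (auto intro!: derivative_eq_intros)
    from DERIV_chain2[OF DERIV_spow[OF k] this]
    have "((\<lambda>\<tau>. W k \<tau> \<omega>) has_real_derivative
       c k * ((s - 1 - real k) * spow (s - 1 - real k - 1) (\<not> odd k) (L \<omega> \<tau>) * (r * cos \<omega>)) * (r * cos \<omega>) ^ k * w \<omega>) (at \<tau>)"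
      unfolding W_def by (intro DERIV_cmult DERIV_cmult_right)
    moreover have "c (Suc k) = c k * (s - 1 - real k)" "s - 1 - real (Suc k) = s - 1 - real k - 1" "odd (Suc k) = (\<not> odd k)"
      by (simp_all add: c_def)
    then have "W (Suc k) \<tau> \<omega> = c k * ((s - 1 - real k) * spow (s - 1 - real k - 1) (\<not> odd k) (L \<omega> \<tau>) * (r * cos \<omega>)) * (r * cos \<omega>) ^ k * w \<omega>"
      unfolding W_def by (simp only: power_Suc mult.assoc mult.left_commute mult.commute)
    ultimately show ?thesis by (simp only:)
  qed
  \<comment> \<open>Differentiation under the integral sign, order by order; uniqueness of
    derivatives identifies the result with the given g.\<close>
  have g_eq: "g k \<tau> = s / circle_int s * integral {0..2*pi} (W k \<tau>)" if "k \<le> p - 1" for k \<tau>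
    using that
  proof (induction k arbitrary: \<tau>)
    case 0
    show ?case
      using circle_average[OF s1, of "x + \<tau> * r" y h1 h2] circle_int_pos[of s] s1
      by (simp add: g0 W_def[abs_def] L_def w_def c_def)
  next
    case (Suc k)
    have "((\<lambda>\<tau>. integral (cbox 0 (2*pi)) (W k \<tau>)) has_real_derivative integral (cbox 0 (2*pi)) (W (Suc k) \<tau>)) (at \<tau> within UNIV)"
    proof (rule leibniz_rule_field_derivative)
      show "W k \<tau> integrable_on cbox 0 (2*pi)" for \<tau>
        using cont1[of k \<tau>] Suc.prems by (simp add: integrable_continuous_real)
    qed (use W_der Suc.prems cont in auto)
    from DERIV_cmult[OF this, of "s / circle_int s"]
    have "((\<lambda>\<tau>. s / circle_int s * integral {0..2*pi} (W k \<tau>)) has_real_derivative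
      s / circle_int s * integral {0..2*pi} (W (Suc k) \<tau>)) (at \<tau>)"
      by (simp only: cbox_interval)
    moreover have "(\<lambda>\<tau>. s / circle_int s * integral {0..2*pi} (W k \<tau>)) = g k"
      using Suc.IH Suc.prems by (intro ext) simp
    ultimately have "(g k has_real_derivative s / circle_int s * integral {0..2*pi} (W (Suc k) \<tau>)) (at \<tau>)"
      by (simp only:)
    then show ?case using g_der[of k \<tau>] Suc.prems by (intro DERIV_unique[of "g k"]) auto
  qed
  \<comment> \<open>With s = p + \<nu> the factors s, s - 1, ..., s - p + 1 are exactly \<nu> + p,
    ..., \<nu> + 1.\<close>
  have c_prod: "s * c (p - 1) = (\<Prod>i=1..p. \<nu> + real i)"
  proof -
    have "s * c (p - 1) = (\<Prod>i<Suc (p - 1). s - real i)"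
      by (subst prod.lessThan_Suc_shift) (simp add: c_def algebra_simps)
    also have "\<dots> = (\<Prod>i=1..p. \<nu> + real i)"
      using assms(1) by (intro prod.reindex_bij_witness[of _ "\<lambda>i. p - i" "\<lambda>i. p - i"]) (auto simp: s of_nat_diff)
    finally show ?thesis .
  qed
  have c_nonneg: "0 \<le> c (p - 1)"
    unfolding c_def using assms(1-3) by (intro prod_nonneg) auto
  have sp: "s - 1 - real (p - 1) = \<nu>" "odd (p - 1) = even p" using assms by (auto simp: of_nat_diff)
  have bound: "\<bar>W (p - 1) \<tau> \<omega> - W (p - 1) 0 \<omega>\<bar>
     \<le> c (p - 1) * K * r powr (s - 1) * \<tau> powr \<nu> * (\<bar>cos \<omega>\<bar> powr (s - 1) * \<bar>w \<omega>\<bar>)" for \<omega>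
  \<comment> \<open>A natural power is rewritten as a real power below, which requires a positive
    base.\<close>
  proof (cases "r = 0 \<or> cos \<omega> = 0")
    case True
    then show ?thesis by (auto simp: W_def L_def)
  next
    case False
    have "\<bar>W (p - 1) \<tau> \<omega> - W (p - 1) 0 \<omega>\<bar> = c (p - 1) * \<bar>spow \<nu> (even p) (L \<omega> \<tau>) - spow \<nu> (even p) (L \<omega> 0)\<bar> * (r * \<bar>cos \<omega>\<bar>) ^ (p - 1) * \<bar>w \<omega>\<bar>"
      unfolding W_def sp using r c_nonneg
      by (simp add: abs_mult power_abs flip: left_diff_distrib right_diff_distrib)
    also have "\<dots> \<le> c (p - 1) * (K * \<bar>L \<omega> \<tau> - L \<omega> 0\<bar> powr \<nu>) * (r * \<bar>cos \<omega>\<bar>) ^ (p - 1) * \<bar>w \<omega>\<bar>"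
      using K c_nonneg r by (intro mult_right_mono mult_left_mono) auto
    also have "\<bar>L \<omega> \<tau> - L \<omega> 0\<bar> = \<tau> * (r * \<bar>cos \<omega>\<bar>)"
      using r \<tau> by (simp add: L_def abs_mult algebra_simps flip: left_diff_distrib)
    also have "c (p - 1) * (K * (\<tau> * (r * \<bar>cos \<omega>\<bar>)) powr \<nu>) * (r * \<bar>cos \<omega>\<bar>) ^ (p - 1) * \<bar>w \<omega>\<bar>
       = c (p - 1) * K * \<tau> powr \<nu> * ((r * \<bar>cos \<omega>\<bar>) powr \<nu> * (r * \<bar>cos \<omega>\<bar>) powr (real (p - 1))) * \<bar>w \<omega>\<bar>"
      using r \<tau> False by (simp add: powr_mult powr_realpow power_mult_distrib)
    also have "(r * \<bar>cos \<omega>\<bar>) powr \<nu> * (r * \<bar>cos \<omega>\<bar>) powr (real (p - 1)) = (r * \<bar>cos \<omega>\<bar>) powr (s - 1)"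
    proof -
      have "\<nu> + real (p - 1) = s - 1" using sp(1) by linarith
      then show ?thesis by (simp only: powr_add[symmetric])
    qed
    finally show ?thesis using r by (simp add: powr_mult mult_ac)
  qed
  have "\<bar>g (p - 1) \<tau> - g (p - 1) 0\<bar> = s / circle_int s * \<bar>integral {0..2*pi} (\<lambda>\<omega>. W (p - 1) \<tau> \<omega> - W (p - 1) 0 \<omega>)\<bar>"
  proof -
    have "integral {0..2*pi} (\<lambda>\<omega>. W (p - 1) \<tau> \<omega> - W (p - 1) 0 \<omega>) = integral {0..2*pi} (W (p - 1) \<tau>) - integral {0..2*pi} (W (p - 1) 0)"
      by (intro Henstock_Kurzweil_Integration.integral_diff integrable_continuous_real cont1) auto
    then have "g (p - 1) \<tau> - g (p - 1) 0 = s / circle_int s * integral {0..2*pi} (\<lambda>\<omega>. W (p - 1) \<tau> \<omega> - W (p - 1) 0 \<omega>)"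
      by (simp only: g_eq[OF order_refl] right_diff_distrib)
    moreover have "0 \<le> s / circle_int s" using s1 circle_int_pos[of s] by simp
    ultimately show ?thesis by (simp only: abs_mult abs_of_nonneg)
  qed
  also have "\<dots> \<le> s / circle_int s * (c (p - 1) * K * r powr (s - 1) * \<tau> powr \<nu> * (circle_int s * sqrt (h1\<^sup>2 + h2\<^sup>2)))"
  proof (rule mult_left_mono)
    have "norm (integral {0..2*pi} (\<lambda>\<omega>. W (p - 1) \<tau> \<omega> - W (p - 1) 0 \<omega>))
      \<le> integral {0..2*pi} (\<lambda>\<omega>. c (p - 1) * K * r powr (s - 1) * \<tau> powr \<nu> * (\<bar>cos \<omega>\<bar> powr (s - 1) * \<bar>w \<omega>\<bar>))"
    proof (rule integral_norm_bound_integral)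
      show "(\<lambda>\<omega>. W (p - 1) \<tau> \<omega> - W (p - 1) 0 \<omega>) integrable_on {0..2*pi}"
        by (intro integrable_continuous_real continuous_on_diff cont1) auto
      show "(\<lambda>\<omega>. c (p - 1) * K * r powr (s - 1) * \<tau> powr \<nu> * (\<bar>cos \<omega>\<bar> powr (s - 1) * \<bar>w \<omega>\<bar>)) integrable_on {0..2*pi}"
        unfolding w_def using s1 by (intro integrable_continuous_real continuous_intros continuous_on_powr') auto
    qed (use bound in simp)
    also have "\<dots> = c (p - 1) * K * r powr (s - 1) * \<tau> powr \<nu> * integral {0..2*pi} (\<lambda>\<omega>. \<bar>cos \<omega>\<bar> powr (s - 1) * \<bar>w \<omega>\<bar>)"
      by (rule Henstock_Kurzweil_Integration.integral_mult_right)
    also have "\<dots> \<le> c (p - 1) * K * r powr (s - 1) * \<tau> powr \<nu> * (circle_int s * sqrt (h1\<^sup>2 + h2\<^sup>2))"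
      using c_nonneg K(2) circle_holder[OF s1, of h1 h2] by (intro mult_left_mono) (auto simp: w_def)
    finally show "\<bar>integral {0..2*pi} (\<lambda>\<omega>. W (p - 1) \<tau> \<omega> - W (p - 1) 0 \<omega>)\<bar> \<le> c (p - 1) * K * r powr (s - 1) * \<tau> powr \<nu> * (circle_int s * sqrt (h1\<^sup>2 + h2\<^sup>2))"
      by simp
    show "0 \<le> s / circle_int s" using s1 circle_int_pos[of s] by simp
  qed
  also have "\<dots> = K * (s * c (p - 1)) * r powr (s - 1) * \<tau> powr \<nu> * sqrt (h1\<^sup>2 + h2\<^sup>2)"
    using s1 circle_int_pos[of s] by simp
  finally show ?thesis by (simp only: c_prod)
qed

section \<open>Powers of the norm\<close>

context euclid
begin

text \<open>\<open>pw a \<beta> e F\<close>: \<open>F\<close> is homogeneous of degree \<open>\<beta>\<close> about \<open>a\<close> and even or odd according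
  to \<open>e\<close>. All iterated derivatives of \<open>N (x - a) powr s\<close> are of this form off \<open>a\<close>; at \<open>a\<close> the
  convention \<open>0 powr b = 0\<close> gives them the value 0.\<close>
inductive pw :: "'a \<Rightarrow> real \<Rightarrow> bool \<Rightarrow> ('a \<Rightarrow> real) \<Rightarrow> bool" for a where
  zero: "pw a \<beta> e (\<lambda>_. 0)"
| add: "pw a \<beta> e F \<Longrightarrow> pw a \<beta> e G \<Longrightarrow> pw a \<beta> e (\<lambda>x. F x + G x)"
| base: "set hs \<subseteq> E \<Longrightarrow> \<beta> = b + real (length hs) \<Longrightarrow> e = even (length hs) \<Longrightarrow>
    pw a \<beta> e (\<lambda>x. c * (N (x - a) powr b * prod_list (map (B (x - a)) hs)))"

lemma pw_cmult: "pw a \<beta> e F \<Longrightarrow> pw a \<beta> e (\<lambda>x. c * F x)"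
proof (induction rule: pw.induct)
  case (base hs \<beta> b e d)
  then show ?case using pw.base[of hs \<beta> b e a "c * d"] by (simp add: mult.assoc)
qed (auto simp: distrib_left intro: pw.zero pw.add)

lemma pw_mult:
  assumes "h \<in> E" "pw a \<beta> e F" shows "pw a (\<beta> + 1) (\<not> e) (\<lambda>x. F x * B (x - a) h)"
  using assms(2)
proof (induction rule: pw.induct)
  case (zero \<beta> e)
  then show ?case by (simp add: pw.zero)
next
  case (add \<beta> e F G)
  then show ?case by (simp add: distrib_right pw.add)
next
  case (base hs \<beta> b e c)
  then show ?case
    using pw.base[of "h # hs" "\<beta> + 1" b "\<not> e" a c] assms(1) by (simp add: mult_ac)
qed

lemma pw_at_center: "pw a \<beta> e F \<Longrightarrow> F a = 0"
  by (induction rule: pw.induct) auto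

lemma pw_bound:
  assumes "a \<in> E" "pw a \<beta> e F" shows "\<exists>K\<ge>0. \<forall>x\<in>E. \<bar>F x\<bar> \<le> K * N (x - a) powr \<beta>"
  using assms(2)
proof (induction rule: pw.induct)
  case (zero \<beta> e)
  then show ?case by (intro exI[of _ 0]) auto
next
  case (add \<beta> e F G)
  then obtain K L where KL: "0 \<le> K" "0 \<le> L" "\<And>x. x \<in> E \<Longrightarrow> \<bar>F x\<bar> \<le> K * N (x - a) powr \<beta>"
    "\<And>x. x \<in> E \<Longrightarrow> \<bar>G x\<bar> \<le> L * N (x - a) powr \<beta>" by blast
  show ?case
  proof (intro exI[of _ "K + L"] conjI ballI)
    fix x assume "x \<in> E"
    then show "\<bar>F x + G x\<bar> \<le> (K + L) * N (x - a) powr \<beta>"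
      using KL(3,4)[of x] abs_triangle_ineq[of "F x" "G x"] by (simp add: distrib_right)
  qed (use KL in auto)
next
  case (base hs \<beta> b e c)
  have prod: "\<bar>prod_list (map (B v) hs)\<bar> \<le> prod_list (map N hs) * N v ^ length hs" if "v \<in> E" "set hs \<subseteq> E" for v hs
    using that(2)
  proof (induction hs)
    case (Cons h hs)
    have "\<bar>B v h\<bar> * \<bar>prod_list (map (B v) hs)\<bar> \<le> (N v * N h) * (prod_list (map N hs) * N v ^ length hs)"
      using Cons that B_cauchy_schwarz[of v h] by (intro mult_mono) auto
    then show ?case by (simp add: abs_mult mult_ac)
  qed auto
  have nn: "0 \<le> prod_list (map N hs)" using base(1) by (induction hs) auto
  show ?case
  proof (intro exI[of _ "\<bar>c\<bar> * prod_list (map N hs)"] conjI ballI)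
    fix x assume x: "x \<in> E"
    have v: "x - a \<in> E" using x assms by auto
    show "\<bar>c * (N (x - a) powr b * prod_list (map (B (x - a)) hs))\<bar> \<le> \<bar>c\<bar> * prod_list (map N hs) * N (x - a) powr \<beta>"
    proof (cases "x = a")
      case False
      then have pos: "0 < N (x - a)" using v N_pos by auto
      have "\<bar>c * (N (x - a) powr b * prod_list (map (B (x - a)) hs))\<bar> = \<bar>c\<bar> * (N (x - a) powr b * \<bar>prod_list (map (B (x - a)) hs)\<bar>)"
        by (simp add: abs_mult)
      also have "\<dots> \<le> \<bar>c\<bar> * (N (x - a) powr b * (prod_list (map N hs) * N (x - a) ^ length hs))"
        using prod[OF v base(1)] by (intro mult_left_mono) auto
      also have "\<dots> = \<bar>c\<bar> * prod_list (map N hs) * (N (x - a) powr b * N (x - a) powr real (length hs))"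
        using pos by (simp add: powr_realpow)
      also have "N (x - a) powr b * N (x - a) powr real (length hs) = N (x - a) powr \<beta>"
        by (simp add: base(2) powr_add)
      finally show ?thesis .
    qed simp
  qed (use nn in simp)
qed

lemma pw_reflect: "pw a \<beta> e F \<Longrightarrow> F (a - v) = (if e then 1 else - 1) * F (a + v)"
proof (induction rule: pw.induct)
  case (base hs \<beta> b e c)
  have "prod_list (map (B (- v)) hs) = (- 1) ^ length hs * prod_list (map (B v) hs)"
    by (induction hs) (simp_all add: B_simps)
  then show ?case using base by simp
qed (auto simp: algebra_simps)

lemma pw_derivative:
  assumes a: "a \<in> E" and "pw a \<beta> e F"
  shows "\<exists>F1. (\<forall>h\<in>E. pw a (\<beta> - 1) (\<not> e) (F1 h)) \<and> (\<forall>x\<in>E. x \<noteq> a \<longrightarrow> der F (\<lambda>h. F1 h x) x)"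
  using assms(2)
proof (induction rule: pw.induct)
  case (zero \<beta> e)
  show ?case by (intro exI[of _ "\<lambda>_ _. 0"]) (simp add: pw.zero der_const)
next
  case (add \<beta> e F G)
  then obtain F1 G1 where F1: "\<forall>h\<in>E. pw a (\<beta> - 1) (\<not> e) (F1 h)" "\<forall>x\<in>E. x \<noteq> a \<longrightarrow> der F (\<lambda>h. F1 h x) x"
    and G1: "\<forall>h\<in>E. pw a (\<beta> - 1) (\<not> e) (G1 h)" "\<forall>x\<in>E. x \<noteq> a \<longrightarrow> der G (\<lambda>h. G1 h x) x" by blast
  then show ?case
    by (intro exI[of _ "\<lambda>h x. F1 h x + G1 h x"]) (simp add: pw.add der_add)
next
  case (base hs \<beta> b e c)
  from base(1) have "\<exists>F1. (\<forall>h\<in>E. pw a (b + real (length hs) - 1) (\<not> even (length hs)) (F1 h)) \<and>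
     (\<forall>x\<in>E. x \<noteq> a \<longrightarrow> der (\<lambda>x. N (x - a) powr b * prod_list (map (B (x - a)) hs)) (\<lambda>h. F1 h x) x)"
  proof (induction hs)
    case Nil
    show ?case
    proof (intro exI[of _ "\<lambda>h x. b * (N (x - a) powr (b - 2) * prod_list (map (B (x - a)) [h]))"] conjI ballI impI)
      fix h assume "h \<in> E"
      then show "pw a (b + real (length []) - 1) (\<not> even (length [])) (\<lambda>x. b * (N (x - a) powr (b - 2) * prod_list (map (B (x - a)) [h])))"
        by (intro pw.base) auto
    next
      fix x assume "x \<in> E" "x \<noteq> a"
      then show "der (\<lambda>x. N (x - a) powr b * prod_list (map (B (x - a)) []))
         (\<lambda>h. b * (N (x - a) powr (b - 2) * prod_list (map (B (x - a)) [h]))) x"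
        using der_N_powr[of x a b] a by (simp add: mult.assoc)
    qed
  next
    case (Cons k hs)
    then obtain F1 where F1: "\<forall>h\<in>E. pw a (b + real (length hs) - 1) (\<not> even (length hs)) (F1 h)"
      "\<forall>x\<in>E. x \<noteq> a \<longrightarrow> der (\<lambda>x. N (x - a) powr b * prod_list (map (B (x - a)) hs)) (\<lambda>h. F1 h x) x"
      by auto
    have k: "k \<in> E" using Cons.prems by simp
    let ?F = "\<lambda>x. N (x - a) powr b * prod_list (map (B (x - a)) hs)"
    show ?case
    proof (intro exI[of _ "\<lambda>h x. B h k * ?F x + F1 h x * B (x - a) k"] conjI ballI impI)
      fix h assume h: "h \<in> E"
      have "pw a (b + real (length hs)) (even (length hs)) (\<lambda>x. 1 * ?F x)"
        using Cons.prems by (intro pw.base) auto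
      then have "pw a (b + real (length hs)) (even (length hs)) (\<lambda>x. B h k * ?F x)"
        using pw_cmult[of a _ _ "\<lambda>x. 1 * ?F x" "B h k"] by simp
      moreover have "pw a (b + real (length hs)) (even (length hs)) (\<lambda>x. F1 h x * B (x - a) k)"
        using pw_mult[OF k F1(1)[rule_format, OF h]] by simp
      ultimately have "pw a (b + real (length hs)) (even (length hs)) (\<lambda>x. B h k * ?F x + F1 h x * B (x - a) k)"
        by (rule pw.add)
      then show "pw a (b + real (length (k # hs)) - 1) (\<not> even (length (k # hs))) (\<lambda>x. B h k * ?F x + F1 h x * B (x - a) k)"
        by simp
    next
      fix x assume x: "x \<in> E" "x \<noteq> a"
      have "der (\<lambda>x. ?F x * B (x - a) k) (\<lambda>h. ?F x * B h k + F1 h x * B (x - a) k) x"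
        using F1 x a by (intro der_mult der_B) auto
      then show "der (\<lambda>x. N (x - a) powr b * prod_list (map (B (x - a)) (k # hs))) (\<lambda>h. B h k * ?F x + F1 h x * B (x - a) k) x"
        by (rule der_cong) (use x in \<open>auto simp: mult_ac\<close>)
    qed
  qed
  then obtain F1 where F1: "\<forall>h\<in>E. pw a (b + real (length hs) - 1) (\<not> even (length hs)) (F1 h)"
     "\<forall>x\<in>E. x \<noteq> a \<longrightarrow> der (\<lambda>x. N (x - a) powr b * prod_list (map (B (x - a)) hs)) (\<lambda>h. F1 h x) x" by blast
  show ?case
  proof (intro exI[of _ "\<lambda>h x. c * F1 h x"] conjI ballI impI)
    fix h assume "h \<in> E"
    then show "pw a (\<beta> - 1) (\<not> e) (\<lambda>x. c * F1 h x)" using F1(1) base(2,3) by (intro pw_cmult) auto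
  next
    fix x assume "x \<in> E" "x \<noteq> a"
    then show "der (\<lambda>x. c * (N (x - a) powr b * prod_list (map (B (x - a)) hs))) (\<lambda>h. c * F1 h x) x"
      using F1(2) by (intro der_cmult) auto
  qed
qed

text \<open>A degree above 1 means decay faster than linear at the centre, so the derivative there
  is 0, and 0 is also the value every function of the family takes there.\<close>

lemma pw_derivative':
  assumes a: "a \<in> E" and F: "pw a \<beta> e F" and \<beta>: "1 < \<beta>"
  shows "\<exists>F1. (\<forall>h\<in>E. pw a (\<beta> - 1) (\<not> e) (F1 h)) \<and> (\<forall>x\<in>E. der F (\<lambda>h. F1 h x) x)"
proof -
  obtain F1 where F1: "\<forall>h\<in>E. pw a (\<beta> - 1) (\<not> e) (F1 h)" "\<forall>x\<in>E. x \<noteq> a \<longrightarrow> der F (\<lambda>h. F1 h x) x"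
    using pw_derivative[OF a F] by blast
  obtain K where K: "\<forall>x\<in>E. \<bar>F x\<bar> \<le> K * N (x - a) powr \<beta>" using pw_bound[OF a F] by blast
  have "der F (\<lambda>_. 0) a"
    by (rule der_zero_of_bound[OF a \<beta>, of F K]) (use K pw_at_center[OF F] in auto)
  then have "der F (\<lambda>h. F1 h a) a"
    by (rule der_cong) (use a F1(1) pw_at_center in auto)
  with F1 show ?thesis by metis
qed

abbreviation npow :: "'a \<Rightarrow> real \<Rightarrow> 'a \<Rightarrow> real" where
  "npow a s \<equiv> (\<lambda>x. N (x - a) powr s)"

text \<open>The degree is still above 1 before each differentiation as long as the order stays below
  s, so all these derivatives exist at the centre as well.\<close>

lemma dderiv_npow:
  assumes a: "a \<in> E" and "set hs \<subseteq> E" "real (length hs) < s"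
  shows "\<exists>F. pw a (s - real (length hs)) (even (length hs)) F \<and> (\<forall>x\<in>E. dderiv E (npow a s) hs x = F x)"
  using assms(2,3)
proof (induction hs)
  case Nil
  have "pw a s True (\<lambda>x. 1 * (N (x - a) powr s * prod_list (map (B (x - a)) [])))"
    by (rule pw.base) auto
  then show ?case by (intro exI[of _ "npow a s"]) simp
next
  case (Cons h hs)
  then obtain F where F: "pw a (s - real (length hs)) (even (length hs)) F" "\<And>x. x \<in> E \<Longrightarrow> dderiv E (npow a s) hs x = F x"
    by auto
  have "1 < s - real (length hs)" using Cons.prems by simp
  from pw_derivative'[OF a F(1) this] obtain F1
    where F1: "\<forall>h\<in>E. pw a (s - real (length hs) - 1) (\<not> even (length hs)) (F1 h)" "\<forall>x\<in>E. der F (\<lambda>h. F1 h x) x"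
    by blast
  have d: "der (dderiv E (npow a s) hs) (\<lambda>h. F1 h x) x" if "x \<in> E" for x
    by (rule der_cong[of F "\<lambda>h. F1 h x"]) (use that F1 F in auto)
  have "dderiv E (npow a s) (h # hs) x = F1 h x" if "x \<in> E" for x
    by (rule dderiv_Cons_eq[OF d]) (use that Cons.prems in auto)
  moreover have "pw a (s - real (length (h # hs))) (even (length (h # hs))) (F1 h)"
    using F1(1) Cons.prems by (simp add: algebra_simps)
  ultimately show ?case by blast
qed

lemma differentiable_dderiv_npow:
  assumes a: "a \<in> E" and hs: "set hs \<subseteq> E" and x: "x \<in> E"
    and "1 < s - real (length hs) \<or> x \<noteq> a \<and> real (length hs) < s"
  shows "dderiv E (npow a s) hs differentiable (at x within E)"
proof -
  have "real (length hs) < s" using assms(4) by auto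
  from dderiv_npow[OF a hs this] obtain F where F: "pw a (s - real (length hs)) (even (length hs)) F"
    "\<forall>x\<in>E. dderiv E (npow a s) hs x = F x" by blast
  have "\<exists>F1. der F F1 x"
    using assms(4) pw_derivative[OF a F(1)] pw_derivative'[OF a F(1)] x by blast
  then obtain F1 where "der F F1 x" by blast
  then have "der (dderiv E (npow a s) hs) F1 x"
    by (rule der_cong) (use F x in auto)
  then show ?thesis by (rule der_differentiable)
qed

lemma times_differentiable_npow:
  assumes "a \<in> E" "real n < s" shows "times_differentiable E n (npow a s)"
  unfolding times_differentiable_def
  using assms by (intro allI impI differentiable_dderiv_npow) auto

text \<open>Off the centre the order may equal s, which is the case n = p with \<nu> = 0.\<close>

lemma smooth_at_npow:
  assumes "a \<in> E" "x \<in> E" "x \<noteq> a" "real n \<le> s" "1 \<le> n" shows "smooth_at n (npow a s) x"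
  unfolding smooth_at_def
  using assms by (intro conjI times_differentiable_npow allI impI differentiable_dderiv_npow) auto

text \<open>A derivative of even order is an even function about the centre, so a further derivative
  there is 0 if it exists and 0 by the default of \<open>dderiv\<close> if it does not. For odd p
  and \<nu> = 0 this makes the top Taylor term at the centre vanish.\<close>

lemma dderiv_npow_center:
  assumes a: "a \<in> E" and hs: "set hs \<subseteq> E" "h \<in> E" "real (length hs) < s" "even (length hs)"
  shows "dderiv E (npow a s) (h # hs) a = 0"
proof (cases "dderiv E (npow a s) hs differentiable (at a within E)")
  case True
  obtain F where F: "pw a (s - real (length hs)) (even (length hs)) F"
    "\<forall>x\<in>E. dderiv E (npow a s) hs x = F x" using dderiv_npow[OF a hs(1,3)] by blast
  let ?G = "dderiv E (npow a s) hs" and ?D = "dderiv E (npow a s) (h # hs) a"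
  have even: "?G (a + t *\<^sub>R h) = ?G (a + (- t) *\<^sub>R h)" for t
  proof -
    have "F (a - t *\<^sub>R h) = F (a + t *\<^sub>R h)" using pw_reflect[OF F(1), of "t *\<^sub>R h"] hs(4) by simp
    moreover have "a + t *\<^sub>R h \<in> E" "a - t *\<^sub>R h \<in> E" using a hs by auto
    ultimately show ?thesis using F(2) by simp
  qed
  have d: "((\<lambda>t. ?G (a + t *\<^sub>R h)) has_real_derivative ?D) (at 0)"
    using der_line0[OF der_dderiv[OF True] a hs(2)] .
  moreover have "((\<lambda>t. ?G (a + (- t) *\<^sub>R h)) has_real_derivative ?D * - 1) (at 0)"
    by (rule DERIV_chain2[of "\<lambda>t. ?G (a + t *\<^sub>R h)" ?D uminus 0 "- 1"]) (use d in \<open>auto intro!: derivative_eq_intros\<close>)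
  then have "((\<lambda>t. ?G (a + t *\<^sub>R h)) has_real_derivative ?D * - 1) (at 0)"
    unfolding even[symmetric] .
  ultimately have "?D = ?D * - 1" by (rule DERIV_unique)
  then show ?thesis by simp
qed simp

text \<open>Handles the remaining case at the centre: for \<nu> = 0 and even p the power N^p is a
  polynomial and differentiable to every order. Closure under sums, products and derivatives is all
  that is required of the class.\<close>

inductive spoly :: "'a \<Rightarrow> ('a \<Rightarrow> real) \<Rightarrow> bool" for a where
  const: "spoly a (\<lambda>_. c)"
| lin: "h \<in> E \<Longrightarrow> spoly a (\<lambda>x. B (x - a) h)"
| sq: "spoly a (\<lambda>x. B (x - a) (x - a))"
| add: "spoly a F \<Longrightarrow> spoly a G \<Longrightarrow> spoly a (\<lambda>x. F x + G x)"
| mult: "spoly a F \<Longrightarrow> spoly a G \<Longrightarrow> spoly a (\<lambda>x. F x * G x)"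

lemma spoly_derivative:
  assumes a: "a \<in> E" and "spoly a F"
  shows "\<exists>F1. (\<forall>h\<in>E. spoly a (F1 h)) \<and> (\<forall>x\<in>E. der F (\<lambda>h. F1 h x) x)"
  using assms(2)
proof (induction rule: spoly.induct)
  case (const c)
  show ?case by (intro exI[of _ "\<lambda>_ _. 0"]) (auto intro: spoly.const der_const)
next
  case (lin h)
  then show ?case using a by (intro exI[of _ "\<lambda>v _. B v h"]) (auto intro: spoly.const der_B)
next
  case sq
  show ?case using a by (intro exI[of _ "\<lambda>v x. 2 * B (x - a) v"]) (auto intro: spoly.const spoly.lin spoly.mult der_Bsq)
next
  case (add F G)
  then obtain F1 G1 where "\<forall>h\<in>E. spoly a (F1 h)" "\<forall>x\<in>E. der F (\<lambda>h. F1 h x) x"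
    "\<forall>h\<in>E. spoly a (G1 h)" "\<forall>x\<in>E. der G (\<lambda>h. G1 h x) x" by blast
  then show ?case by (intro exI[of _ "\<lambda>h x. F1 h x + G1 h x"]) (simp add: spoly.add der_add)
next
  case (mult F G)
  then obtain F1 G1 where "\<forall>h\<in>E. spoly a (F1 h)" "\<forall>x\<in>E. der F (\<lambda>h. F1 h x) x"
    "\<forall>h\<in>E. spoly a (G1 h)" "\<forall>x\<in>E. der G (\<lambda>h. G1 h x) x" by blast
  then show ?case using mult.hyps
    by (intro exI[of _ "\<lambda>h x. F x * G1 h x + F1 h x * G x"] conjI ballI der_mult spoly.add spoly.mult) auto
qed

lemma dderiv_spoly:
  assumes a: "a \<in> E" and F: "spoly a F" and "set hs \<subseteq> E"
  shows "\<exists>G. spoly a G \<and> (\<forall>x\<in>E. dderiv E F hs x = G x)"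
  using assms(3)
proof (induction hs)
  case (Cons h hs)
  then obtain G where G: "spoly a G" "\<forall>x\<in>E. dderiv E F hs x = G x" by auto
  obtain G1 where G1: "\<forall>h\<in>E. spoly a (G1 h)" "\<forall>x\<in>E. der G (\<lambda>h. G1 h x) x"
    using spoly_derivative[OF a G(1)] by blast
  have d: "der (dderiv E F hs) (\<lambda>h. G1 h x) x" if "x \<in> E" for x
    by (rule der_cong[of G "\<lambda>h. G1 h x"]) (use that G1 G in auto)
  have "dderiv E F (h # hs) x = G1 h x" if "x \<in> E" for x
    by (rule dderiv_Cons_eq[OF d]) (use that Cons.prems in auto)
  moreover have "spoly a (G1 h)" using G1(1) Cons.prems by simp
  ultimately show ?case by blast
qed (use F in auto)

lemma times_differentiable_spoly:
  assumes a: "a \<in> E" and F: "spoly a F"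
  shows "times_differentiable E n F"
  unfolding times_differentiable_def
proof (intro allI impI, elim conjE)
  fix hs x assume hs: "set hs \<subseteq> E" "x \<in> E"
  obtain G where G: "spoly a G" "\<forall>x\<in>E. dderiv E F hs x = G x" using dderiv_spoly[OF a F hs(1)] by blast
  obtain G1 where "\<forall>x\<in>E. der G (\<lambda>h. G1 h x) x" using spoly_derivative[OF a G(1)] by blast
  then have "der G (\<lambda>h. G1 h x) x" using hs by blast
  then have "der (dderiv E F hs) (\<lambda>h. G1 h x) x" by (rule der_cong) (use G hs in auto)
  then show "dderiv E F hs differentiable (at x within E)" by (rule der_differentiable)
qed

lemma times_differentiable_cong:
  assumes "\<And>x. x \<in> E \<Longrightarrow> F x = G x" "times_differentiable E n F"
  shows "times_differentiable E n G"
  unfolding times_differentiable_def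
proof (intro allI impI, elim conjE)
  fix hs x assume *: "set hs \<subseteq> E" "length hs < n" "x \<in> E"
  then have "dderiv E F hs differentiable (at x within E)" using assms(2) by (simp add: times_differentiable_def)
  moreover have "(dderiv E F hs has_derivative D) (at x within E) \<longleftrightarrow> (dderiv E G hs has_derivative D) (at x within E)" for D
    by (rule has_derivative_cong_E) (use * dderiv_cong[of F G] assms in auto)
  ultimately show "dderiv E G hs differentiable (at x within E)" by (simp add: differentiable_def)
qed

lemma times_differentiable_npow_even:
  assumes a: "a \<in> E" and "even q" "0 < q"
  shows "times_differentiable E n (npow a (real q))"
proof -
  obtain k where k: "q = 2 * k" using assms(2) by (auto elim: evenE)
  show ?thesis
  proof (rule times_differentiable_cong)
  have "spoly a (\<lambda>x. (B (x - a) (x - a)) ^ k)" for k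
    by (induction k) (auto intro: spoly.const spoly.mult spoly.sq)
  then show "times_differentiable E n (\<lambda>x. (B (x - a) (x - a)) ^ k)" by (rule times_differentiable_spoly[OF a])
  fix x assume x: "x \<in> E"
  have "(B (x - a) (x - a)) ^ k = N (x - a) ^ q"
    using N_sq[of "x - a"] a x by (simp add: k power_mult)
  also have "\<dots> = N (x - a) powr real q"
    using a x assms(3) by (intro powr_realpow'[symmetric]) auto
  finally show "(B (x - a) (x - a)) ^ k = N (x - a) powr real q" .
  qed
qed

end

section \<open>Taylor remainder and uniform convexity of powers of the norm\<close>

lemma powr_superadditive:
  fixes x y m :: real
  assumes "0 \<le> x" "0 \<le> y" "1 \<le> m" shows "x powr m + y powr m \<le> (x + y) powr m"
proof (cases "x + y = 0")
  case False
  then have pos: "0 < x + y" using assms by simp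
  have le: "(z / (x + y)) powr m \<le> z / (x + y)" if "0 \<le> z" "z \<le> x + y" for z
    using that pos assms powr_mono'[of 1 m "z / (x + y)"] by auto
  have "(x powr m + y powr m) / (x + y) powr m = (x / (x + y)) powr m + (y / (x + y)) powr m"
    using assms by (simp add: powr_divide add_divide_distrib)
  also have "\<dots> \<le> x / (x + y) + y / (x + y)"
    using le[of x] le[of y] assms by simp
  also have "\<dots> = 1" using pos by (simp flip: add_divide_distrib)
  finally show ?thesis using pos by (simp add: field_simps)
next
  case True
  then have "x = 0" "y = 0" using assms by auto
  then show ?thesis by simp
qed

lemma powr_convex_combination:
  fixes x y m :: real
  assumes "0 \<le> x" "0 \<le> y" "1 \<le> m" "0 \<le> l" "l \<le> 1"
  shows "((1 - l) * x + l * y) powr m \<le> (1 - l) * x powr m + l * y powr m"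
proof (cases "x = 0 \<or> y = 0")
  case True
  have *: "(t * u) powr m \<le> t * u powr m" if "0 \<le> t" "t \<le> 1" "0 \<le> u" for t u :: real
  proof -
    have "t powr m \<le> t" using that powr_mono'[of 1 m t] assms(3) by simp
    then show ?thesis using that by (simp add: powr_mult mult_right_mono)
  qed
  show ?thesis using True *[of l y] *[of "1 - l" x] assms by auto
next
  case False
  then show ?thesis
    using convex_onD[OF powr_convex[OF assms(3)], of l x y] assms by simp
qed

text \<open>Here a and b play the lengths of two vectors and D the length of their difference. The
  right-hand side is affine in D^2 and the left-hand side is convex in D^2, so it is enough to check
  the extreme values D = |a - b| and D = a + b. At the second, a = b gives equality, so the constant
  is sharp.\<close>

lemma power_gap:
  fixes a b D q :: real
  assumes "0 \<le> a" "0 \<le> b" "0 \<le> D" "\<bar>a - b\<bar> \<le> D" "D \<le> a + b" "0 \<le> q"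
  shows "2 powr (1 - q) * D powr (q + 2) \<le> (a powr q + b powr q) * D\<^sup>2 + (a powr q - b powr q) * (a\<^sup>2 - b\<^sup>2)"
proof -
  have pw: "x powr (q + 1) = x powr q * x" if "0 \<le> x" for x
    using that by (simp add: powr_add)
  have pw2: "x powr (q + 2) = x powr (q + 1) * x" if "0 \<le> x" for x
    using that powr_add[of x "q + 1" 1] by (simp add: add.commute)
  let ?R = "\<lambda>e. (a powr q + b powr q) * e + (a powr q - b powr q) * (a\<^sup>2 - b\<^sup>2)"
  let ?m = "1 + q / 2"
  have sq: "(x\<^sup>2) powr ?m = x powr (q + 2)" if "0 \<le> x" for x
    using that powr_powr[of x 2 ?m] by (simp add: powr_numeral add.commute)
  \<comment> \<open>Parallel vectors: superadditivity of t^(q+1), together with 2^(1-q) <=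
    2.\<close>
  have e0: "2 powr (1 - q) * ((a - b)\<^sup>2) powr ?m \<le> ?R ((a - b)\<^sup>2)"
  proof -
    have two: "2 powr (1 - q) \<le> (2::real)"
      using assms(6) powr_mono[of "1 - q" 1 "2::real"] by simp
    have *: "2 powr (1 - q) * ((u - v)\<^sup>2) powr ?m \<le> 2 * (u - v) * (u powr (q + 1) - v powr (q + 1))"
      if "0 \<le> v" "v \<le> u" for u v
    proof -
      have "((u - v)\<^sup>2) powr ?m = (u - v) powr (q + 1) * (u - v)" using that by (simp add: sq pw2)
      also have "2 powr (1 - q) * \<dots> \<le> 2 * ((u powr (q + 1) - v powr (q + 1)) * (u - v))"
        using that two powr_superadditive[of v "u - v" "q + 1"] assms(6)
        by (intro mult_mono mult_right_mono) auto
      finally show ?thesis by (simp only: mult.assoc mult.commute mult.left_commute)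
    qed
    have "?R ((a - b)\<^sup>2) = 2 * (a - b) * (a powr (q + 1) - b powr (q + 1))"
      unfolding pw[OF assms(1)] pw[OF assms(2)] by (simp add: power2_eq_square algebra_simps)
    then show ?thesis
      using *[of b a] *[of a b] assms power2_commute[of a b] by (cases "b \<le> a") (auto simp: algebra_simps)
  qed
  \<comment> \<open>Opposite vectors: convexity of t^(q+1) at the midpoint.\<close>
  have e1: "2 powr (1 - q) * ((a + b)\<^sup>2) powr ?m \<le> ?R ((a + b)\<^sup>2)"
  proof -
    have "(a + b) powr (q + 1) = 2 powr (q + 1) * ((1 - 1/2) * a + 1/2 * b) powr (q + 1)"
      using assms by (simp flip: powr_mult add: algebra_simps)
    also have "\<dots> \<le> 2 powr (q + 1) * ((1 - 1/2) * a powr (q + 1) + 1/2 * b powr (q + 1))"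
      using assms by (intro mult_left_mono powr_convex_combination) auto
    also have "\<dots> = 2 powr q * (a powr (q + 1) + b powr (q + 1))"
      by (simp add: powr_add algebra_simps)
    finally have "2 powr (1 - q) * (a + b) powr (q + 1) \<le> 2 powr (1 - q) * (2 powr q * (a powr (q + 1) + b powr (q + 1)))"
      by (intro mult_left_mono) auto
    also have "\<dots> = 2 * (a powr (q + 1) + b powr (q + 1))"
      by (simp add: powr_diff)
    finally have "2 powr (1 - q) * (a + b) powr (q + 1) * (a + b) \<le> 2 * (a powr (q + 1) + b powr (q + 1)) * (a + b)"
      using assms by (intro mult_right_mono) auto
    moreover have "((a + b)\<^sup>2) powr ?m = (a + b) powr (q + 1) * (a + b)" using assms by (simp add: sq pw2)
    moreover have "?R ((a + b)\<^sup>2) = 2 * (a powr (q + 1) + b powr (q + 1)) * (a + b)"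
      unfolding pw[OF assms(1)] pw[OF assms(2)] by (simp add: power2_eq_square algebra_simps)
    ultimately show ?thesis by (simp add: mult.assoc)
  qed
  have "2 powr (1 - q) * (D\<^sup>2) powr ?m \<le> ?R (D\<^sup>2)"
  proof (cases "a * b = 0")
    case True
    then have "D\<^sup>2 = (a - b)\<^sup>2" using assms by auto
    then show ?thesis using e0 by simp
  next
    case False
    then have ab: "0 < a * b" using assms by simp
    \<comment> \<open>Position of D^2 between the extremes, whose distance is (a + b)^2 - (a - b)^2
      = 4 a b; if a b = 0 they coincide.\<close>
    define l where "l = (D\<^sup>2 - (a - b)\<^sup>2) / (4 * (a * b))"
    have "(a - b)\<^sup>2 \<le> D\<^sup>2" "D\<^sup>2 \<le> (a + b)\<^sup>2"
      using assms by (auto simp: abs_le_square_iff[symmetric])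
    then have l: "0 \<le> l" "l \<le> 1"
      using ab by (auto simp: l_def divide_simps power2_eq_square algebra_simps)
    have "l * (4 * (a * b)) = D\<^sup>2 - (a - b)\<^sup>2" using False by (simp add: l_def)
    then have D: "D\<^sup>2 = (1 - l) * (a - b)\<^sup>2 + l * (a + b)\<^sup>2"
      by (simp add: power2_eq_square algebra_simps)
    have "2 powr (1 - q) * (D\<^sup>2) powr ?m \<le> 2 powr (1 - q) * ((1 - l) * ((a - b)\<^sup>2) powr ?m + l * ((a + b)\<^sup>2) powr ?m)"
      unfolding D using l assms(6) by (intro mult_left_mono powr_convex_combination) auto
    also have "\<dots> = (1 - l) * (2 powr (1 - q) * ((a - b)\<^sup>2) powr ?m) + l * (2 powr (1 - q) * ((a + b)\<^sup>2) powr ?m)"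
      by (simp add: algebra_simps)
    also have "\<dots> \<le> (1 - l) * ?R ((a - b)\<^sup>2) + l * ?R ((a + b)\<^sup>2)"
      using l e0 e1 by (intro add_mono mult_left_mono) auto
    also have "\<dots> = ?R (D\<^sup>2)" unfolding D by (simp add: algebra_simps)
    finally show ?thesis .
  qed
  then show ?thesis using assms by (simp add: sq)
qed

lemma derivative_bound_of_lipschitz:
  fixes g :: "real \<Rightarrow> real"
  assumes "(g has_real_derivative D) (at 0)" "\<And>t. 0 \<le> t \<Longrightarrow> t \<le> 1 \<Longrightarrow> \<bar>g t - g 0\<bar> \<le> L * t"
  shows "\<bar>D\<bar> \<le> L"
proof -
  have "((\<lambda>h. (g h - g 0) / h) \<longlongrightarrow> D) (at_right 0)"
    using assms(1) unfolding DERIV_def by (auto intro: tendsto_mono[OF at_le])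
  then have "((\<lambda>h. \<bar>(g h - g 0) / h\<bar>) \<longlongrightarrow> \<bar>D\<bar>) (at_right 0)" by (rule tendsto_rabs)
  moreover have "\<forall>\<^sub>F h in at_right 0. \<bar>(g h - g 0) / h\<bar> \<le> L"
    unfolding eventually_at_right_field
  proof (intro exI[of _ 1] conjI allI impI)
    fix h :: real assume "0 < h" "h < 1"
    then show "\<bar>(g h - g 0) / h\<bar> \<le> L" using assms(2)[of h] by (simp add: abs_divide field_simps)
  qed simp
  ultimately show ?thesis by (rule tendsto_upperbound) simp
qed

context euclid
begin

section \<open>Taylor remainder of the norm power\<close>

text \<open>The line y + \<tau> d lies in the plane through the centre a spanned by d and y - a, and
  the gradient of the norm power sees only the part of h in that plane. Hence the planar estimate
  applies, and Bessel's inequality returns from the projection to h. The constant is free of the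
  dimension.\<close>

lemma npow_holder:
  assumes mem: "a \<in> E" "y \<in> E" "d \<in> E" "h \<in> E" and p: "1 \<le> p" and \<nu>: "0 < \<nu>" and s: "s = real p + \<nu>"
    and K: "\<And>u v. \<bar>spow \<nu> (even p) u - spow \<nu> (even p) v\<bar> \<le> K * \<bar>u - v\<bar> powr \<nu>" "0 \<le> K" and \<tau>: "0 \<le> \<tau>"
  shows "\<bar>dderiv E (npow a s) (replicate (p - 1) d @ [h]) (y + \<tau> *\<^sub>R d) - dderiv E (npow a s) (replicate (p - 1) d @ [h]) y\<bar>
    \<le> K * (\<Prod>i=1..p. \<nu> + real i) * N d powr (s - 1) * \<tau> powr \<nu> * N h"
proof (cases "d = 0")
  case True
  have "0 \<le> (\<Prod>i=1..p. \<nu> + real i)" using \<nu> by (intro prod_nonneg) auto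
  then show ?thesis using True K(2) mem by simp
next
  case False
  define r where "r = N d"
  have r: "0 < r" using N_pos False mem by (simp add: r_def)
  define u where "u = y - a"
  define e1 where "e1 = (1 / r) *\<^sub>R d"
  define \<alpha> where "\<alpha> = B u e1"
  define w where "w = u - \<alpha> *\<^sub>R e1"
  define b where "b = N w"
  \<comment> \<open>If y - a is parallel to d there is no second direction; e2 = 0 keeps all the
    identities valid. For that reason they are stated with an extra factor b or h2 in place of B e2
    e2 = 1.\<close>
  define e2 where "e2 = (if b = 0 then 0 else (1 / b) *\<^sub>R w)"
  define h1 where "h1 = B e1 h"
  define h2 where "h2 = B e2 h"
  have in_E: "u \<in> E" "e1 \<in> E" "w \<in> E" "e2 \<in> E"
    using mem by (auto simp: u_def e1_def w_def e2_def)
  have e11: "B e1 e1 = 1"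
    using r N_sq[OF mem(3)] B_pos[OF mem(3) False] by (simp add: e1_def B_simps r_def power2_eq_square)
  have we1: "B w e1 = 0" by (simp add: w_def B_simps e11 \<alpha>_def)
  have e12: "B e2 e1 = 0" "B e1 e2 = 0"
    using we1 B_sym[of e1 e2] in_E by (auto simp: e2_def B_simps)
  have w: "w = b *\<^sub>R e2"
    using N_eq_0[OF in_E(3)] by (auto simp: e2_def b_def)
  have bee: "b * (b * B e2 e2) = b\<^sup>2"
  proof -
    have "b\<^sup>2 = B w w" using N_sq[OF in_E(3)] by (simp add: b_def)
    also have "\<dots> = B (b *\<^sub>R e2) (b *\<^sub>R e2)" by (simp only: w[symmetric])
    finally show ?thesis by (simp add: B_simps)
  qed
  have hee: "h2 * (h2 * B e2 e2) = h2\<^sup>2"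
    using bee by (cases "b = 0") (auto simp: h2_def e2_def B_simps power2_eq_square)
  have line: "y + \<tau> *\<^sub>R d - a = (\<alpha> + \<tau> * r) *\<^sub>R e1 + b *\<^sub>R e2" for \<tau>
  proof -
    have "d = r *\<^sub>R e1" "u = \<alpha> *\<^sub>R e1 + w" using r by (simp_all add: e1_def w_def)
    then show ?thesis unfolding w[symmetric] by (simp add: u_def algebra_simps)
  qed
  have N_line: "N (y + \<tau> *\<^sub>R d - a) = sqrt ((\<alpha> + \<tau> * r)\<^sup>2 + b\<^sup>2)" for \<tau>
    unfolding line nrm_def using bee by (simp add: B_simps e11 e12 power2_eq_square)
  have B_line: "B (y + \<tau> *\<^sub>R d - a) h = (\<alpha> + \<tau> * r) * h1 + b * h2" for \<tau>
    unfolding line by (simp add: B_simps h1_def h2_def)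
  have bessel: "sqrt (h1\<^sup>2 + h2\<^sup>2) \<le> N h"
  proof -
    have "0 \<le> B (h - h1 *\<^sub>R e1 - h2 *\<^sub>R e2) (h - h1 *\<^sub>R e1 - h2 *\<^sub>R e2)"
      using mem in_E by (intro B_nonneg) auto
    also have "\<dots> = B h h - h1\<^sup>2 - h2\<^sup>2"
      using hee B_sym[of h e1] B_sym[of h e2] mem in_E
      by (simp add: B_simps e11 e12 power2_eq_square flip: h1_def h2_def)
    finally show ?thesis unfolding nrm_def by (intro real_sqrt_le_mono) simp
  qed
  define g where "g k \<tau> = dderiv E (npow a s) (replicate k d @ [h]) (y + \<tau> *\<^sub>R d)" for k \<tau>
  have td: "times_differentiable E p (npow a s)"
    using mem \<nu> s by (intro times_differentiable_npow) auto
  have s1: "1 < s" using p \<nu> s by simp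
  have "\<bar>g (p - 1) \<tau> - g (p - 1) 0\<bar> \<le> K * (\<Prod>i=1..p. \<nu> + real i) * r powr (s - 1) * \<tau> powr \<nu> * sqrt (h1\<^sup>2 + h2\<^sup>2)"
  proof (rule planar_power_holder[where x = \<alpha> and y = b, OF p \<nu> s _ _ _ K \<tau>])
    show "0 \<le> r" using r by simp
    fix \<tau>
    have "der (dderiv E (npow a s) []) (\<lambda>v. s * N (y + \<tau> *\<^sub>R d - a) powr (s - 2) * B (y + \<tau> *\<^sub>R d - a) v) (y + \<tau> *\<^sub>R d)"
      using der_N_powr'[of "y + \<tau> *\<^sub>R d" a s] mem s1 by simp
    from dderiv_Cons_eq[OF this, of h] show "g 0 \<tau> = s * (sqrt ((\<alpha> + \<tau> * r)\<^sup>2 + b\<^sup>2) powr (s - 2) * ((\<alpha> + \<tau> * r) * h1 + b * h2))"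
      using mem by (simp add: g_def N_line B_line del: dderiv.simps)
  next
    fix k \<tau> assume "k < p - 1"
    then have "der (dderiv E (npow a s) (replicate k d @ [h])) (\<lambda>v. dderiv E (npow a s) (v # replicate k d @ [h]) (y + \<tau> *\<^sub>R d)) (y + \<tau> *\<^sub>R d)"
      using mem by (intro der_dderiv times_differentiable_D[OF td]) auto
    from der_line[OF this mem(2,3)] show "(g k has_real_derivative g (Suc k) \<tau>) (at \<tau>)"
      by (simp add: g_def[abs_def] del: dderiv.simps)
  qed
  also have "\<dots> \<le> K * (\<Prod>i=1..p. \<nu> + real i) * r powr (s - 1) * \<tau> powr \<nu> * N h"
    using bessel K(2) \<nu> by (intro mult_left_mono mult_nonneg_nonneg prod_nonneg) auto
  finally show ?thesis by (simp add: g_def r_def)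
qed

text \<open>A single integration of the increment of the p-th derivative. The gained factor 1 / (1 +
  \<nu>) is given away, so the constant of the increment carries over unchanged.\<close>

lemma first_order_remainder:
  assumes td: "times_differentiable E p G" and p: "2 \<le> p" and \<nu>: "0 \<le> \<nu>"
    and mem: "y \<in> E" "d \<in> E" "h \<in> E"
    and bound: "\<And>\<tau>. 0 \<le> \<tau> \<Longrightarrow> \<tau> \<le> 1 \<Longrightarrow> \<bar>dderiv E G (replicate (p - 1) d @ [h]) (y + \<tau> *\<^sub>R d)
      - dderiv E G (replicate (p - 1) d @ [h]) y\<bar> \<le> M * \<tau> powr \<nu>"
    and M: "0 \<le> M" and \<tau>: "0 \<le> \<tau>" "\<tau> \<le> 1"
  shows "\<bar>dderiv E G (replicate (p - 2) d @ [h]) (y + \<tau> *\<^sub>R d) - dderiv E G (replicate (p - 2) d @ [h]) y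
    - \<tau> * dderiv E G (replicate (p - 1) d @ [h]) y\<bar> \<le> M * \<tau> powr (1 + \<nu>)"
proof -
  let ?g = "\<lambda>k \<tau>. dderiv E G (replicate k d @ [h]) (y + \<tau> *\<^sub>R d)"
  let ?f = "\<lambda>\<tau>. ?g (p - 2) \<tau> - ?g (p - 2) 0 - \<tau> * ?g (p - 1) 0"
  have Suc: "p - 1 = Suc (p - 2)" using p by simp
  have "(?g (p - 2) has_real_derivative ?g (p - 1) \<tau>) (at \<tau>)" for \<tau>
  proof -
    have "der (dderiv E G (replicate (p - 2) d @ [h])) (\<lambda>v. dderiv E G (v # replicate (p - 2) d @ [h]) (y + \<tau> *\<^sub>R d)) (y + \<tau> *\<^sub>R d)"
      using mem p by (intro der_dderiv times_differentiable_D[OF td]) auto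
    from der_line[OF this mem(1,2)] show ?thesis by (simp only: Suc replicate_Suc append_Cons)
  qed
  then have "(?f has_real_derivative ?g (p - 1) \<tau> - 0 - 1 * ?g (p - 1) 0) (at \<tau>)" for \<tau>
    by (intro DERIV_diff DERIV_cmult_right DERIV_ident DERIV_const)
  then have "\<bar>?f \<tau>\<bar> \<le> M * \<tau> powr (\<nu> + 1) / (\<nu> + 1)"
    using bound by (intro powr_integral_bound[OF \<nu> \<tau>, where f' = "\<lambda>\<tau>. ?g (p - 1) \<tau> - 0 - 1 * ?g (p - 1) 0"]) auto
  also have "\<dots> \<le> M * \<tau> powr (\<nu> + 1) / 1"
    using \<nu> M by (intro divide_left_mono mult_nonneg_nonneg) auto
  finally show ?thesis by (simp add: add.commute)
qed

lemma holder_remainder: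
  assumes td: "times_differentiable E p G" and H: "holder E B G p \<nu> = ennreal H" "0 \<le> H" and p: "2 \<le> p" and \<nu>: "0 \<le> \<nu>"
    and mem: "x \<in> E" "y \<in> E" "h \<in> E" and \<tau>: "0 \<le> \<tau>" "\<tau> \<le> 1"
  shows "\<bar>dderiv E G (replicate (p - 2) (x - y) @ [h]) (y + \<tau> *\<^sub>R (x - y)) - dderiv E G (replicate (p - 2) (x - y) @ [h]) y
    - \<tau> * dderiv E G (replicate (p - 1) (x - y) @ [h]) y\<bar>
    \<le> H * N (x - y) powr (real p + \<nu> - 1) * \<tau> powr (1 + \<nu>) * N h"
proof -
  let ?d = "x - y" and ?P = "\<lambda>k. dderiv E G (replicate (p - k) (x - y) @ [h])"
  have d: "?d \<in> E" using mem by auto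
  have "\<bar>?P 2 (y + \<tau> *\<^sub>R ?d) - ?P 2 y
    - \<tau> * ?P 1 y\<bar> \<le> (H * N ?d powr (real p + \<nu> - 1) * N h) * \<tau> powr (1 + \<nu>)"
  proof (rule first_order_remainder[OF td p \<nu> mem(2) d mem(3) _ _ \<tau>])
    fix \<tau> :: real assume \<tau>: "0 \<le> \<tau>" "\<tau> \<le> 1"
    show "\<bar>?P 1 (y + \<tau> *\<^sub>R ?d) - ?P 1 y\<bar>
      \<le> H * N ?d powr (real p + \<nu> - 1) * N h * \<tau> powr \<nu>"
    \<comment> \<open>The Hoelder quotient is defined for distinct points only.\<close>
    proof (cases "\<tau> *\<^sub>R ?d = 0")
      case True
      then show ?thesis using H(2) mem by (auto simp del: dderiv.simps)
    next
      case False
      then have nz: "\<tau> > 0" "?d \<noteq> 0" using \<tau> by auto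
      then have Nd: "0 < N ?d" using N_pos d by blast
      have "\<bar>?P 1 (y + \<tau> *\<^sub>R ?d) - ?P 1 y\<bar>
         \<le> H * N ((y + \<tau> *\<^sub>R ?d) - y) powr \<nu> * prod_list (map N (replicate (p - 1) ?d @ [h]))"
        using mem d False p by (intro holder_bound[OF td H]) auto
      also have "prod_list (map N (replicate (p - 1) ?d @ [h])) = N ?d powr real (p - 1) * N h"
        using Nd by (simp add: powr_realpow prod_list_replicate)
      also have "N ((y + \<tau> *\<^sub>R ?d) - y) powr \<nu> = \<tau> powr \<nu> * N ?d powr \<nu>"
        using nz Nd by (simp add: N_scale powr_mult)
      also have "H * (\<tau> powr \<nu> * N ?d powr \<nu>) * (N ?d powr real (p - 1) * N h)
         = H * (N ?d powr \<nu> * N ?d powr real (p - 1)) * N h * \<tau> powr \<nu>" by (simp add: mult_ac)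
      also have "N ?d powr \<nu> * N ?d powr real (p - 1) = N ?d powr (real p + \<nu> - 1)"
      proof -
        have "\<nu> + real (p - 1) = real p + \<nu> - 1" using p by (simp add: of_nat_diff)
        then show ?thesis by (simp only: powr_add[symmetric])
      qed
      finally show ?thesis .
    qed
  qed (use H mem in simp)
  then show ?thesis by (simp add: mult_ac)
qed

text \<open>Q is existential on purpose: normally it is the p-th derivative with one free slot, but
  for \<nu> = 0 and odd p that derivative need not exist at the centre, and there Q = 0
  serves.\<close>

lemma npow_remainder:
  assumes p: "2 \<le> p" and \<nu>: "0 \<le> \<nu>" "\<nu> \<le> 1" and s: "s = real p + \<nu>" and mem: "a \<in> E" "x \<in> E" "y \<in> E"
  shows "\<exists>Q. der (\<lambda>x. dderiv E (npow a s) (replicate p (x - y)) y) (\<lambda>h. real p * Q h) x \<and>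
    (\<forall>h\<in>E. \<forall>\<tau>. 0 \<le> \<tau> \<longrightarrow> \<tau> \<le> 1 \<longrightarrow>
      \<bar>dderiv E (npow a s) (replicate (p - 2) (x - y) @ [h]) (y + \<tau> *\<^sub>R (x - y))
        - dderiv E (npow a s) (replicate (p - 2) (x - y) @ [h]) y - \<tau> * Q h\<bar>
      \<le> C_const p \<nu> * N (x - y) powr (s - 1) * \<tau> powr (1 + \<nu>) * N h)"
proof (cases "\<nu> = 0")
  case False
  then have \<nu>0: "0 < \<nu>" using \<nu> by simp
  have td: "times_differentiable E p (npow a s)" using mem \<nu>0 s by (intro times_differentiable_npow) auto
  have d: "x - y \<in> E" using mem by auto
  let ?P = "\<lambda>k h. dderiv E (npow a s) (replicate (p - k) (x - y) @ [h])"
  show ?thesis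
  proof (intro exI[of _ "\<lambda>h. ?P 1 h y"] conjI ballI allI impI)
    show "der (\<lambda>x. dderiv E (npow a s) (replicate p (x - y)) y) (\<lambda>h. real p * ?P 1 h y) x"
      using mem by (intro der_dderiv_replicate[OF smooth_at_of_times[OF td]]) auto
    fix h \<tau> assume h: "h \<in> E" and \<tau>: "0 \<le> \<tau>" "\<tau> \<le> (1::real)"
    have "\<bar>?P 2 h (y + \<tau> *\<^sub>R (x - y))
        - ?P 2 h y - \<tau> * ?P 1 h y\<bar>
       \<le> (C_const p \<nu> * N (x - y) powr (s - 1) * N h) * \<tau> powr (1 + \<nu>)"
    proof (rule first_order_remainder[OF td p \<nu>(1) mem(3) d h _ _ \<tau>])
      fix \<tau> :: real assume "0 \<le> \<tau>"
      then show "\<bar>?P 1 h (y + \<tau> *\<^sub>R (x - y)) - ?P 1 h y\<bar>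
        \<le> C_const p \<nu> * N (x - y) powr (s - 1) * N h * \<tau> powr \<nu>"
        using npow_holder[OF mem(1,3) d h _ \<nu>0 s spow_holder[OF \<nu>0 \<nu>(2)], of \<tau>] p
        by (simp add: C_const_def mult_ac)
    next
      show "0 \<le> C_const p \<nu> * N (x - y) powr (s - 1) * N h"
        unfolding C_const_def using h \<nu> by (intro mult_nonneg_nonneg prod_nonneg) auto
    qed
    then show "\<bar>?P 2 h (y + \<tau> *\<^sub>R (x - y))
        - ?P 2 h y - \<tau> * ?P 1 h y\<bar>
       \<le> C_const p \<nu> * N (x - y) powr (s - 1) * \<tau> powr (1 + \<nu>) * N h" by (simp add: mult_ac)
  qed
next
  text \<open>For \<open>\<nu> = 0\<close> the same power is viewed with one derivative less and exponent \<open>1\<close>: the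
    derivative of order \<open>p - 1\<close> is Lipschitz, which bounds both the increment and the last term.\<close>
  case True
  have d: "x - y \<in> E" using mem by auto
  have p1: "real p = real (p - 1) + 1" "p - 1 - 1 = p - 2" using p by (simp_all add: of_nat_diff)
  have s0: "s = real p" "s = real (p - 1) + 1" using s True p1(1) by linarith+
  define P where "P = (\<Prod>i=1..p - 1. 1 + real i)"
  have P: "0 \<le> P" unfolding P_def by (intro prod_nonneg) auto
  \<comment> \<open>At \<nu> = 0 the product in \<open>C_const\<close> is p!, and P, with one factor
    less but each factor shifted by one, is p! again.\<close>
  have C: "C_const p \<nu> = 2 * P"
  proof -
    obtain n where n: "p = Suc n" using p by (cases p) auto
    have "(\<Prod>i=1..Suc n. real i) = (\<Prod>i=1..n. 1 + real i)"
      by (induction n) (simp_all add: add.commute)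
    then show ?thesis by (simp add: C_const_def True P_def n)
  qed
  let ?g = "\<lambda>h \<tau>. dderiv E (npow a s) (replicate (p - 2) (x - y) @ [h]) (y + \<tau> *\<^sub>R (x - y))"
  let ?L = "\<lambda>h. P * N (x - y) powr (s - 1) * N h"
  have lip: "\<bar>?g h \<tau> - ?g h 0\<bar> \<le> ?L h * \<tau>" if h: "h \<in> E" and \<tau>: "0 \<le> \<tau>" for h \<tau>
  proof -
    have one: "1 \<le> p - 1" using p by simp
    have K: "\<bar>spow 1 (even (p - 1)) u - spow 1 (even (p - 1)) v\<bar> \<le> 1 * \<bar>u - v\<bar> powr 1" for u v
      by (simp add: spow_lipschitz)
    have "\<bar>?g h \<tau> - ?g h 0\<bar> \<le> 1 * P * N (x - y) powr (s - 1) * \<tau> powr 1 * N h"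
      using npow_holder[OF mem(1,3) d h one zero_less_one s0(2) K zero_le_one \<tau>]
      unfolding P_def p1(2) by simp
    then show ?thesis using \<tau> by (simp add: mult_ac)
  qed
  show ?thesis
  proof (cases "y = a \<and> odd p")
    case center: True
    have zero: "dderiv E (npow a s) (replicate p v) y = 0" if "v \<in> E" for v
    proof -
      have "dderiv E (npow a s) (v # replicate (p - 1) v) a = 0"
        using that mem p center s0 by (intro dderiv_npow_center) auto
      moreover have "v # replicate (p - 1) v = replicate p v" using p by (cases p) auto
      ultimately show ?thesis using center by (simp only:)
    qed
    show ?thesis
    proof (intro exI[of _ "\<lambda>_. 0"] conjI ballI allI impI)
      show "der (\<lambda>x. dderiv E (npow a s) (replicate p (x - y)) y) (\<lambda>h. real p * 0) x"
        by (rule der_cong[OF der_const[of 0]]) (use mem zero in auto)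
      fix h \<tau> assume h: "h \<in> E" and \<tau>: "0 \<le> \<tau>" "\<tau> \<le> (1::real)"
      have "?L h * \<tau> \<le> 2 * ?L h * \<tau>" using P h \<tau> by (intro mult_right_mono) auto
      then show "\<bar>?g h \<tau> - dderiv E (npow a s) (replicate (p - 2) (x - y) @ [h]) y - \<tau> * 0\<bar>
        \<le> C_const p \<nu> * N (x - y) powr (s - 1) * \<tau> powr (1 + \<nu>) * N h"
        using lip[OF h \<tau>(1)] \<tau> by (simp add: C[unfolded True] True mult_ac del: dderiv.simps)
    qed
  next
    case False
    have sm: "smooth_at p (npow a s) y"
    proof (cases "y = a")
      case True
      with False have "even p" by simp
      then show ?thesis unfolding s0(1)
        using mem p by (intro smooth_at_of_times times_differentiable_npow_even) auto
    qed (use mem p s0 in \<open>auto intro: smooth_at_npow\<close>)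
    let ?Q = "\<lambda>h. dderiv E (npow a s) (replicate (p - 1) (x - y) @ [h]) y"
    have Q: "\<bar>?Q h\<bar> \<le> ?L h" if h: "h \<in> E" for h
    proof (rule derivative_bound_of_lipschitz[of "?g h"])
      have "der (dderiv E (npow a s) (replicate (p - 2) (x - y) @ [h])) (\<lambda>v. dderiv E (npow a s) (v # replicate (p - 2) (x - y) @ [h]) y) y"
        using h d p by (intro der_dderiv smooth_at_D[OF sm]) auto
      from der_line0[OF this mem(3) d] show "(?g h has_real_derivative ?Q h) (at 0)"
        using p by (simp only: replicate_Suc[symmetric] append_Cons[symmetric] Suc_diff_Suc numeral_2_eq_2 Suc_le_eq One_nat_def)
    qed (use lip[OF h] in simp)
    show ?thesis
    proof (intro exI[of _ ?Q] conjI ballI allI impI)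
      show "der (\<lambda>x. dderiv E (npow a s) (replicate p (x - y)) y) (\<lambda>h. real p * ?Q h) x"
        using mem by (intro der_dderiv_replicate[OF sm]) auto
      fix h \<tau> assume h: "h \<in> E" and \<tau>: "0 \<le> \<tau>" "\<tau> \<le> (1::real)"
      have "\<bar>\<tau> * ?Q h\<bar> \<le> ?L h * \<tau>" using Q[OF h] \<tau> by (simp add: abs_mult mult.commute mult_left_mono del: dderiv.simps)
      then have "\<bar>?g h \<tau> - ?g h 0 - \<tau> * ?Q h\<bar> \<le> 2 * (?L h * \<tau>)"
        using lip[OF h \<tau>(1)] by linarith
      then show "\<bar>?g h \<tau> - dderiv E (npow a s) (replicate (p - 2) (x - y) @ [h]) y - \<tau> * ?Q h\<bar>
        \<le> C_const p \<nu> * N (x - y) powr (s - 1) * \<tau> powr (1 + \<nu>) * N h"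
        using \<tau> by (simp add: C[unfolded True] True mult_ac del: dderiv.simps)
    qed
  qed
qed

section \<open>Uniform convexity of the norm power\<close>

text \<open>By polarization the right-hand side depends only on the lengths of x, y and x - y; twice
  it is the right-hand side of \<open>power_gap\<close>.\<close>

lemma npow_monotone:
  assumes mem: "x \<in> E" "y \<in> E" and q: "0 \<le> q"
  shows "2 powr (- q) * N (x - y) powr (q + 2) \<le> N x powr q * B x (x - y) - N y powr q * B y (x - y)"
proof -
  have "2 powr (1 - q) * N (x - y) powr (q + 2)
    \<le> (N x powr q + N y powr q) * (N (x - y))\<^sup>2 + (N x powr q - N y powr q) * ((N x)\<^sup>2 - (N y)\<^sup>2)"
    using mem q N_triangle_diff[OF mem] N_triangle[of x "- y"] by (intro power_gap) auto
  also have "\<dots> = 2 * (N x powr q * B x (x - y) - N y powr q * B y (x - y))"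
    using mem B_sym[of y x] by (simp add: N_sq) (simp add: B_simps algebra_simps)
  also have "2 powr (1 - q) = 2 * 2 powr (- q)" by (simp add: powr_diff powr_minus field_simps)
  finally show ?thesis by simp
qed

text \<open>Integrates the monotonicity bound along the segment. It is of the form s c \<tau>^(s-1),
  the exact derivative of c \<tau>^s, so the constant passes through without loss.\<close>

lemma npow_uniform_convex:
  assumes mem: "x \<in> E" "z \<in> E" and s: "2 \<le> s"
  shows "N x powr s + s * N x powr (s - 2) * B x (z - x) + 2 powr (2 - s) * N (z - x) powr s \<le> N z powr s"
proof -
  define d where "d = z - x"
  have d: "d \<in> E" using mem by (auto simp: d_def)
  define k' where "k' \<tau> = s * N (x + \<tau> *\<^sub>R d) powr (s - 2) * B (x + \<tau> *\<^sub>R d) d" for \<tau>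
  define c where "c = 2 powr (2 - s) * N d powr s"
  have k: "((\<lambda>\<tau>. N (x + \<tau> *\<^sub>R d) powr s) has_real_derivative k' \<tau>) (at \<tau>)" for \<tau>
  proof -
    have "der (\<lambda>x. N (x - 0) powr s) (\<lambda>v. s * N (x + \<tau> *\<^sub>R d - 0) powr (s - 2) * B (x + \<tau> *\<^sub>R d - 0) v) (x + \<tau> *\<^sub>R d)"
      using mem d s by (intro der_N_powr') auto
    from der_line[OF this mem(1) d] show ?thesis by (simp add: k'_def)
  qed
  let ?h = "\<lambda>\<tau>. N (x + \<tau> *\<^sub>R d) powr s - \<tau> * k' 0 - c * \<tau> powr s"
  have "?h 0 \<le> ?h 1"
  proof (rule DERIV_nonneg_imp_increasing_open[of 0 1 ?h])
    fix \<tau> :: real assume \<tau>: "0 < \<tau>" "\<tau> < 1"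
    have "(?h has_real_derivative k' \<tau> - 1 * k' 0 - c * (s * \<tau> powr (s - 1))) (at \<tau>)"
      using \<tau> by (intro DERIV_diff k DERIV_cmult DERIV_cmult_right DERIV_ident has_real_derivative_powr)
    \<comment> \<open>Both sides carry a factor \<tau> because monotonicity is tested with \<tau> d
      rather than with d.\<close>
    moreover have "\<tau> * (c * (s * \<tau> powr (s - 1))) \<le> \<tau> * (k' \<tau> - 1 * k' 0)"
    proof -
      have "2 powr (- (s - 2)) * N ((x + \<tau> *\<^sub>R d) - x) powr (s - 2 + 2)
        \<le> N (x + \<tau> *\<^sub>R d) powr (s - 2) * B (x + \<tau> *\<^sub>R d) ((x + \<tau> *\<^sub>R d) - x) - N x powr (s - 2) * B x ((x + \<tau> *\<^sub>R d) - x)"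
        using mem d s by (intro npow_monotone) auto
      then have "s * (2 powr (2 - s) * (\<tau> powr s * N d powr s)) \<le> s * (\<tau> * (N (x + \<tau> *\<^sub>R d) powr (s - 2) * B (x + \<tau> *\<^sub>R d) d - N x powr (s - 2) * B x d))"
        using \<tau> s d by (intro mult_left_mono) (auto simp: N_scale powr_mult B_simps algebra_simps)
      moreover have "\<tau> * \<tau> powr (s - 1) = \<tau> powr s" using \<tau> by (simp add: powr_diff)
      then have "\<tau> * (c * (s * \<tau> powr (s - 1))) = s * (2 powr (2 - s) * (\<tau> powr s * N d powr s))"
        by (simp add: c_def mult_ac flip: \<open>\<tau> * \<tau> powr (s - 1) = \<tau> powr s\<close>)
      moreover have "\<tau> * (k' \<tau> - 1 * k' 0) = s * (\<tau> * (N (x + \<tau> *\<^sub>R d) powr (s - 2) * B (x + \<tau> *\<^sub>R d) d - N x powr (s - 2) * B x d))"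
        by (simp add: k'_def algebra_simps)
      ultimately show ?thesis by (simp only:)
    qed
    then have "0 \<le> k' \<tau> - 1 * k' 0 - c * (s * \<tau> powr (s - 1))" using \<tau> by simp
    ultimately show "\<exists>y. (?h has_real_derivative y) (at \<tau>) \<and> 0 \<le> y" by blast
  next
    have c1: "continuous_on {0..1} (\<lambda>\<tau>. N (x + \<tau> *\<^sub>R d) powr s)"
      by (intro continuous_at_imp_continuous_on ballI DERIV_isCont[OF k])
    have c2: "continuous_on {0..1} (\<lambda>\<tau>. \<tau> * k' 0)"
      by (intro continuous_intros)
    have c3: "continuous_on {0..1} (\<lambda>\<tau>. c * \<tau> powr s)"
      using s by (intro continuous_on_mult continuous_on_const continuous_on_powr' continuous_on_id) auto
    show "continuous_on {0..1} ?h"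
      by (rule continuous_on_diff[OF continuous_on_diff[OF c1 c2] c3])
  qed simp
  then show ?thesis using s by (simp add: k'_def c_def d_def)
qed

end

section \<open>The accelerated tensor method\<close>

text \<open>Young's inequality with weights (s - 1) / s and 1 / s, raised to the power s so that
  only explicit constants remain to be compared.\<close>

lemma young_split:
  fixes X Y Z s :: real
  assumes "0 < X" "0 < Y" "0 \<le> Z" "1 < s" and le: "Z powr s \<le> (X * s / (s - 1)) powr (s - 1) * (Y * s)"
  shows "Z \<le> X + Y"
proof -
  have "Z = (Z powr s) powr (1 / s)" using assms by (simp add: powr_powr)
  also have "\<dots> \<le> ((X * s / (s - 1)) powr (s - 1) * (Y * s)) powr (1 / s)"
    using assms by (intro powr_mono2) auto
  also have "\<dots> = (X * s / (s - 1)) powr ((s - 1) / s) * (Y * s) powr (1 / s)"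
    using assms by (simp add: powr_mult powr_powr)
  also have "\<dots> \<le> (s - 1) / s * (X * s / (s - 1)) + 1 / s * (Y * s)"
    using assms by (intro Youngs_inequality_0) (auto simp: field_simps)
  also have "\<dots> = X + Y" using assms by simp
  finally show ?thesis .
qed

lemma power_tangent:
  fixes b u s :: real
  assumes "0 \<le> b" "0 \<le> u" "1 < s"
  shows "u powr s - b powr s \<le> s * u powr (s - 1) * (u - b)"
proof -
  have "1 / s + 1 / (s / (s - 1)) = 1" "1 < s / (s - 1)" using assms by (simp_all add: field_simps)
  from Youngs_inequality[OF assms(3) this(2,1) assms(1), of "u powr (s - 1)"]
  have "b * u powr (s - 1) \<le> b powr s / s + (u powr (s - 1)) powr (s / (s - 1)) / (s / (s - 1))" by simp
  moreover have "(s - 1) * (s / (s - 1)) = s" using assms by simp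
  ultimately have "b * u powr (s - 1) \<le> b powr s / s + u powr s * (s - 1) / s" by (simp add: powr_powr)
  then have "s * (b * u powr (s - 1)) \<le> s * (b powr s / s + u powr s * (s - 1) / s)"
    using assms by (intro mult_left_mono) auto
  also have "\<dots> = b powr s + u powr s * (s - 1)" using assms by (simp add: distrib_left)
  finally have "s * (b * u powr (s - 1)) \<le> b powr s + u powr s * (s - 1)" .
  moreover have "u powr s = u powr (s - 1) * u"
    using assms powr_add[of u "s - 1" 1] by simp
  ultimately show ?thesis by (simp add: algebra_simps)
qed

text \<open>Bernoulli's inequality for (1 + 1 / (s - 1))^(s - 1); the tangent inequality yields it
  for s > 2, and s = 2 is an equality.\<close>

lemma exp_bound_two: assumes "2 \<le> s" shows "2 \<le> (s / (s - 1)) powr (s - 1 :: real)"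
proof -
  have u: "1 \<le> s / (s - 1)" using assms by (simp add: field_simps)
  have "1 powr 1 + (1 / (s - 1)) * (s - 1) \<le> (s / (s - 1)) powr (s - 1)"
  proof (cases "s = 2")
    case False
    then have m: "1 < s - 1" using assms by simp
    have "1 powr (s - 1) - (s / (s - 1)) powr (s - 1) \<le> (s - 1) * 1 powr (s - 1 - 1) * (1 - s / (s - 1))"
      by (rule power_tangent) (use u m in auto)
    moreover have "(s - 1) * (1 - s / (s - 1)) = - 1" using assms by (simp add: field_simps)
    ultimately show ?thesis using m by simp
  qed simp
  then show ?thesis using assms by simp
qed

lemma three_quarters: assumes "2 \<le> p" "s \<le> real p + 1" "2 \<le> s" shows "(3 / 4) powr s * (s / real p) \<le> 1"
proof -
  have "(3 / 4 :: real) powr s \<le> (3 / 4) powr 2" using assms by (intro powr_mono') auto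
  then have "(3 / 4) powr s \<le> 9 / (16::real)" by (simp add: powr_numeral power2_eq_square)
  moreover have "s / real p \<le> 3 / 2" using assms by (simp add: field_simps)
  ultimately have "(3 / 4) powr s * (s / real p) \<le> 9 / 16 * (3 / 2)"
    using assms by (intro mult_mono) auto
  also have "\<dots> \<le> 1" by simp
  finally show ?thesis .
qed

text \<open>The decrease obtained from the model step pays for the linear term of the estimate
  sequence.\<close>
lemma acceleration_inequality:
  fixes a A \<kappa> r \<rho> s :: real
  assumes p: "2 \<le> p" and s: "2 \<le> s" "s \<le> real p + 1" and pos: "0 < a" "0 < A" "0 < \<kappa>" "0 \<le> r" "0 \<le> \<rho>"
    and a: "a powr s = 2 powr (1 - 3 * real p) * (s / real p) / \<kappa> * A powr (s - 1)"
  shows "a * (3 / 2 * \<kappa> * r powr (s - 1) * \<rho>) \<le> A * (\<kappa> / 2 * r powr s) + 2 powr (2 - s) / s * \<rho> powr s"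
proof (cases "r = 0 \<or> \<rho> = 0")
  case True
  have "0 \<le> A * (\<kappa> / 2 * r powr s)" "0 \<le> 2 powr (2 - s) / s * \<rho> powr s" using pos s by auto
  moreover have "a * (3 / 2 * \<kappa> * r powr (s - 1) * \<rho>) = 0" using True by auto
  ultimately show ?thesis by linarith
next
  case False
  then have r\<rho>: "0 < r" "0 < \<rho>" using pos by auto
  define X where "X = A * (\<kappa> / 2 * r powr s)"
  define Y where "Y = 2 powr (2 - s) / s * \<rho> powr s"
  define Z where "Z = a * (3 / 2 * \<kappa> * r powr (s - 1) * \<rho>)"
  have X: "0 < X" and Y: "0 < Y" and Z: "0 \<le> Z" using pos r\<rho> s by (auto simp: X_def Y_def Z_def)
  \<comment> \<open>The monomial common to Z^s and to the bound of Young's inequality; once it is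
    split off, only numbers are left.\<close>
  define W where "W = A powr (s - 1) * \<kappa> powr (s - 1) * (r powr s) powr (s - 1) * \<rho> powr s"
  have W: "0 < W" using pos r\<rho> by (simp add: W_def)
  have comm: "(r powr (s - 1)) powr s = (r powr s) powr (s - 1)" by (simp add: powr_powr mult.commute)
  have k: "\<kappa> powr s = \<kappa> powr (s - 1) * \<kappa>" using pos by (simp add: powr_diff)
  have "Z powr s = a powr s * ((3 / 2) powr s * \<kappa> powr s * (r powr (s - 1)) powr s * \<rho> powr s)"
    unfolding Z_def by (simp only: powr_mult)
  also have "\<dots> = (3 / 2) powr s * 2 powr (1 - 3 * real p) * (s / real p) * W"
    unfolding a comm k W_def using pos by simp
  also have "\<dots> \<le> ((s / (s - 1)) powr (s - 1) * 2 powr (3 - 2 * s)) * W"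
  proof (intro mult_right_mono less_imp_le[OF W])
    \<comment> \<open>The constant 2^(3p-1) of the step-size rule is used here: s <= p + 1 gives 1 -
      3 p <= 4 - 3 s, and 2^(-s) turns the 3/2 of the gradient bound into 3/4.\<close>
    have "(3 / 2) powr s * 2 powr (1 - 3 * real p) * (s / real p) \<le> (3 / 2) powr s * 2 powr (4 - 3 * s) * (s / real p)"
      using s p by (intro mult_left_mono mult_right_mono powr_mono) auto
    also have "(3 / 2) powr s * 2 powr (4 - 3 * s) = (3 / 4 :: real) powr s * (2 * 2 powr (3 - 2 * s))"
    proof -
      have "(2::real) powr (4 - 3 * s) = 2 powr (- s) * (2 * 2 powr (3 - 2 * s))"
        by (simp add: powr_add[symmetric] powr_mult_base)
      moreover have "(3 / 2 :: real) powr s * 2 powr (- s) = (3 / 4) powr s"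
        by (simp add: powr_minus divide_inverse[symmetric] powr_divide[symmetric])
      ultimately show ?thesis by (simp only: mult.assoc[symmetric])
    qed
    also have "(3 / 4) powr s * (2 * 2 powr (3 - 2 * s)) * (s / real p) = ((3 / 4) powr s * (s / real p)) * (2 * 2 powr (3 - 2 * s))"
      by (simp only: mult_ac)
    also have "\<dots> \<le> 1 * ((s / (s - 1)) powr (s - 1) * 2 powr (3 - 2 * s))"
      using three_quarters[OF p s(2,1)] exp_bound_two[OF s(1)] by (intro mult_mono mult_right_mono) auto
    finally show "(3 / 2) powr s * 2 powr (1 - 3 * real p) * (s / real p) \<le> (s / (s - 1)) powr (s - 1) * 2 powr (3 - 2 * s)"
      by simp
  qed
  also have "\<dots> = (X * s / (s - 1)) powr (s - 1) * (Y * s)"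
  proof -
    have "X * s / (s - 1) = (s / (s - 1)) * (1 / 2) * A * \<kappa> * r powr s"
      unfolding X_def using s by (simp add: divide_simps)
    then have "(X * s / (s - 1)) powr (s - 1) = (s / (s - 1)) powr (s - 1) * (1 / 2) powr (s - 1) * A powr (s - 1) * \<kappa> powr (s - 1) * (r powr s) powr (s - 1)"
      using pos s r\<rho> by (simp only: powr_mult) 
    moreover have "(1 / 2) powr (s - 1) * 2 powr (2 - s) = (2::real) powr (3 - 2 * s)"
    proof -
      have "(1 / 2 :: real) powr (s - 1) = 2 powr (1 - s)"
        using powr_minus_divide[of 2 "s - 1"] by (simp add: powr_divide)
      then show ?thesis by (simp add: powr_add[symmetric])
    qed
    moreover have "Y * s = 2 powr (2 - s) * \<rho> powr s" using s by (simp add: Y_def)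
    ultimately show ?thesis by (simp add: W_def mult_ac)
  qed
  finally have "Z \<le> X + Y" using X Y Z s by (intro young_split) auto
  then show ?thesis by (simp add: X_def Y_def Z_def)
qed

text \<open>The root A^(1/s) grows at least linearly. With u and b the roots after and before a
  step, the rule reads u^s - b^s = c^(1/s) u^(s-1); the tangent inequality bounds the left side by s
  u^(s-1) (u - b), and u^(s-1) cancels.\<close>

lemma sequence_growth:
  fixes A a :: "nat \<Rightarrow> real"
  assumes s: "1 < s" and c: "0 < c" and A0: "A 0 = 0"
    and step: "\<And>t. t < m \<Longrightarrow> 0 < a t \<and> A (Suc t) = A t + a t \<and> a t powr s = c * A (Suc t) powr (s - 1)"
  shows "t \<le> m \<Longrightarrow> 0 \<le> A t \<and> c * (real t / s) powr s \<le> A t"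
proof -
  have "t \<le> m \<Longrightarrow> 0 \<le> A t \<and> c powr (1 / s) * (real t / s) \<le> A t powr (1 / s)" for t
  proof (induction t)
    case (Suc t)
    then have IH: "0 \<le> A t" "c powr (1 / s) * (real t / s) \<le> A t powr (1 / s)" and t: "t < m" by auto
    have st: "0 < a t" "A (Suc t) = A t + a t" "a t powr s = c * A (Suc t) powr (s - 1)" using step[OF t] by auto
    have pos: "0 < A (Suc t)" using st IH by simp
    define u b where "u = A (Suc t) powr (1 / s)" and "b = A t powr (1 / s)"
    have us: "u powr s = A (Suc t)" "b powr s = A t" and u: "0 < u" "0 \<le> b"
      using pos IH(1) s by (auto simp: u_def b_def powr_powr)
    have "a t = (a t powr s) powr (1 / s)" using powr_powr[of "a t" s "1 / s"] st(1) s by simp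
    also have "\<dots> = c powr (1 / s) * u powr (s - 1)"
      using c pos by (simp add: st(3) powr_mult powr_powr u_def)
    finally have "c powr (1 / s) * u powr (s - 1) = u powr s - b powr s" using us st(2) by simp
    also have "\<dots> \<le> s * u powr (s - 1) * (u - b)" using u s by (intro power_tangent) auto
    finally have "c powr (1 / s) * u powr (s - 1) \<le> (s * (u - b)) * u powr (s - 1)" by (simp add: mult_ac)
    then have "c powr (1 / s) \<le> s * (u - b)" using u by simp
    then have "c powr (1 / s) / s \<le> u - b" using s by (simp add: field_simps)
    moreover have "c powr (1 / s) * (real (Suc t) / s) = c powr (1 / s) * (real t / s) + c powr (1 / s) / s"
      by (simp add: distrib_left add_divide_distrib)
    ultimately have "c powr (1 / s) * (real (Suc t) / s) \<le> u" using IH(2) by (simp only: b_def) 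
    with pos show ?case by (simp add: u_def)
  qed (simp add: A0)
  then have *: "0 \<le> A t \<and> c powr (1 / s) * (real t / s) \<le> A t powr (1 / s)" if "t \<le> m" for t using that .
  show "0 \<le> A t \<and> c * (real t / s) powr s \<le> A t" if "t \<le> m"
  proof
    show "0 \<le> A t" using *[OF that] by simp
    have "(c powr (1 / s) * (real t / s)) powr s \<le> (A t powr (1 / s)) powr s"
      using *[OF that] s c by (intro powr_mono2) auto
    moreover have "(c powr (1 / s) * (real t / s)) powr s = c * (real t / s) powr s"
      unfolding powr_mult powr_powr using s c by simp
    moreover have "(A t powr (1 / s)) powr s = A t" using *[OF that] s by (simp add: powr_powr)
    ultimately show "c * (real t / s) powr s \<le> A t" by (simp only:)
  qed
qed

text \<open>Removes the slack of working with near-minimizers: l is both a position on a segment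
  and, squared, the tolerance.\<close>

lemma halving_limit:
  fixes G g s :: real
  assumes "\<And>l. 0 < l \<Longrightarrow> l < 1 \<Longrightarrow> G \<le> (l + g) / (1 - l) powr s / 2 + l\<^sup>2"
  shows "G \<le> g / 2"
proof -
  have "((\<lambda>l. (l + g) / (1 - l) powr s / 2 + l\<^sup>2) \<longlongrightarrow> (0 + g) / (1 - 0) powr s / 2 + 0\<^sup>2) (at_right 0)"
    by (intro tendsto_intros) auto
  then have "((\<lambda>l. (l + g) / (1 - l) powr s / 2 + l\<^sup>2) \<longlongrightarrow> g / 2) (at_right 0)" by simp
  moreover have "\<forall>\<^sub>F l in at_right 0. G \<le> (l + g) / (1 - l) powr s / 2 + l\<^sup>2"
    unfolding eventually_at_right_field using assms by (intro exI[of _ 1]) auto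
  ultimately show ?thesis by (rule tendsto_lowerbound) simp
qed

context euclid
begin

lemma convex_tangent:
  assumes conv: "convex_on E G" and G: "der G D x" and mem: "x \<in> E" "z \<in> E"
  shows "G x + D (z - x) \<le> G z"
proof -
  have d: "z - x \<in> E" using mem by auto
  have "((\<lambda>t. (G (x + t *\<^sub>R (z - x)) - G (x + 0 *\<^sub>R (z - x))) / (t - 0)) \<longlongrightarrow> D (z - x)) (at_right 0)"
    using der_line0[OF G mem(1) d] unfolding has_field_derivative_iff by (auto intro: tendsto_mono[OF at_le])
  moreover have "\<forall>\<^sub>F t in at_right 0. (G (x + t *\<^sub>R (z - x)) - G (x + 0 *\<^sub>R (z - x))) / (t - 0) \<le> G z - G x"
    unfolding eventually_at_right_field
  proof (intro exI[of _ 1] conjI allI impI)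
    fix t :: real assume t: "0 < t" "t < 1"
    have "x + t *\<^sub>R (z - x) = (1 - t) *\<^sub>R x + t *\<^sub>R z" by (simp add: algebra_simps)
    then have "G (x + t *\<^sub>R (z - x)) \<le> (1 - t) * G x + t * G z"
      using convex_onD[OF conv, of t x z] t mem by simp
    then have "G (x + t *\<^sub>R (z - x)) - G x \<le> t * (G z - G x)" by (simp add: algebra_simps)
    then show "(G (x + t *\<^sub>R (z - x)) - G (x + 0 *\<^sub>R (z - x))) / (t - 0) \<le> G z - G x"
      using t by (simp add: field_simps)
  qed simp
  ultimately have "D (z - x) \<le> G z - G x" by (rule tendsto_upperbound) simp
  then show ?thesis by simp
qed

text \<open>Minimality is exploited only along the segment from v to x: there convexity of R forces
  the slope of the norm power at v to be at least s (R v - R x). Uniform convexity of the norm power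
  adds the growth term.\<close>

lemma prox_minimizer_growth:
  assumes D: "convex D" "D \<subseteq> E" and R: "convex_on D R" and s: "2 \<le> s" and w: "w \<in> E" and v: "v \<in> D"
    and min: "\<And>x. x \<in> D \<Longrightarrow> 1 / s * N (v - w) powr s + R v \<le> 1 / s * N (x - w) powr s + R x"
    and x: "x \<in> D"
  shows "1 / s * N (v - w) powr s + R v + 2 powr (2 - s) / s * N (x - v) powr s \<le> 1 / s * N (x - w) powr s + R x"
proof -
  have mem: "x \<in> E" "v \<in> E" using D x v by auto
  have d: "x - v \<in> E" using mem by auto
  let ?k = "\<lambda>t. N (v + t *\<^sub>R (x - v) - w) powr s"
  let ?D = "s * N (v - w) powr (s - 2) * B (v - w) (x - v)"
  have "der (\<lambda>x. N (x - w) powr s) (\<lambda>h. s * N (v - w) powr (s - 2) * B (v - w) h) v"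
    using mem w s by (intro der_N_powr') auto
  from der_line0[OF this mem(2) d]
  have "((\<lambda>t. (?k t - ?k 0) / (t - 0)) \<longlongrightarrow> ?D) (at_right 0)"
    unfolding has_field_derivative_iff by (auto intro: tendsto_mono[OF at_le])
  moreover have "\<forall>\<^sub>F t in at_right 0. s * (R v - R x) \<le> (?k t - ?k 0) / (t - 0)"
    unfolding eventually_at_right_field
  proof (intro exI[of _ 1] conjI allI impI)
    fix t :: real assume t: "0 < t" "t < 1"
    have eq: "v + t *\<^sub>R (x - v) = (1 - t) *\<^sub>R v + t *\<^sub>R x" by (simp add: algebra_simps)
    have "v + t *\<^sub>R (x - v) \<in> D" unfolding eq using t x v D(1) by (intro convexD) auto
    moreover have "R (v + t *\<^sub>R (x - v)) \<le> (1 - t) * R v + t * R x"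
      unfolding eq using convex_onD[OF R, of t v x] t x v by simp
    ultimately have "1 / s * N (v - w) powr s + R v \<le> 1 / s * ?k t + ((1 - t) * R v + t * R x)"
      using min by fastforce
    then have "t * (R v - R x) \<le> (?k t - N (v - w) powr s) / s" by (simp add: algebra_simps diff_divide_distrib)
    then have "t * (s * (R v - R x)) \<le> ?k t - N (v - w) powr s" using s by (simp add: field_simps)
    then show "s * (R v - R x) \<le> (?k t - ?k 0) / (t - 0)" using t by (simp add: pos_le_divide_eq mult.commute)
  qed simp
  ultimately have "s * (R v - R x) \<le> ?D" by (rule tendsto_lowerbound) simp
  moreover have "N (v - w) powr s + s * N (v - w) powr (s - 2) * B (v - w) ((x - w) - (v - w)) + 2 powr (2 - s) * N ((x - w) - (v - w)) powr s \<le> N (x - w) powr s"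
    using mem w s by (intro npow_uniform_convex) auto
  ultimately have "N (v - w) powr s + s * (R v - R x) + 2 powr (2 - s) * N (x - v) powr s \<le> N (x - w) powr s" by simp
  then have "(N (v - w) powr s + s * (R v - R x) + 2 powr (2 - s) * N (x - v) powr s) / s \<le> N (x - w) powr s / s"
    using s by (intro divide_right_mono) auto
  then show ?thesis using s by (simp add: add_divide_distrib)
qed

end

section \<open>The regularized composite problem and its model step\<close>

locale composite_problem = euclid +
  fixes f :: "'a \<Rightarrow> real" and \<phi> :: "'a \<Rightarrow> ereal" and p :: nat and \<nu> \<theta> \<delta> H :: real and x0 :: 'a
  assumes p: "2 \<le> p" and \<nu>: "0 \<le> \<nu>" "\<nu> \<le> 1" and H: "0 \<le> H" and \<theta>: "0 \<le> \<theta>" and \<delta>: "0 < \<delta>"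
    and conv: "convex_on E f" and td: "times_differentiable E p f" and hol: "holder E B f p \<nu> = ennreal H"
    and \<phi>: "closed_convex_fun E \<phi>" and x0: "x0 \<in> E"
begin

definition s :: real where "s = real p + \<nu>"

abbreviation "F \<equiv> F_reg B f p \<nu> \<delta> x0"
abbreviation "HF \<equiv> H_F E B f p \<nu> \<delta>"
abbreviation "HR \<equiv> H_reg E B f p \<nu> \<theta> \<delta>"
abbreviation "model \<equiv> Omega E B f p \<nu> \<theta> \<delta> x0"
abbreviation "tensor_step \<equiv> model_step E B f \<phi> p \<nu> \<theta> \<delta> x0"
abbreviation "inner_run \<equiv> alg5 E B f \<phi> p \<nu> \<theta> \<delta> x0"
abbreviation "restart_length \<equiv> alg6_m E B f p \<nu> \<theta> \<delta>"
abbreviation "outer_run \<equiv> alg6_run E B f \<phi> p \<nu> \<theta> \<delta> x0"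
abbreviation "stop_test \<equiv> alg6_stop E B f p \<nu> \<delta> x0"
abbreviation "stops_at \<equiv> alg6_stops_at E B f p \<nu> \<delta> x0"

text \<open>The gradient of the penalty \<open>HR / fact p\<close> r^s of the model is
  \<open>\<kappa>\<close> r^(s-2) B(x - y), while \<open>\<kappa>'\<close> r^(s-1) bounds everything
  else in the gradient: Taylor error plus inexactness.\<close>

definition \<kappa> :: real where "\<kappa> = s / fact p * HR"
definition \<kappa>' :: real where "\<kappa>' = HF / fact (p - 1) + \<theta>"

lemma s: "2 \<le> s" "s \<le> real p + 1" "1 < s" "0 < s" "0 \<le> s"
  using p \<nu> by (auto simp: s_def)

lemma C_pos: "0 < C_const p \<nu>"
  unfolding C_const_def using \<nu> by (intro mult_pos_pos prod_pos) auto

lemma HF_eq: "HF = H + \<delta> / s * C_const p \<nu>"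
  using H by (simp add: H_F_def hol s_def)

lemma HF_pos: "0 < HF"
  unfolding HF_eq using C_pos \<delta> s H by (intro add_nonneg_pos) auto

lemma HR_pos: "0 < HR"
  unfolding H_reg_def using HF_pos p \<theta> by (intro mult_pos_pos add_pos_nonneg) auto

lemma fact_p: "fact p = real p * fact (p - 1)"
  using p by (intro fact_reduce) auto

lemma \<kappa>_eq: "\<kappa> = s * (HF / fact (p - 1) + 3 * \<theta>)"
  using p by (simp add: \<kappa>_def H_reg_def fact_p field_simps)

lemma \<kappa>_pos: "0 < \<kappa>"
  unfolding \<kappa>_def using s HR_pos by simp

text \<open>The factor p in \<open>H_reg\<close> turns 1 / p! into 1 / (p - 1)!, so both constants
  contain the same Taylor term; s >= 2 then supplies the factor 2.\<close>

lemma \<kappa>': "0 \<le> \<kappa>'" "2 * \<kappa>' \<le> \<kappa>"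
proof -
  show "0 \<le> \<kappa>'" using HF_pos \<theta> by (simp add: \<kappa>'_def)
  have "2 * \<kappa>' \<le> 2 * (HF / fact (p - 1) + 3 * \<theta>)" using \<theta> by (simp add: \<kappa>'_def)
  also have "\<dots> \<le> \<kappa>" unfolding \<kappa>_eq using s HF_pos \<theta> by (intro mult_right_mono) auto
  finally show "2 * \<kappa>' \<le> \<kappa>" .
qed

lemma F_eq: "F x = f x + \<delta> / s * N (x - x0) powr s"
  by (simp add: F_reg_def s_def)

lemma der_f: "x \<in> E \<Longrightarrow> der f (grad E f x) x"
  using der_frechet[OF times_differentiable_D[OF td, of "[]" x]] p by (simp add: grad_def)

lemma der_pow: "a \<in> E \<Longrightarrow> x \<in> E \<Longrightarrow> der (\<lambda>x. N (x - a) powr s) (\<lambda>h. s * N (x - a) powr (s - 2) * B (x - a) h) x"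
  using s by (intro der_N_powr') auto

lemma der_F': "x \<in> E \<Longrightarrow> der F (\<lambda>h. grad E f x h + \<delta> / s * (s * N (x - x0) powr (s - 2) * B (x - x0) h)) x"
  by (rule der_cong[OF der_add[OF der_f der_cmult[OF der_pow[OF x0], of x "\<delta> / s"]]]) (auto simp: F_eq)

lemma der_F: "x \<in> E \<Longrightarrow> der F (grad E F x) x"
  unfolding grad_def by (rule der_frechet[OF der_differentiable[OF der_F']])

lemma grad_F: "x \<in> E \<Longrightarrow> h \<in> E \<Longrightarrow> grad E F x h = grad E f x h + \<delta> * N (x - x0) powr (s - 2) * B (x - x0) h"
  using der_unique[OF der_F der_F', of x h] s by simp

lemma linear_grad: "der G D x \<Longrightarrow> linear (grad E G x)"
  unfolding grad_def using der_differentiable frechet_derivative_works has_derivative_linear by blast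

lemma N_pow_mult_B: "x \<in> E \<Longrightarrow> N x powr (s - 2) * B x x = N x powr s"
  by (cases "N x = 0") (auto simp: N_eq_0 B_simps powr_diff powr_numeral simp flip: N_sq)

lemma B_bound: "x \<in> E \<Longrightarrow> h \<in> E \<Longrightarrow> \<bar>N x powr (s - 2) * B x h\<bar> \<le> N x powr (s - 1) * N h"
proof -
  assume mem: "x \<in> E" "h \<in> E"
  have "\<bar>N x powr (s - 2) * B x h\<bar> \<le> N x powr (s - 2) * (N x * N h)"
    using B_cauchy_schwarz[OF mem] by (simp add: abs_mult mult_left_mono)
  also have "\<dots> = N x powr (s - 1) * N h"
    using mem powr_add[of "N x" "s - 2" 1] by simp
  finally show ?thesis .
qed

text \<open>Taylor's estimate is applied to f and to the norm power separately, since
  \<open>F_deriv\<close> is a sum of two terms and for \<nu> = 0 need not be a derivative of F.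
  Subtracting the \<kappa> term removes the gradient of the model's penalty, so the comparison is
  with the polynomial part alone.\<close>

lemma model_gradient:
  assumes y: "y \<in> E" and x: "x \<in> E"
  shows "\<exists>D. der (model y) D x \<and> (\<forall>h\<in>E. \<bar>grad E F x h - (D h - \<kappa> * N (x - y) powr (s - 2) * B (x - y) h)\<bar>
     \<le> HF / fact (p - 1) * N (x - y) powr (s - 1) * N h)"
proof -
  let ?r = "N (x - y) powr (s - 1)"
  let ?n = "\<lambda>x. N (x - x0) powr s"
  have "\<exists>D. der (\<lambda>x. \<Sum>i=1..p. dderiv E f (replicate i (x - y)) y / fact i) D x \<and>
    (\<forall>h\<in>E. \<bar>dderiv E f [h] x - D h\<bar> \<le> (H * ?r) / fact (p - 1) * N h)"
  proof (rule taylor_gradient[OF times_differentiable_mono[OF td] p \<nu>(1) _ x y])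
    show "der (\<lambda>x. dderiv E f (replicate p (x - y)) y) (\<lambda>h. real p * dderiv E f (replicate (p - 1) (x - y) @ [h]) y) x"
      using x y by (intro der_dderiv_replicate[OF smooth_at_of_times[OF td]]) auto
    fix h \<tau> assume "h \<in> E" "0 \<le> \<tau>" "\<tau> \<le> (1::real)"
    from holder_remainder[OF td hol H p \<nu>(1) x y this]
    show "\<bar>dderiv E f (replicate (p - 2) (x - y) @ [h]) (y + \<tau> *\<^sub>R (x - y)) - dderiv E f (replicate (p - 2) (x - y) @ [h]) y
      - \<tau> * dderiv E f (replicate (p - 1) (x - y) @ [h]) y\<bar> \<le> (H * ?r) * \<tau> powr (1 + \<nu>) * N h"
      by (simp add: s_def)
  qed (use H in auto)
  then obtain Df where Df: "der (\<lambda>x. \<Sum>i=1..p. dderiv E f (replicate i (x - y)) y / fact i) Df x"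
    "\<And>h. h \<in> E \<Longrightarrow> \<bar>dderiv E f [h] x - Df h\<bar> \<le> (H * ?r) / fact (p - 1) * N h" by blast
  obtain Q where Q: "der (\<lambda>x. dderiv E ?n (replicate p (x - y)) y) (\<lambda>h. real p * Q h) x"
    "\<And>h \<tau>. h \<in> E \<Longrightarrow> 0 \<le> \<tau> \<Longrightarrow> \<tau> \<le> 1 \<Longrightarrow>
      \<bar>dderiv E ?n (replicate (p - 2) (x - y) @ [h]) (y + \<tau> *\<^sub>R (x - y))
        - dderiv E ?n (replicate (p - 2) (x - y) @ [h]) y - \<tau> * Q h\<bar>
      \<le> C_const p \<nu> * ?r * \<tau> powr (1 + \<nu>) * N h"
    using npow_remainder[OF p \<nu> s_def x0 x y] by blast
  have "\<exists>D. der (\<lambda>x. \<Sum>i=1..p. dderiv E ?n (replicate i (x - y)) y / fact i) D x \<and>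
    (\<forall>h\<in>E. \<bar>dderiv E ?n [h] x - D h\<bar> \<le> (C_const p \<nu> * ?r) / fact (p - 1) * N h)"
  proof (rule taylor_gradient[OF _ p \<nu>(1) _ x y Q])
    show "times_differentiable E (p - 1) ?n" using x0 p \<nu> by (intro times_differentiable_npow) (auto simp: s_def)
  qed (use C_pos in auto)
  then obtain Dn where Dn: "der (\<lambda>x. \<Sum>i=1..p. dderiv E ?n (replicate i (x - y)) y / fact i) Dn x"
    "\<And>h. h \<in> E \<Longrightarrow> \<bar>dderiv E ?n [h] x - Dn h\<bar> \<le> (C_const p \<nu> * ?r) / fact (p - 1) * N h" by blast
  let ?D = "\<lambda>h. (0 + (Df h + \<delta> / s * Dn h)) + HR / fact p * (s * N (x - y) powr (s - 2) * B (x - y) h)"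
  have "der (\<lambda>x. (F y + ((\<Sum>i=1..p. dderiv E f (replicate i (x - y)) y / fact i)
     + \<delta> / s * (\<Sum>i=1..p. dderiv E ?n (replicate i (x - y)) y / fact i))) + HR / fact p * N (x - y) powr s) ?D x"
    using x y by (intro der_add der_cmult der_const Df(1) Dn(1) der_pow)
  then have "der (model y) ?D x"
  proof (rule der_cong[OF _ x])
    fix z assume "z \<in> E"
    have "(\<Sum>i=1..p. F_deriv E B f p \<nu> \<delta> x0 i y (z - y) / fact i) = (\<Sum>i=1..p. dderiv E f (replicate i (z - y)) y / fact i)
       + \<delta> / s * (\<Sum>i=1..p. dderiv E ?n (replicate i (z - y)) y / fact i)"
      by (simp add: F_deriv_def s_def sum.distrib add_divide_distrib sum_distrib_left)
    then show "(F y + ((\<Sum>i=1..p. dderiv E f (replicate i (z - y)) y / fact i)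
     + \<delta> / s * (\<Sum>i=1..p. dderiv E ?n (replicate i (z - y)) y / fact i))) + HR / fact p * N (z - y) powr s = model y z"
      by (simp add: Omega_def s_def)
  qed simp
  moreover have "\<bar>grad E F x h - (?D h - \<kappa> * N (x - y) powr (s - 2) * B (x - y) h)\<bar> \<le> HF / fact (p - 1) * ?r * N h" if h: "h \<in> E" for h
  proof -
    have 1: "dderiv E f [h] x = grad E f x h"
      using dderiv_Cons_eq[of f "[]" "grad E f x" x h] der_f x h by simp
    have 2: "dderiv E ?n [h] x = s * N (x - x0) powr (s - 2) * B (x - x0) h"
      using dderiv_Cons_eq[of ?n "[]" _ x h] der_pow[OF x0 x] x h by simp
    have "grad E F x h - (?D h - \<kappa> * N (x - y) powr (s - 2) * B (x - y) h)
       = (dderiv E f [h] x - Df h) + \<delta> / s * (dderiv E ?n [h] x - Dn h)"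
      unfolding 1 2 grad_F[OF x h] using s(4) by (simp add: \<kappa>_def algebra_simps diff_divide_distrib)
    also have "\<bar>\<dots>\<bar> \<le> (H * ?r) / fact (p - 1) * N h + \<delta> / s * ((C_const p \<nu> * ?r) / fact (p - 1) * N h)"
      using Df(2)[OF h] mult_left_mono[OF Dn(2)[OF h], of "\<delta> / s"] \<delta> s(4)
      by (intro order_trans[OF abs_triangle_ineq] add_mono) (auto simp: abs_mult simp del: dderiv.simps)
    also have "\<dots> = HF / fact (p - 1) * ?r * N h"
      by (simp add: HF_eq add_divide_distrib algebra_simps)
    finally show ?thesis .
  qed
  ultimately show ?thesis by blast
qed

abbreviation "D \<equiv> eff_dom E \<phi>"
definition \<phi>r :: "'a \<Rightarrow> real" where "\<phi>r x = real_of_ereal (\<phi> x)"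
definition Fc :: "'a \<Rightarrow> real" where "Fc x = F x + \<phi>r x"

lemma D_E: "x \<in> D \<Longrightarrow> x \<in> E"
  by (simp add: eff_dom_def)

lemma \<phi>_real: "x \<in> D \<Longrightarrow> \<phi> x = ereal (\<phi>r x)"
  using \<phi> by (auto simp: eff_dom_def \<phi>r_def closed_convex_fun_def ereal_real)

lemma \<phi>_infty: "x \<in> E \<Longrightarrow> x \<notin> D \<Longrightarrow> \<phi> x = \<infinity>"
  by (auto simp: eff_dom_def)

lemma D_convex_\<phi>:
  assumes "x \<in> D" "z \<in> D" "0 \<le> l" "l \<le> 1"
  shows "(1 - l) *\<^sub>R x + l *\<^sub>R z \<in> D" "\<phi>r ((1 - l) *\<^sub>R x + l *\<^sub>R z) \<le> (1 - l) * \<phi>r x + l * \<phi>r z"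
proof -
  have "(x, \<phi>r x) \<in> epi E \<phi>" "(z, \<phi>r z) \<in> epi E \<phi>"
    using assms \<phi>_real D_E by (auto simp: epi_def)
  then have "(1 - l) *\<^sub>R (x, \<phi>r x) + l *\<^sub>R (z, \<phi>r z) \<in> epi E \<phi>"
    using \<phi> assms unfolding closed_convex_fun_def by (intro convexD) auto
  then have *: "(1 - l) *\<^sub>R x + l *\<^sub>R z \<in> E" "\<phi> ((1 - l) *\<^sub>R x + l *\<^sub>R z) \<le> ereal ((1 - l) * \<phi>r x + l * \<phi>r z)"
    by (auto simp: epi_def)
  then show "(1 - l) *\<^sub>R x + l *\<^sub>R z \<in> D" unfolding eff_dom_def by (auto intro: le_less_trans)
  from \<phi>_real[OF this] *(2) show "\<phi>r ((1 - l) *\<^sub>R x + l *\<^sub>R z) \<le> (1 - l) * \<phi>r x + l * \<phi>r z" by simp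
qed

lemma convex_D: "convex D"
  unfolding convex_alt using D_convex_\<phi>(1) by auto

lemma convex_\<phi>r: "convex_on D \<phi>r"
  using convex_D D_convex_\<phi>(2) by (intro convex_onI) auto

lemma F_uniform_convex:
  assumes "x \<in> E" "z \<in> E"
  shows "F x + grad E F x (z - x) + \<delta> * 2 powr (2 - s) / s * N (z - x) powr s \<le> F z"
proof -
  have 1: "f x + grad E f x (z - x) \<le> f z" by (rule convex_tangent[OF conv der_f]) (use assms in auto)
  have "N (x - x0) powr s + s * N (x - x0) powr (s - 2) * B (x - x0) ((z - x0) - (x - x0))
     + 2 powr (2 - s) * N ((z - x0) - (x - x0)) powr s \<le> N (z - x0) powr s"
    using assms x0 s by (intro npow_uniform_convex) auto
  then have "\<delta> / s * (N (x - x0) powr s + s * N (x - x0) powr (s - 2) * B (x - x0) (z - x)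
     + 2 powr (2 - s) * N (z - x) powr s) \<le> \<delta> / s * N (z - x0) powr s"
    using \<delta> s by (intro mult_left_mono) auto
  with 1 show ?thesis
    using assms s(4) grad_F[of x "z - x"] by (simp add: F_eq E_diff distrib_left mult.assoc[symmetric])
qed

lemma F_tangent: "x \<in> E \<Longrightarrow> z \<in> E \<Longrightarrow> F x + grad E F x (z - x) \<le> F z"
proof -
  assume "x \<in> E" "z \<in> E"
  moreover have "0 \<le> \<delta> * 2 powr (2 - s) / s * N (z - x) powr s"
    using \<delta> s by (intro mult_nonneg_nonneg divide_nonneg_nonneg) auto
  ultimately show ?thesis using F_uniform_convex[of x z] by linarith
qed

lemma step_facts:
  assumes st: "tensor_step y x g" and y: "y \<in> E"
  defines "G \<equiv> \<lambda>h. grad E F x h + g h" and "r \<equiv> N (x - y)"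
  shows "x \<in> D" "linear g" "linear G" "\<And>z. z \<in> D \<Longrightarrow> \<phi>r x + g (z - x) \<le> \<phi>r z"
    "\<kappa> / 2 * r powr s \<le> G (y - x)" "\<And>h. h \<in> E \<Longrightarrow> \<bar>G h\<bar> \<le> 3 / 2 * \<kappa> * r powr (s - 1) * N h"
proof -
  have x: "x \<in> E" and g: "g \<in> subdiff E \<phi> x"
    and dual: "dual_nrm E B (\<lambda>h. grad E (model y) x h + g h) \<le> \<theta> * r powr (s - 1)"
    using st by (auto simp: model_step_def s_def r_def)
  show xD: "x \<in> D" and ling: "linear g" using g by (auto simp: subdiff_def)
  show "linear G" unfolding G_def by (intro linear_compose_add linear_grad[OF der_F[OF x]] ling)
  show "\<phi>r x + g (z - x) \<le> \<phi>r z" if "z \<in> D" for z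
  proof -
    have "\<phi> x + ereal (g (z - x)) \<le> \<phi> z" using g D_E[OF that] by (auto simp: subdiff_def)
    then show ?thesis using \<phi>_real[OF xD] \<phi>_real[OF that] by simp
  qed
  obtain D\<Omega> where D\<Omega>: "der (model y) D\<Omega> x"
    "\<And>h. h \<in> E \<Longrightarrow> \<bar>grad E F x h - (D\<Omega> h - \<kappa> * r powr (s - 2) * B (x - y) h)\<bar> \<le> HF / fact (p - 1) * r powr (s - 1) * N h"
    using model_gradient[OF y x] unfolding r_def by blast
  have lin\<Omega>: "linear (\<lambda>h. grad E (model y) x h + g h)"
    by (intro linear_compose_add linear_grad[OF D\<Omega>(1)] ling)
  have key: "\<bar>G h + \<kappa> * r powr (s - 2) * B (x - y) h\<bar> \<le> \<kappa>' * r powr (s - 1) * N h" if h: "h \<in> E" for h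
  proof -
    have "\<bar>D\<Omega> h + g h\<bar> \<le> dual_nrm E B (\<lambda>h. grad E (model y) x h + g h) * N h"
      using dual_nrm_bound[OF lin\<Omega> h] frechet_der[OF D\<Omega>(1) x h] by (simp add: grad_def)
    also have "\<dots> \<le> \<theta> * r powr (s - 1) * N h" using dual h by (intro mult_right_mono) auto
    finally have "\<bar>D\<Omega> h + g h\<bar> \<le> \<theta> * r powr (s - 1) * N h" .
    moreover have "G h + \<kappa> * r powr (s - 2) * B (x - y) h
      = (grad E F x h - (D\<Omega> h - \<kappa> * r powr (s - 2) * B (x - y) h)) + (D\<Omega> h + g h)"
      by (simp add: G_def)
    moreover have "\<kappa>' * r powr (s - 1) * N h = HF / fact (p - 1) * r powr (s - 1) * N h + \<theta> * r powr (s - 1) * N h"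
      by (simp only: \<kappa>'_def distrib_right)
    ultimately show ?thesis using D\<Omega>(2)[OF h] by linarith
  qed
  have r0: "0 \<le> r" using x y by (simp add: r_def)
  have rr: "r powr (s - 1) * r = r powr s" using r0 powr_add[of r "s - 1" 1] by simp
  \<comment> \<open>\<kappa> - \<kappa>' >= \<kappa> / 2 gives the lower bound, tested at h = y - x,
    and \<kappa> + \<kappa>' <= 3 \<kappa> / 2 gives the upper bound for every h.\<close>
  have half: "\<kappa>' * c \<le> \<kappa> / 2 * c" if "0 \<le> c" for c
    using \<kappa>'(2) that by (intro mult_right_mono) auto
  show "\<kappa> / 2 * r powr s \<le> G (y - x)"
  proof -
    have yx: "y - x \<in> E" using x y by auto
    have "B (x - y) (y - x) = - B (x - y) (x - y)" by (simp add: B_simps)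
    then have "r powr (s - 2) * B (x - y) (y - x) = - (r powr s)"
      using N_pow_mult_B[of "x - y"] x y by (simp add: r_def)
    then have e1: "\<kappa> * r powr (s - 2) * B (x - y) (y - x) = - \<kappa> * r powr s" by (simp add: mult.assoc)
    have e2: "\<kappa>' * r powr (s - 1) * N (y - x) = \<kappa>' * r powr s"
      using rr N_minus_commute[of y x] by (simp add: r_def mult.assoc)
    have "\<bar>G (y - x) + - \<kappa> * r powr s\<bar> \<le> \<kappa>' * r powr s" using key[OF yx] unfolding e1 e2 .
    then show ?thesis using half[of "r powr s"] by (simp add: abs_le_iff)
  qed
  show "\<bar>G h\<bar> \<le> 3 / 2 * \<kappa> * r powr (s - 1) * N h" if h: "h \<in> E" for h
  proof -
    have "\<bar>\<kappa> * r powr (s - 2) * B (x - y) h\<bar> \<le> \<kappa> * (r powr (s - 1) * N h)"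
      using B_bound[of "x - y" h] x y h \<kappa>_pos mult_left_mono[of _ _ \<kappa>] by (simp add: r_def mult.assoc abs_mult)
    then show ?thesis using key[OF h] half[of "r powr (s - 1) * N h"] h by (simp add: algebra_simps)
  qed
qed

section \<open>Rate of the inner method\<close>

text \<open>The coefficient of the step-size rule written through \<kappa>, using (p - 1)! / HR = s
  / (p \<kappa>).\<close>

definition coef :: real where "coef = 2 powr (1 - 3 * real p) * (s / real p) / \<kappa>"

lemma coef_eq: "1 / 2 ^ (3 * p - 1) * (fact (p - 1) / HR) = coef"
proof -
  have "(2::real) powr (1 - 3 * real p) = 2 powr (- real (3 * p - 1))" using p by (simp add: of_nat_diff)
  also have "\<dots> = 1 / 2 ^ (3 * p - 1)" by (simp add: powr_minus_divide powr_realpow)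
  finally show ?thesis using p s(4) HR_pos by (simp add: coef_def \<kappa>_def fact_p)
qed

lemma coef_pos: "0 < coef"
  unfolding coef_def using p s(4) \<kappa>_pos by (intro divide_pos_pos mult_pos_pos) auto

text \<open>The invariant is that A_t Fc(w_t) stays below the minimum of \<Psi>_t, while convexity
  bounds \<Psi>_t above by the proximal term plus A_t Fc. The comparison point x ranges over all of
  D, so that a near-minimizer can be inserted later.\<close>

lemma alg5_rate:
  assumes alg: "inner_run m w0 w'" and w0: "w0 \<in> D"
  shows "w' \<in> D \<and> (\<exists>A. 0 \<le> A \<and> coef * (real m / s) powr s \<le> A \<and>
    (\<forall>x\<in>D. A * (Fc w' - Fc x) \<le> 1 / s * N (x - w0) powr s))"
proof -
  obtain w v a A \<psi> where init: "w 0 = w0" "v 0 = w0" "A 0 = (0::real)"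
    and \<psi>0: "\<psi> 0 = (\<lambda>x. ereal (1 / s * N (x - w0) powr s))"
    and it: "\<forall>t<m. 0 < a t
        \<and> a t powr s = coef * (A t + a t) powr (s - 1)
        \<and> A (Suc t) = A t + a t
        \<and> (let \<gamma> = a t / A (Suc t); \<eta> = (1 - \<gamma>) *\<^sub>R w t + \<gamma> *\<^sub>R v t
           in \<exists>g. tensor_step \<eta> (w (Suc t)) g)
        \<and> \<psi> (Suc t) = (\<lambda>x. \<psi> t x + ereal (a t) *
             (ereal (F (w (Suc t)) + grad E F (w (Suc t)) (x - w (Suc t))) + \<phi> x))
        \<and> is_arg_min (\<psi> (Suc t)) (\<lambda>x. x \<in> E) (v (Suc t))"
    and w': "w' = w m"
    using alg unfolding alg5_def coef_eq s_def[symmetric] by blast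
  define \<eta> where "\<eta> t = (1 - a t / A (Suc t)) *\<^sub>R w t + (a t / A (Suc t)) *\<^sub>R v t" for t
  have a: "0 < a t" and A_Suc: "A (Suc t) = A t + a t" and a_eq: "a t powr s = coef * A (Suc t) powr (s - 1)"
    and st: "\<exists>g. tensor_step (\<eta> t) (w (Suc t)) g"
    and \<psi>_Suc: "\<psi> (Suc t) = (\<lambda>x. \<psi> t x + ereal (a t) *
             (ereal (F (w (Suc t)) + grad E F (w (Suc t)) (x - w (Suc t))) + \<phi> x))"
    and arg: "is_arg_min (\<psi> (Suc t)) (\<lambda>x. x \<in> E) (v (Suc t))" if "t < m" for t
  proof -
    note * = it[rule_format, OF that, unfolded Let_def, folded \<eta>_def]
    from * show "0 < a t" "A (Suc t) = A t + a t" "\<exists>g. tensor_step (\<eta> t) (w (Suc t)) g"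
      "\<psi> (Suc t) = (\<lambda>x. \<psi> t x + ereal (a t) *
             (ereal (F (w (Suc t)) + grad E F (w (Suc t)) (x - w (Suc t))) + \<phi> x))"
      "is_arg_min (\<psi> (Suc t)) (\<lambda>x. x \<in> E) (v (Suc t))" by blast+
    from * show "a t powr s = coef * A (Suc t) powr (s - 1)" by simp
  qed
  have growth: "0 \<le> A t" "coef * (real t / s) powr s \<le> A t" if "t \<le> m" for t
    using sequence_growth[where A = A and a = a and m = m and t = t, OF s(3) coef_pos init(3)] that a A_Suc a_eq by auto
  \<comment> \<open>On D the extended-valued \<psi> t equals the real \<Psi> t; R t is its part
    without the proximal term, convex but possibly nonsmooth.\<close>
  define l where "l i x = F (w (Suc i)) + grad E F (w (Suc i)) (x - w (Suc i))" for i x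
  define R where "R t x = (\<Sum>i<t. a i * (l i x + \<phi>r x))" for t x
  define \<Psi> where "\<Psi> t x = 1 / s * N (x - w0) powr s + R t x" for t x
  have \<psi>_D: "\<psi> t x = ereal (\<Psi> t x)" if "t \<le> m" "x \<in> D" for t x
    using that(1)
  proof (induction t)
    case 0
    show ?case by (simp add: \<psi>0 \<Psi>_def R_def)
  next
    case (Suc t)
    then show ?case using \<psi>_Suc[of t] \<phi>_real[OF that(2)] by (simp add: \<Psi>_def R_def l_def)
  qed
  have v_min: "v t \<in> D \<and> (\<forall>x\<in>D. \<Psi> t (v t) \<le> \<Psi> t x)" if "t \<le> m" for t
  proof (cases t)
    case 0
    then show ?thesis using w0 init(2) s(4) by (simp add: \<Psi>_def R_def)
  next
    case (Suc n)
    then have n: "n < m" using that by simp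
    have vE: "v t \<in> E" and le: "\<And>y. y \<in> E \<Longrightarrow> \<psi> t (v t) \<le> \<psi> t y"
      using arg[OF n] by (auto simp: is_arg_min_def Suc not_less)
    \<comment> \<open>Outside D the weight a > 0 makes \<psi> infinite, whereas the starting point
      has a finite value.\<close>
    have vD: "v t \<in> D"
    proof (rule ccontr)
      assume "v t \<notin> D"
      then have "\<psi> t (v t) = \<infinity>" using \<psi>_Suc[OF n] \<phi>_infty[OF vE] a[OF n] by (simp add: Suc)
      then show False using le[OF D_E[OF w0]] \<psi>_D[OF that w0] by simp
    qed
    moreover have "\<Psi> t (v t) \<le> \<Psi> t x" if "x \<in> D" for x
      using le[OF D_E[OF that]] \<psi>_D[OF \<open>t \<le> m\<close>] vD that by simp
    ultimately show ?thesis by blast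
  qed
  have w_D: "w t \<in> D" if "t \<le> m" for t
    using that
  proof (induction t)
    case (Suc t)
    have "\<eta> t \<in> E" using Suc v_min[of t] D_E unfolding \<eta>_def by (intro E_add E_scale) auto
    then show ?case using st[of t] step_facts(1) Suc.prems by auto
  qed (use init w0 in simp)
  have l_convex: "convex_on D (l i)" if "i < m" for i
  proof (rule convex_onI)
    fix t x y assume t: "0 < t" "t < (1::real)" and xy: "x \<in> D" "y \<in> D"
    have lin: "linear (grad E F (w (Suc i)))" using w_D[of "Suc i"] that D_E by (intro linear_grad[OF der_F]) auto
    have "(1 - t) *\<^sub>R x + t *\<^sub>R y - w (Suc i) = (1 - t) *\<^sub>R (x - w (Suc i)) + t *\<^sub>R (y - w (Suc i))"
      by (simp add: algebra_simps)
    from arg_cong[OF this, of "grad E F (w (Suc i))"]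
    have "grad E F (w (Suc i)) ((1 - t) *\<^sub>R x + t *\<^sub>R y - w (Suc i))
      = (1 - t) * grad E F (w (Suc i)) (x - w (Suc i)) + t * grad E F (w (Suc i)) (y - w (Suc i))"
      by (simp only: linear_add[OF lin] linear_cmul[OF lin] real_scaleR_def)
    then show "l i ((1 - t) *\<^sub>R x + t *\<^sub>R y) \<le> (1 - t) * l i x + t * l i y"
      unfolding l_def by (simp only:) (simp add: algebra_simps)
  qed (rule convex_D)
  have R_convex: "convex_on D (R t)" if "t \<le> m" for t
    using that
  proof (induction t)
    case 0
    show ?case using convex_D by (simp add: R_def convex_on_def)
  next
    case (Suc t)
    have "convex_on D (\<lambda>x. R t x + a t * (l t x + \<phi>r x))"
      using Suc a[of t] by (intro convex_on_add convex_on_cmul l_convex convex_\<phi>r) auto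
    then show ?case by (simp add: R_def)
  qed
  have R_le: "R t x \<le> A t * Fc x" if "t \<le> m" "x \<in> D" for t x
    using that(1)
  proof (induction t)
    case (Suc t)
    have "a t * (l t x + \<phi>r x) \<le> a t * Fc x"
      using F_tangent[of "w (Suc t)" x] w_D[of "Suc t"] D_E that Suc.prems a[of t]
      by (intro mult_left_mono) (auto simp: l_def Fc_def)
    then show ?case using Suc A_Suc[of t] by (simp add: R_def distrib_right)
  qed (simp add: R_def init)
  have main: "A t * Fc (w t) \<le> \<Psi> t (v t)" if "t \<le> m" for t
    using that
  proof (induction t)
    case 0
    then show ?case by (simp add: init \<Psi>_def R_def)
  next
    case (Suc t)
    then have t: "t < m" "t \<le> m" by auto
    define x where "x = v (Suc t)"
    have mem: "w t \<in> D" "v t \<in> D" "w (Suc t) \<in> D" "x \<in> D"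
      using w_D v_min Suc.prems by (auto simp: x_def)
    note memE = mem[THEN D_E]
    have \<eta>E: "\<eta> t \<in> E" unfolding \<eta>_def using memE by (intro E_add E_scale) auto
    obtain g where g: "tensor_step (\<eta> t) (w (Suc t)) g" using st[OF t(1)] by blast
    note sf = step_facts[OF g \<eta>E]
    define G where "G h = grad E F (w (Suc t)) h + g h" for h
    define r where "r = N (w (Suc t) - \<eta> t)"
    define \<rho> where "\<rho> = N (x - v t)"
    have lin: "linear G" using sf(3) unfolding G_def .
    have Apos: "0 < A (Suc t)" using a[OF t(1)] growth(1)[OF t(2)] A_Suc[OF t(1)] by simp
    \<comment> \<open>The choice of \<eta> makes this identity hold: both linearizations combine
      into one at \<eta>, where the step gains, and one along x - v_t, where growth around v_t
      compensates.\<close>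
    have "A t *\<^sub>R (w t - w (Suc t)) + a t *\<^sub>R (x - w (Suc t)) = A (Suc t) *\<^sub>R (\<eta> t - w (Suc t)) + a t *\<^sub>R (x - v t)"
    proof -
      have "A (Suc t) *\<^sub>R \<eta> t = (A (Suc t) - a t) *\<^sub>R w t + a t *\<^sub>R v t"
        using Apos by (simp add: \<eta>_def scaleR_add_right algebra_simps)
      then show ?thesis using A_Suc[OF t(1)] by (simp add: algebra_simps)
    qed
    from arg_cong[OF this, of G]
    have Geq: "A t * G (w t - w (Suc t)) + a t * G (x - w (Suc t)) = A (Suc t) * G (\<eta> t - w (Suc t)) + a t * G (x - v t)"
      by (simp add: linear_add[OF lin] linear_cmul[OF lin])
    have e1: "\<Psi> t (v t) + 2 powr (2 - s) / s * \<rho> powr s \<le> \<Psi> t x"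
      unfolding \<Psi>_def \<rho>_def
      by (rule prox_minimizer_growth[OF convex_D _ R_convex[OF t(2)] s(1) D_E[OF w0] mem(2) _ mem(4)])
        (use v_min[OF t(2)] D_E in \<open>auto simp: \<Psi>_def\<close>)
    have "F (w (Suc t)) + grad E F (w (Suc t)) (w t - w (Suc t)) \<le> F (w t)"
      using memE by (intro F_tangent)
    then have "Fc (w (Suc t)) + G (w t - w (Suc t)) \<le> Fc (w t)"
      using sf(4)[OF mem(1)] by (simp add: Fc_def G_def)
    then have e2: "A t * (Fc (w (Suc t)) + G (w t - w (Suc t))) \<le> A t * Fc (w t)"
      using growth(1)[OF t(2)] by (rule mult_left_mono)
    have "Fc (w (Suc t)) + G (x - w (Suc t)) \<le> l t x + \<phi>r x"
      using sf(4)[OF mem(4)] by (simp add: Fc_def G_def l_def)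
    then have e3: "a t * (Fc (w (Suc t)) + G (x - w (Suc t))) \<le> a t * (l t x + \<phi>r x)"
      using a[OF t(1)] by (intro mult_left_mono) auto
    have e4: "A (Suc t) * (\<kappa> / 2 * r powr s) \<le> A (Suc t) * G (\<eta> t - w (Suc t))"
      using sf(5) Apos by (intro mult_left_mono) (auto simp: G_def r_def)
    have "\<bar>G (x - v t)\<bar> \<le> 3 / 2 * \<kappa> * r powr (s - 1) * \<rho>"
      using sf(6)[of "x - v t"] memE by (simp add: G_def r_def \<rho>_def E_diff)
    then have e5: "- (a t * (3 / 2 * \<kappa> * r powr (s - 1) * \<rho>)) \<le> a t * G (x - v t)"
      using a[OF t(1)] mult_left_mono[of "- (3 / 2 * \<kappa> * r powr (s - 1) * \<rho>)" "G (x - v t)" "a t"] by simp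
    \<comment> \<open>The possible loss in e5 is covered by the gain of the step in e4 together with
      the growth term in e1.\<close>
    have e6: "a t * (3 / 2 * \<kappa> * r powr (s - 1) * \<rho>) \<le> A (Suc t) * (\<kappa> / 2 * r powr s) + 2 powr (2 - s) / s * \<rho> powr s"
      using a_eq[OF t(1)] a[OF t(1)] Apos \<kappa>_pos memE \<eta>E
      by (intro acceleration_inequality[OF p s(1,2)]) (auto simp: coef_def r_def \<rho>_def)
    have IH: "A t * Fc (w t) \<le> \<Psi> t (v t)" using Suc.IH t by simp
    have "A (Suc t) * Fc (w (Suc t)) = A t * Fc (w (Suc t)) + a t * Fc (w (Suc t))"
      by (simp add: A_Suc[OF t(1)] distrib_right)
    moreover have "\<Psi> (Suc t) x = \<Psi> t x + a t * (l t x + \<phi>r x)" by (simp add: \<Psi>_def R_def)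
    ultimately have "A (Suc t) * Fc (w (Suc t)) \<le> \<Psi> (Suc t) x"
      using e1 e2 e3 e4 e5 e6 IH Geq unfolding distrib_left by linarith
    then show ?case by (simp add: x_def)
  qed
  show ?thesis
  proof (intro conjI exI[of _ "A m"] ballI)
    show "w' \<in> D" using w_D w' by simp
    fix x assume x: "x \<in> D"
    have "A m * Fc (w m) \<le> \<Psi> m x" using main[of m] v_min[of m] x by fastforce
    also have "\<dots> \<le> 1 / s * N (x - w0) powr s + A m * Fc x" using R_le[OF _ x, of m] by (simp add: \<Psi>_def)
    finally show "A m * (Fc w' - Fc x) \<le> 1 / s * N (x - w0) powr s" by (simp add: w' algebra_simps)
  qed (use growth in auto)
qed

text \<open>The target 2^(s-1) / \<delta> is the weight A at which the rate |x - y|^s / (s A) is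
  half of the uniform convexity term \<delta> 2^(2-s) / s |x - y|^s. The restart length solves for
  it, as 1 - 3 p + (4 p + \<nu> - 2) = s - 1.\<close>

lemma alg6_m_bound: "2 powr (s - 1) / \<delta> \<le> coef * (real restart_length / s) powr s"
proof -
  define X where "X = 2 powr (4 * real p + \<nu> - 2) * s powr s * HR / (\<delta> * fact (p - 1))"
  have X: "0 < X" unfolding X_def using HR_pos \<delta> s(4) by (intro divide_pos_pos mult_pos_pos) auto
  have "X powr (1 / s) \<le> real restart_length"
    unfolding alg6_m_def X_def s_def[symmetric] by linarith
  then have "X powr (1 / s) / s \<le> real restart_length / s" using s(4) by (intro divide_right_mono) auto
  then have "(X powr (1 / s) / s) powr s \<le> (real restart_length / s) powr s" using s(4) by (intro powr_mono2) auto
  moreover have "(X powr (1 / s) / s) powr s = X / s powr s"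
    using X s(4) by (simp add: powr_divide powr_powr)
  ultimately have "coef * (X / s powr s) \<le> coef * (real restart_length / s) powr s"
    using coef_pos by (intro mult_left_mono) auto
  moreover have "coef * (X / s powr s) = 2 powr (s - 1) / \<delta>"
  proof -
    have "coef * (X / s powr s) = 2 powr (1 - 3 * real p) * 2 powr (4 * real p + \<nu> - 2) / \<delta>"
      using HR_pos s(4) p by (simp add: coef_def \<kappa>_def X_def fact_p)
    also have "(2::real) powr (1 - 3 * real p) * 2 powr (4 * real p + \<nu> - 2) = 2 powr (s - 1)"
    proof -
      have "1 - 3 * real p + (4 * real p + \<nu> - 2) = s - 1" by (simp add: s_def)
      then show ?thesis by (simp only: powr_add[symmetric])
    qed
    finally show ?thesis .
  qed
  ultimately show ?thesis by simp
qed

text \<open>Of the two growth terms at the intermediate point only the one towards z is kept. With z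
  the current iterate, x nearly optimal and l small, it bounds |x - z|^s by the gap of z.\<close>

lemma Fc_segment:
  assumes x: "x \<in> D" and z: "z \<in> D" and l: "0 \<le> l" "l \<le> 1"
  shows "Fc ((1 - l) *\<^sub>R x + l *\<^sub>R z) + l * (\<delta> * 2 powr (2 - s) / s * ((1 - l) powr s * N (x - z) powr s))
    \<le> (1 - l) * Fc x + l * Fc z"
proof -
  define u where "u = (1 - l) *\<^sub>R x + l *\<^sub>R z"
  define c where "c = \<delta> * 2 powr (2 - s) / s"
  have c: "0 \<le> c" using \<delta> s by (simp add: c_def)
  have uE: "u \<in> E" "x \<in> E" "z \<in> E" using x z D_E by (auto simp: u_def)
  have lin: "linear (grad E F u)" by (rule linear_grad[OF der_F[OF uE(1)]])
  have dx: "x - u = l *\<^sub>R (x - z)" and dz: "z - u = (1 - l) *\<^sub>R (z - x)" by (simp_all add: u_def algebra_simps)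
  have 1: "F u + grad E F u (x - u) + c * N (x - u) powr s \<le> F x"
    and 2: "F u + grad E F u (z - u) + c * N (z - u) powr s \<le> F z"
    using F_uniform_convex uE by (auto simp: c_def)
  have "F u + l * (- grad E F u (z - x)) \<le> F x"
  proof -
    have "grad E F u (x - u) = l * (- grad E F u (z - x))"
      using linear_cmul[OF lin, of l "x - z"] linear_neg[OF lin, of "z - x"] by (simp add: dx)
    moreover have "0 \<le> c * N (x - u) powr s" using c by simp
    ultimately show ?thesis using 1 by linarith
  qed
  then have a: "(1 - l) * (F u + l * (- grad E F u (z - x))) \<le> (1 - l) * F x" using l by (intro mult_left_mono) auto
  have "F u + (1 - l) * grad E F u (z - x) + c * ((1 - l) powr s * N (x - z) powr s) \<le> F z"
  proof -
    have "grad E F u (z - u) = (1 - l) * grad E F u (z - x)" unfolding dz by (simp only: linear_cmul[OF lin] real_scaleR_def)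
    moreover have "N (z - u) powr s = (1 - l) powr s * N (x - z) powr s"
      unfolding dz N_scale using l N_minus_commute[of z x] by (simp add: powr_mult)
    ultimately show ?thesis using 2 by simp
  qed
  then have b: "l * (F u + (1 - l) * grad E F u (z - x) + c * ((1 - l) powr s * N (x - z) powr s)) \<le> l * F z"
    using l by (intro mult_left_mono) auto
  have "F u + l * (c * ((1 - l) powr s * N (x - z) powr s)) \<le> (1 - l) * F x + l * F z"
    using a b by (simp add: algebra_simps)
  moreover have "\<phi>r u \<le> (1 - l) * \<phi>r x + l * \<phi>r z" unfolding u_def by (rule D_convex_\<phi>(2)[OF x z l])
  ultimately have "Fc u + l * (c * ((1 - l) powr s * N (x - z) powr s)) \<le> (1 - l) * Fc x + l * Fc z"
    by (simp add: Fc_def distrib_left)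
  then show ?thesis by (simp add: u_def c_def)
qed

end

section \<open>Restarts\<close>

locale composite_minimization = composite_problem +
  fixes xs :: 'a and S :: real
  assumes ri: "rel_interior (eff_dom E \<phi>) \<noteq> {}" and xs: "xs \<in> E"
    and xs_min: "\<And>x. x \<in> E \<Longrightarrow> composite f \<phi> xs \<le> composite f \<phi> x"
    and S: "composite f \<phi> x0 - composite f \<phi> xs \<le> ereal S"
begin

lemma composite_D: "x \<in> D \<Longrightarrow> composite f \<phi> x = ereal (f x + \<phi>r x)"
  by (simp add: composite_def \<phi>_real)

lemma xs_D: "xs \<in> D"
proof -
  obtain z where z: "z \<in> D" using ri unfolding rel_interior_def by blast
  have "composite f \<phi> xs \<le> ereal (f z + \<phi>r z)" using xs_min[OF D_E[OF z]] composite_D[OF z] by simp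
  then have "\<phi> xs \<noteq> \<infinity>" by (auto simp: composite_def)
  then show ?thesis using xs \<phi>_infty by blast
qed

text \<open>S is a real number, so the initial value cannot be infinite.\<close>

lemma x0_D: "x0 \<in> D"
proof (rule ccontr)
  assume "x0 \<notin> D"
  then have "composite f \<phi> x0 = \<infinity>" using \<phi>_infty[OF x0] by (simp add: composite_def)
  then show False using S composite_D[OF xs_D] by simp
qed

lemma xs_le: "x \<in> D \<Longrightarrow> f xs + \<phi>r xs \<le> f x + \<phi>r x"
  using xs_min[of x] composite_D xs_D D_E by simp

lemma S_bound: "f x0 + \<phi>r x0 - (f xs + \<phi>r xs) \<le> S"
  using S composite_D[OF xs_D] composite_D[OF x0_D] by simp

definition Finf :: real where "Finf = Inf (Fc ` D)"
definition gap :: "'a \<Rightarrow> real" where "gap x = Fc x - Finf"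

lemma Fc_ge: "x \<in> D \<Longrightarrow> f xs + \<phi>r xs \<le> Fc x"
proof -
  assume "x \<in> D"
  moreover have "0 \<le> \<delta> / s * N (x - x0) powr s" using \<delta> s(4) by simp
  ultimately show ?thesis using xs_le[of x] unfolding Fc_def F_eq by linarith
qed

lemma gap_nonneg: "x \<in> D \<Longrightarrow> 0 \<le> gap x"
proof -
  assume "x \<in> D"
  moreover have "bdd_below (Fc ` D)" using Fc_ge by (rule bdd_belowI2)
  ultimately show ?thesis unfolding gap_def Finf_def using cINF_lower[of Fc D x] by simp
qed

lemma near_minimizer: "0 < e \<Longrightarrow> \<exists>x\<in>D. Fc x \<le> Finf + e"
  using cInf_lessD[of "Fc ` D" "Finf + e"] xs_D unfolding Finf_def by force

lemma gap_x0: "gap x0 \<le> S"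
proof -
  have "f xs + \<phi>r xs \<le> Finf"
    unfolding Finf_def using xs_D Fc_ge by (intro cINF_greatest) auto
  then show ?thesis using S_bound s(4) by (simp add: gap_def Fc_def F_eq)
qed

text \<open>A point slightly off a near-minimizer x towards y still has value at least the infimum,
  so uniform convexity bounds |x - y|^s by the gap of y. The rate at the chosen restart length turns
  this into half the gap.\<close>

lemma alg5_halves_gap:
  assumes alg: "inner_run restart_length y y'" and y: "y \<in> D"
  shows "y' \<in> D" "gap y' \<le> gap y / 2"
proof -
  obtain A where A: "y' \<in> D" "0 \<le> A" "coef * (real restart_length / s) powr s \<le> A"
    "\<And>x. x \<in> D \<Longrightarrow> A * (Fc y' - Fc x) \<le> 1 / s * N (x - y) powr s"
    using alg5_rate[OF alg y] by blast
  show y': "y' \<in> D" by (rule A)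
  define c where "c = \<delta> * 2 powr (2 - s) / s"
  have c: "0 < c" using \<delta> s(4) by (simp add: c_def)
  have Ab: "2 powr (s - 1) / \<delta> \<le> A" using alg6_m_bound A(3) by linarith
  show "gap y' \<le> gap y / 2"
  proof (rule halving_limit)
    fix l :: real assume l: "0 < l" "l < 1"
    \<comment> \<open>The tolerance is l^2 because the segment inequality is divided by l afterwards
      and the error has to vanish still.\<close>
    obtain x where x: "x \<in> D" "Fc x \<le> Finf + l\<^sup>2" using near_minimizer[of "l\<^sup>2"] l by auto
    have "Finf \<le> Fc ((1 - l) *\<^sub>R x + l *\<^sub>R y)"
      using gap_nonneg[OF D_convex_\<phi>(1)[OF x(1) y, of l]] l by (simp add: gap_def)
    then have "Finf + l * (c * ((1 - l) powr s * N (x - y) powr s)) \<le> (1 - l) * Fc x + l * Fc y"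
      using Fc_segment[OF x(1) y, of l] l by (simp add: c_def)
    also have "\<dots> \<le> (1 - l) * (Finf + l\<^sup>2) + l * Fc y" using x(2) l by (intro add_mono mult_left_mono) auto
    also have "\<dots> \<le> Finf + l * (l + gap y)" using l by (simp add: gap_def power2_eq_square algebra_simps)
    finally have "c * ((1 - l) powr s * N (x - y) powr s) \<le> l + gap y" using l by simp
    then have near: "c * N (x - y) powr s \<le> (l + gap y) / (1 - l) powr s"
      using l by (simp add: pos_le_divide_eq mult_ac)
    have nn: "0 \<le> (l + gap y) / (1 - l) powr s / 2" using gap_nonneg[OF y] l by simp
    have "Fc y' - Fc x \<le> (l + gap y) / (1 - l) powr s / 2"
    \<comment> \<open>A is known only from below, so it may be replaced by its bound only in front
      of a nonnegative difference.\<close>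
    proof (cases "Fc y' - Fc x \<le> 0")
      case False
      have "2 powr (s - 1) / \<delta> * (Fc y' - Fc x) \<le> 1 / s * N (x - y) powr s"
        using mult_right_mono[OF Ab, of "Fc y' - Fc x"] A(4)[OF x(1)] False by linarith
      moreover have "1 / s = 2 powr (s - 1) / \<delta> * (c / 2)"
      proof -
        have "(2::real) powr (s - 1) * 2 powr (2 - s) = 2" by (simp add: powr_add[symmetric])
        then show ?thesis using \<delta> s(4) by (simp add: c_def)
      qed
      ultimately have "2 powr (s - 1) / \<delta> * (Fc y' - Fc x) \<le> 2 powr (s - 1) / \<delta> * (c / 2 * N (x - y) powr s)"
        by (simp only: mult.assoc)
      moreover have "0 < 2 powr (s - 1) / \<delta>" using \<delta> by simp
      ultimately have "Fc y' - Fc x \<le> c / 2 * N (x - y) powr s" by (simp only: mult_le_cancel_left_pos)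
      also have "\<dots> = c * N (x - y) powr s / 2" by simp
      also have "\<dots> \<le> (l + gap y) / (1 - l) powr s / 2" using near by (rule divide_right_mono) simp
      finally show ?thesis .
    qed (use nn in linarith)
    then show "gap y' \<le> (l + gap y) / (1 - l) powr s / 2 + l\<^sup>2" using x(2) by (simp add: gap_def)
  qed
qed

text \<open>The decrease \<kappa> / 2 r^s of the step cannot exceed the gap of y, which bounds the
  step length r; the gradient bound is a power of r.\<close>

lemma step_gradient_bound:
  assumes st: "tensor_step y x g" and y: "y \<in> D"
  shows "x \<in> D" "gap x \<le> gap y" "dual_nrm E B (\<lambda>h. grad E F x h + g h) \<le> 3 / 2 * \<kappa> * (2 * gap y / \<kappa>) powr ((s - 1) / s)"
proof -
  note sf = step_facts[OF st D_E[OF y]]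
  show x: "x \<in> D" by (rule sf(1))
  define r where "r = N (x - y)"
  have r: "0 \<le> r" using x y D_E by (simp add: r_def E_diff)
  have "F x + grad E F x (y - x) \<le> F y" using x y D_E by (intro F_tangent) auto
  then have dec: "\<kappa> / 2 * r powr s \<le> Fc y - Fc x"
    using sf(4)[OF y] sf(5) by (simp add: Fc_def r_def)
  moreover have "0 \<le> \<kappa> / 2 * r powr s" using \<kappa>_pos by simp
  ultimately show "gap x \<le> gap y" by (simp add: gap_def)
  have "\<kappa> / 2 * r powr s \<le> gap y" using dec gap_nonneg[OF x] by (simp add: gap_def)
  then have "r powr s \<le> 2 * gap y / \<kappa>" using \<kappa>_pos by (simp add: field_simps)
  then have "(r powr s) powr ((s - 1) / s) \<le> (2 * gap y / \<kappa>) powr ((s - 1) / s)"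
    using s by (intro powr_mono2) auto
  then have rb: "r powr (s - 1) \<le> (2 * gap y / \<kappa>) powr ((s - 1) / s)" using s(4) by (simp add: powr_powr)
  have "dual_nrm E B (\<lambda>h. grad E F x h + g h) \<le> 3 / 2 * \<kappa> * r powr (s - 1)"
  proof (rule dual_nrm_le[OF sf(3)])
    show "0 \<le> 3 / 2 * \<kappa> * r powr (s - 1)" using \<kappa>_pos by simp
    show "grad E F x h + g h \<le> 3 / 2 * \<kappa> * r powr (s - 1) * N h" if "h \<in> E" for h
      unfolding r_def by (rule order_trans[OF abs_ge_self sf(6)[OF that]])
  qed
  also have "\<dots> \<le> 3 / 2 * \<kappa> * (2 * gap y / \<kappa>) powr ((s - 1) / s)"
    using rb \<kappa>_pos by (intro mult_left_mono) auto
  finally show "dual_nrm E B (\<lambda>h. grad E F x h + g h) \<le> 3 / 2 * \<kappa> * (2 * gap y / \<kappa>) powr ((s - 1) / s)" .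
qed

text \<open>The distance to the centre x0 is controlled by values alone: F does not exceed its value
  at x0, whereas the unregularized objective drops by at most S, so \<delta> / s |x - x0|^s <= S.
  The gradient of the regularizer has norm \<delta> |x - x0|^(s-1).\<close>

lemma regularization_bias:
  assumes st: "tensor_step y x g" and y: "y \<in> D" "gap y \<le> gap x0"
  shows "dual_nrm E B (\<lambda>h. grad E f x h + g h)
    \<le> dual_nrm E B (\<lambda>h. grad E F x h + g h) + \<delta> powr (1 / s) * (s * S) powr ((s - 1) / s)"
proof -
  note sf = step_facts[OF st D_E[OF y(1)]]
  note sg = step_gradient_bound[OF st y(1)]
  have xE: "x \<in> E" using sg(1) D_E by blast
  have dE: "x - x0 \<in> E" using xE x0 by auto
  define \<rho> where "\<rho> = N (x - x0)"
  have \<rho>: "0 \<le> \<rho>" using dE by (simp add: \<rho>_def)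
  have "Fc x \<le> Fc x0" using sg(2) y(2) by (simp add: gap_def)
  also have "Fc x0 = f x0 + \<phi>r x0" using s(4) by (simp add: Fc_def F_eq)
  also have "\<dots> \<le> f x + \<phi>r x + S" using S_bound xs_le[OF sg(1)] by linarith
  finally have "\<delta> / s * \<rho> powr s \<le> S" by (simp add: Fc_def F_eq \<rho>_def)
  then have "\<rho> powr s \<le> s * S / \<delta>" using \<delta> s(4) by (simp add: field_simps)
  then have "(\<rho> powr s) powr ((s - 1) / s) \<le> (s * S / \<delta>) powr ((s - 1) / s)"
    using s by (intro powr_mono2) auto
  then have "\<delta> * \<rho> powr (s - 1) \<le> \<delta> * (s * S / \<delta>) powr ((s - 1) / s)"
    using s(4) \<delta> by (intro mult_left_mono) (auto simp: powr_powr)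
  also have "\<dots> = \<delta> powr (1 / s) * (s * S) powr ((s - 1) / s)"
  proof -
    have "1 - (s - 1) / s = 1 / s" using s(4) by (simp add: field_simps)
    then have "\<delta> / \<delta> powr ((s - 1) / s) = \<delta> powr (1 / s)" using \<delta> powr_diff[of \<delta> 1 "(s - 1) / s"] by simp
    then show ?thesis unfolding powr_divide
      by (metis times_divide_eq_left times_divide_eq_right)
  qed
  finally have bias: "\<delta> * \<rho> powr (s - 1) \<le> \<delta> powr (1 / s) * (s * S) powr ((s - 1) / s)" .
  have lin: "linear (\<lambda>h. grad E f x h + g h)" by (intro linear_compose_add linear_grad[OF der_f[OF xE]] sf(2))
  show ?thesis
  proof (rule dual_nrm_le[OF lin])
    show "0 \<le> dual_nrm E B (\<lambda>h. grad E F x h + g h) + \<delta> powr (1 / s) * (s * S) powr ((s - 1) / s)"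
      using dual_nrm_nonneg[OF sf(3)] by (intro add_nonneg_nonneg) auto
    fix h assume h: "h \<in> E"
    have "grad E f x h + g h = (grad E F x h + g h) - \<delta> * (N (x - x0) powr (s - 2) * B (x - x0) h)"
      using grad_F[OF xE h] by simp
    also have "\<dots> \<le> dual_nrm E B (\<lambda>h. grad E F x h + g h) * N h + \<delta> * (\<rho> powr (s - 1) * N h)"
    proof -
      have "\<delta> * (- (N (x - x0) powr (s - 2) * B (x - x0) h)) \<le> \<delta> * (\<rho> powr (s - 1) * N h)"
        using B_bound[OF dE h] \<delta> by (intro mult_left_mono) (auto simp: \<rho>_def abs_le_iff)
      then show ?thesis using dual_nrm_bound[OF sf(3) h] by (simp add: abs_le_iff)
    qed
    also have "\<delta> * (\<rho> powr (s - 1) * N h) \<le> \<delta> powr (1 / s) * (s * S) powr ((s - 1) / s) * N h"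
      using mult_right_mono[OF bias, of "N h"] h by (simp add: mult.assoc)
    finally show "grad E f x h + g h \<le> (dual_nrm E B (\<lambda>h. grad E F x h + g h) + \<delta> powr (1 / s) * (s * S) powr ((s - 1) / s)) * N h"
      by (simp add: distrib_right)
  qed
qed

end

section \<open>Counting iterations\<close>

text \<open>With a = log S and b = log (1/\<epsilon>) the rounds are of order (q a + b) / q and the
  target logarithm is a + q b; both are comparable to a + b because 0 < q <= 1. The assumption S /
  \<epsilon> >= 2 gives a + b >= 1, which absorbs the additive constants.\<close>

lemma iteration_count:
  fixes q S \<epsilon> T m c1 c :: real
  assumes q: "0 < q" "q \<le> 1" and S: "1 \<le> S" and \<epsilon>: "0 < \<epsilon>" "\<epsilon> < 1" and large: "2 \<le> S / \<epsilon>" and c1: "1 \<le> c1"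
    and T: "0 \<le> T" "T \<le> 2 + log 2 (c1 * (S powr q / \<epsilon>)) / q" and m: "0 \<le> m" "m \<le> c * (S powr q / \<epsilon>)" and c: "0 \<le> c"
  shows "T * m \<le> ((2 + log 2 c1 / q) / q + 1 / q\<^sup>2) * c * (log 2 (S / \<epsilon> powr q) * (S powr q / \<epsilon>))"
proof -
  define a where "a = log 2 S"
  define b where "b = - log 2 \<epsilon>"
  define \<Lambda> where "\<Lambda> = log 2 (S / \<epsilon> powr q)"
  define k where "k = 2 + log 2 c1 / q"
  have a: "0 \<le> a" using S by (simp add: a_def)
  have b: "0 \<le> b" using \<epsilon> by (simp add: b_def)
  have k: "0 \<le> k" using c1 q by (simp add: k_def)
  have \<Lambda>: "\<Lambda> = a + q * b" using S \<epsilon> by (simp add: \<Lambda>_def a_def b_def log_divide log_powr)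
  have "log 2 2 \<le> log 2 (S / \<epsilon>)" using large S \<epsilon> by (subst log_le_cancel_iff) auto
  then have ab: "1 \<le> a + b" using S \<epsilon> by (simp add: a_def b_def log_divide)
  have "q * a \<le> 1 * a" using q a by (intro mult_right_mono) auto
  then have qab: "q * (a + b) \<le> \<Lambda>" by (simp add: \<Lambda> distrib_left)
  have L1: "1 \<le> \<Lambda> / q"
  proof -
    have "q * 1 \<le> q * (a + b)" using ab q by (intro mult_left_mono) auto
    then show ?thesis using qab q by (simp add: field_simps)
  qed
  have "T \<le> 2 + (log 2 c1 + (q * a + b)) / q"
    using T(2) S \<epsilon> c1 by (simp add: log_mult log_divide log_powr a_def b_def add_diff_eq)
  also have "\<dots> = k + (q * a + b) / q" by (simp add: k_def add_divide_distrib)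
  also have "k \<le> k * (\<Lambda> / q)" using mult_left_mono[OF L1 k] by simp
  also have "(q * a + b) / q \<le> \<Lambda> / q / q"
  proof -
    have "q * a + b \<le> a + b" using \<open>q * a \<le> 1 * a\<close> by simp
    also have "a + b \<le> \<Lambda> / q" using qab q by (simp add: field_simps)
    finally show ?thesis using q by (intro divide_right_mono) auto
  qed
  finally have "T \<le> (k / q + 1 / q\<^sup>2) * \<Lambda>" by (simp add: distrib_right power2_eq_square add.commute)
  moreover have "0 \<le> c * (S powr q / \<epsilon>)" using c S \<epsilon> by simp
  ultimately have "T * m \<le> ((k / q + 1 / q\<^sup>2) * \<Lambda>) * (c * (S powr q / \<epsilon>))"
    using T(1) m by (intro mult_mono) auto
  then show ?thesis by (simp add: k_def \<Lambda>_def mult_ac)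
qed

text \<open>What the count takes from the choice of \<delta>: \<delta> <= 1 removes it from the
  problem constants, the third claim is the admissible bias, the fourth puts \<delta>^(-1/s) at
  order S^q / \<epsilon>, and the last lets additive constants be absorbed into that order.\<close>

lemma delta_choice_facts:
  fixes p :: nat and S \<epsilon> \<nu> :: real
  defines "s \<equiv> real p + \<nu>"
  defines "q \<equiv> (s - 1) / s"
  assumes p: "2 \<le> p" and \<nu>: "0 \<le> \<nu>" and S: "1 \<le> S" and \<epsilon>: "0 < \<epsilon>" "\<epsilon> < 1"
  shows "0 < delta_choice p \<nu> S \<epsilon>" "delta_choice p \<nu> S \<epsilon> \<le> 1"
    "delta_choice p \<nu> S \<epsilon> powr (1 / s) * (s * S) powr q \<le> \<epsilon> / 2"
    "delta_choice p \<nu> S \<epsilon> powr (- (1 / s)) = 2 powr s * (2 powr (s - 2) * s) powr q * (S powr q / \<epsilon>)"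
    "1 \<le> 2 powr s * (2 powr (s - 2) * s) powr q * (S powr q / \<epsilon>)"
proof -
  have s: "2 \<le> s" using p \<nu> by (simp add: s_def)
  have q: "0 \<le> q" using s by (simp add: q_def)
  define W where "W = 2 powr (s - 2) * s * S"
  define d where "d = \<epsilon> / (2 powr s * W powr q)"
  have dc: "delta_choice p \<nu> S \<epsilon> = d powr s"
    by (simp add: delta_choice_def d_def W_def s_def q_def)
  have two: "1 \<le> (2::real) powr (s - 2)" using s by (intro ge_one_powr_ge_zero) auto
  have sS: "1 \<le> s * S" using s S mult_mono[of 1 s 1 S] by simp
  have W: "s * S \<le> W" "1 \<le> W"
    using mult_right_mono[OF two, of "s * S"] sS by (auto simp: W_def mult.assoc)
  have Wq: "1 \<le> W powr q" using W q by (intro ge_one_powr_ge_zero) auto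
  have two_s: "2 \<le> (2::real) powr s" using s powr_mono[of 1 s "2::real"] by simp
  have prod: "2 \<le> 2 powr s * W powr q" using mult_mono[OF two_s Wq] by simp
  have d: "0 < d" "d \<le> 1" using \<epsilon> prod by (auto simp: d_def)
  have droot: "(d powr s) powr (1 / s) = d" using d s by (simp add: powr_powr)
  show "0 < delta_choice p \<nu> S \<epsilon>" using d by (simp add: dc)
  show "delta_choice p \<nu> S \<epsilon> \<le> 1" using d s by (simp add: dc powr_le1)
  show "delta_choice p \<nu> S \<epsilon> powr (1 / s) * (s * S) powr q \<le> \<epsilon> / 2"
  proof -
    have "(s * S) powr q \<le> W powr q" using W sS q by (intro powr_mono2) auto
    then have "d * (s * S) powr q \<le> d * W powr q" using d by (intro mult_left_mono) auto
    also have "\<dots> = \<epsilon> / 2 powr s" using W(2) by (simp add: d_def)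
    also have "\<dots> \<le> \<epsilon> / 2" using two_s \<epsilon> by (intro divide_left_mono) auto
    finally show ?thesis by (simp add: dc droot)
  qed
  have inv: "(d powr s) powr (- (1 / s)) = 1 / d" using droot by (simp add: powr_minus_divide)
  have W_eq: "W powr q = (2 powr (s - 2) * s) powr q * S powr q"
    unfolding W_def by (simp only: powr_mult)
  show eq: "delta_choice p \<nu> S \<epsilon> powr (- (1 / s)) = 2 powr s * (2 powr (s - 2) * s) powr q * (S powr q / \<epsilon>)"
    unfolding dc inv using \<epsilon> by (simp add: d_def W_eq)
  have "1 \<le> 1 / d" using d by simp
  then show "1 \<le> 2 powr s * (2 powr (s - 2) * s) powr q * (S powr q / \<epsilon>)"
    using eq unfolding dc inv by simp
qed

context composite_problem
begin

lemma HF_le: "\<delta> \<le> 1 \<Longrightarrow> HF \<le> H + C_const p \<nu>"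
proof -
  assume "\<delta> \<le> 1"
  then have "\<delta> / s \<le> 1" using s by simp
  then show ?thesis using C_pos mult_right_mono[of "\<delta> / s" 1 "C_const p \<nu>"] by (simp add: HF_eq)
qed

lemma \<kappa>_le: assumes "\<delta> \<le> 1" shows "\<kappa> \<le> s * ((H + C_const p \<nu>) / fact (p - 1) + 3 * \<theta>)"
  unfolding \<kappa>_eq using HF_le[OF assms] s(5) by (intro mult_left_mono add_mono divide_right_mono) auto

lemma alg6_m_le:
  assumes "\<delta> \<le> 1"
  shows "real restart_length \<le> 2 + (2 powr (4 * real p + \<nu> - 2) * s powr s *
    (real p * (H + C_const p \<nu> + 3 * \<theta> * fact (p - 1))) / fact (p - 1)) powr (1 / s) * \<delta> powr (- (1 / s))"
proof -
  define X where "X = 2 powr (4 * real p + \<nu> - 2) * s powr s * HR / (\<delta> * fact (p - 1))"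
  define Z where "Z = 2 powr (4 * real p + \<nu> - 2) * s powr s * (real p * (H + C_const p \<nu> + 3 * \<theta> * fact (p - 1))) / fact (p - 1)"
  have X0: "0 \<le> X" unfolding X_def using HR_pos \<delta> by (intro divide_nonneg_nonneg mult_nonneg_nonneg) auto
  have "HR \<le> real p * (H + C_const p \<nu> + 3 * \<theta> * fact (p - 1))"
    unfolding H_reg_def using HF_le[OF assms] by (intro mult_left_mono) auto
  then have "2 powr (4 * real p + \<nu> - 2) * s powr s * HR / fact (p - 1) \<le> Z"
    unfolding Z_def by (intro divide_right_mono mult_left_mono) auto
  then have "2 powr (4 * real p + \<nu> - 2) * s powr s * HR / fact (p - 1) / \<delta> \<le> Z / \<delta>"
    using \<delta> by (intro divide_right_mono) auto
  then have "X \<le> Z / \<delta>" by (simp add: X_def mult.commute)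
  then have "X powr (1 / s) \<le> (Z / \<delta>) powr (1 / s)" using X0 s by (intro powr_mono2) auto
  also have "\<dots> = Z powr (1 / s) * \<delta> powr (- (1 / s))" by (simp add: powr_divide powr_minus_divide)
  finally have "X powr (1 / s) \<le> Z powr (1 / s) * \<delta> powr (- (1 / s))" .
  \<comment> \<open>One unit is the leading 1 in the restart length, the other pays for the
    ceiling.\<close>
  moreover have "real restart_length \<le> 2 + X powr (1 / s)"
    unfolding alg6_m_def X_def s_def[symmetric] using powr_ge_zero[of X "1 / s", unfolded X_def] by linarith
  ultimately show ?thesis unfolding Z_def by linarith
qed

end

context composite_minimization
begin

text \<open>A run is unconstrained once a test has succeeded, so only indices before k are assumed
  not to stop. Round k itself may stop, which is how the accuracy claim uses it.\<close>

lemma alg6_rounds: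
  assumes run: "outer_run \<epsilon> y u g"
  shows "(\<forall>j<k. \<not> stop_test \<epsilon> u g j) \<Longrightarrow>
    y k \<in> D \<and> gap (y k) \<le> gap x0 / 2 ^ k \<and> (0 < k \<longrightarrow> tensor_step (y k) (u k) (g k))"
proof (induction k)
  case 0
  have "y 0 = x0" using run by (simp add: alg6_run_def)
  then show ?case using x0_D by simp
next
  case (Suc k)
  then have IH: "y k \<in> D" "gap (y k) \<le> gap x0 / 2 ^ k" by auto
  have "inner_run restart_length (y k) (y (Suc k))"
    "tensor_step (y (Suc k)) (u (Suc k)) (g (Suc k))"
    using run Suc.prems by (auto simp: alg6_run_def)
  with alg5_halves_gap[OF this(1) IH(1)] IH(2) show ?case by auto
qed

lemma alg6_stops:
  assumes run: "outer_run \<epsilon> y u g" and K: "0 < K"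
    and small: "3 / 2 * \<kappa> * (2 * (S / 2 ^ K) / \<kappa>) powr ((s - 1) / s) \<le> \<epsilon> / 2"
  shows "\<exists>T\<le>K. stops_at \<epsilon> u g T"
proof -
  let ?P = "stop_test \<epsilon> u g"
  have "\<exists>j\<le>K. ?P j"
  proof (rule ccontr)
    assume contra: "\<not> (\<exists>j\<le>K. ?P j)"
    then have y: "y K \<in> D" "gap (y K) \<le> gap x0 / 2 ^ K" "tensor_step (y K) (u K) (g K)"
      using alg6_rounds[OF run, of K] K by auto
    have "gap (y K) \<le> S / 2 ^ K"
      using y(2) divide_right_mono[OF gap_x0, of "2 ^ K"] by simp
    then have "(2 * gap (y K) / \<kappa>) powr ((s - 1) / s) \<le> (2 * (S / 2 ^ K) / \<kappa>) powr ((s - 1) / s)"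
      using gap_nonneg[OF y(1)] \<kappa>_pos s by (intro powr_mono2 divide_right_mono) auto
    then have "3 / 2 * \<kappa> * (2 * gap (y K) / \<kappa>) powr ((s - 1) / s) \<le> 3 / 2 * \<kappa> * (2 * (S / 2 ^ K) / \<kappa>) powr ((s - 1) / s)"
      using \<kappa>_pos by (intro mult_left_mono) auto
    then have "?P K"
      using step_gradient_bound(3)[OF y(3,1)] small K unfolding alg6_stop_def by linarith
    with contra show False by blast
  qed
  then obtain j where j: "j \<le> K" "?P j" by blast
  have "stops_at \<epsilon> u g (LEAST j. ?P j)"
    unfolding alg6_stops_at_def using LeastI[of ?P, OF j(2)] not_less_Least[of _ ?P] by blast
  moreover have "(LEAST j. ?P j) \<le> K" using Least_le[of ?P, OF j(2)] j(1) by simp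
  ultimately show ?thesis by blast
qed

lemma alg6_accuracy:
  assumes run: "outer_run \<epsilon> y u g"
    and T: "stops_at \<epsilon> u g T"
    and bias: "\<delta> powr (1 / s) * (s * S) powr ((s - 1) / s) \<le> \<epsilon> / 2"
  shows "dual_nrm E B (\<lambda>h. grad E f (u T) h + g T h) \<le> \<epsilon>"
proof -
  have stop: "0 < T" "dual_nrm E B (\<lambda>h. grad E F (u T) h + g T h) \<le> \<epsilon> / 2"
    and "\<forall>j<T. \<not> stop_test \<epsilon> u g j"
    using T by (auto simp: alg6_stops_at_def alg6_stop_def)
  with alg6_rounds[OF run] have y: "y T \<in> D" "gap (y T) \<le> gap x0 / 2 ^ T"
    "tensor_step (y T) (u T) (g T)" by auto
  have "gap x0 / 2 ^ T \<le> gap x0 / 1"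
    using gap_nonneg[OF x0_D] by (intro divide_left_mono) auto
  then have "gap (y T) \<le> gap x0" using y(2) by simp
  from regularization_bias[OF y(3,1) this] stop(2) bias show ?thesis by linarith
qed

text \<open>Solves the stopping condition for K: since \<kappa> / \<kappa>^q = \<kappa>^(1/s), it
  amounts to 2^(K q) >= c1 S^q / \<epsilon>.\<close>

lemma enough_rounds:
  assumes S1: "1 \<le> S" and \<epsilon>: "0 < \<epsilon>" and c1: "3 * \<kappa> powr (1 / s) * 2 powr ((s - 1) / s) \<le> c1"
    and K: "log 2 (c1 * (S powr ((s - 1) / s) / \<epsilon>)) / ((s - 1) / s) \<le> real K"
  shows "3 / 2 * \<kappa> * (2 * (S / 2 ^ K) / \<kappa>) powr ((s - 1) / s) \<le> \<epsilon> / 2"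
proof -
  define q where "q = (s - 1) / s"
  have q: "0 < q" "1 - q = 1 / s" using s by (auto simp: q_def field_simps)
  have c1_pos: "0 < c1" using c1 \<kappa>_pos by (intro less_le_trans[OF _ c1]) simp
  have k: "\<kappa> / \<kappa> powr q = \<kappa> powr (1 / s)" using \<kappa>_pos powr_diff[of \<kappa> 1 q] by (simp add: q(2))
  have P: "(2 ^ K) powr q = 2 powr (real K * q)" by (simp add: powr_powr flip: powr_realpow)
  have "3 / 2 * \<kappa> * (2 * (S / 2 ^ K) / \<kappa>) powr q = (3 * (\<kappa> / \<kappa> powr q) * 2 powr q) * S powr q / 2 / 2 powr (real K * q)"
    using S1 \<kappa>_pos by (simp add: powr_divide powr_mult P mult_ac)
  also have "\<dots> \<le> c1 * S powr q / 2 / 2 powr (real K * q)"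
    unfolding k using c1 by (intro divide_right_mono mult_right_mono) (auto simp: q_def)
  also have "\<dots> \<le> \<epsilon> / 2"
  proof -
    have "log 2 (c1 * (S powr q / \<epsilon>)) \<le> real K * q" using K q(1) by (simp add: q_def[symmetric] pos_divide_le_eq)
    then have "2 powr (log 2 (c1 * (S powr q / \<epsilon>))) \<le> 2 powr (real K * q)" by (rule powr_mono) simp
    moreover have "0 < c1 * (S powr q / \<epsilon>)" using c1_pos S1 \<epsilon> by simp
    moreover have "2 powr (log 2 (c1 * (S powr q / \<epsilon>))) = c1 * (S powr q / \<epsilon>)"
      using calculation(2) by (intro powr_log_cancel) auto
    ultimately have "c1 * (S powr q / \<epsilon>) \<le> 2 powr (real K * q)" by (simp only:)
    then show ?thesis using \<epsilon> by (simp add: field_simps)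
  qed
  finally show ?thesis by (simp only: q_def)
qed

end

theorem corollary5p10:
  fixes p :: nat and \<nu> H \<theta> :: real
  assumes "2 \<le> p" and "0 \<le> \<nu>" and "\<nu> \<le> 1" and "0 \<le> H" and "0 \<le> \<theta>"
  shows "\<exists>C R. 0 < C \<and> 0 < R \<and>
    (\<forall>(E :: 'a::real_inner set) B f \<phi> x0 xs S \<epsilon> y u g.
       let \<delta> = delta_choice p \<nu> S \<epsilon>; q = (real p + \<nu> - 1) / (real p + \<nu>) in
       finite_dim_subspace E \<longrightarrow> pos_def_operator E B \<longrightarrow>
       convex_on E f \<longrightarrow> times_differentiable E p f \<longrightarrow> holder E B f p \<nu> = ennreal H \<longrightarrow>
       closed_convex_fun E \<phi> \<longrightarrow> rel_interior (eff_dom E \<phi>) \<noteq> {} \<longrightarrow>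
       x0 \<in> E \<longrightarrow>
       xs \<in> E \<longrightarrow> (\<forall>x\<in>E. composite f \<phi> xs \<le> composite f \<phi> x) \<longrightarrow>
       composite f \<phi> x0 - composite f \<phi> xs \<le> ereal S \<longrightarrow> 1 \<le> S \<longrightarrow>
       0 < \<epsilon> \<longrightarrow> \<epsilon> < 1 \<longrightarrow>
       alg6_run E B f \<phi> p \<nu> \<theta> \<delta> x0 \<epsilon> y u g \<longrightarrow>
       (\<exists>T. alg6_stops_at E B f p \<nu> \<delta> x0 \<epsilon> u g T
          \<and> dual_nrm E B (\<lambda>h. grad E f (u T) h + g T h) \<le> \<epsilon>
          \<and> (R \<le> S / \<epsilon> \<longrightarrow>
               real (alg5_iterations E B f p \<nu> \<theta> \<delta> T)
                 \<le> C * (log 2 (S / \<epsilon> powr q) * (S powr q / \<epsilon>)))))"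
proof -
  define s where s_eq: "s = real p + \<nu>"
  define q where "q = (s - 1) / s"
  \<comment> \<open>km bounds \<kappa> for every \<delta> <= 1, c1 governs the number of rounds, and
    c2 c3 the restart length. All depend on p, \<nu>, H and \<theta> only and can be fixed before
    the problem is given.\<close>
  define km where "km = s * ((H + C_const p \<nu>) / fact (p - 1) + 3 * \<theta>)"
  define c1 where "c1 = max 1 (3 * km powr (1 / s) * 2 powr q)"
  define c2 where "c2 = (2 powr (4 * real p + \<nu> - 2) * s powr s *
    (real p * (H + C_const p \<nu> + 3 * \<theta> * fact (p - 1))) / fact (p - 1)) powr (1 / s)"
  define c3 where "c3 = 2 powr s * (2 powr (s - 2) * s) powr q"
  define C where "C = ((2 + log 2 c1 / q) / q + 1 / q\<^sup>2) * ((2 + c2) * c3)"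
  have s2: "2 \<le> s" using assms by (simp add: s_eq)
  have q: "0 < q" "q \<le> 1" using s2 by (auto simp: q_def)
  have c1: "1 \<le> c1" by (simp add: c1_def)
  have c2: "0 \<le> c2" by (simp add: c2_def)
  have c3: "0 < c3" using s2 by (simp add: c3_def)
  have "0 < (2 + log 2 c1 / q) / q + 1 / q\<^sup>2"
    using q c1 by (intro add_pos_pos divide_pos_pos add_pos_nonneg divide_nonneg_pos) auto
  then have C: "0 < C" unfolding C_def using c2 c3 by (intro mult_pos_pos) auto
  show ?thesis
  \<comment> \<open>R = 2 is the threshold at which the binary logarithm of S / \<epsilon> reaches
    1.\<close>
  proof (rule exI[of _ C], rule exI[of _ "2::real"], intro conjI C zero_less_numeral allI, unfold Let_def s_eq[symmetric] q_def[symmetric], intro impI)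
    fix E :: "'a set" and B f \<phi> x0 xs S \<epsilon> y u g
    let ?\<delta> = "delta_choice p \<nu> S \<epsilon>"
    assume hyp: "finite_dim_subspace E" "pos_def_operator E B" "convex_on E f" "times_differentiable E p f"
      "holder E B f p \<nu> = ennreal H" "closed_convex_fun E \<phi>" "rel_interior (eff_dom E \<phi>) \<noteq> {}"
      "x0 \<in> E" "xs \<in> E" "\<forall>x\<in>E. composite f \<phi> xs \<le> composite f \<phi> x"
      "composite f \<phi> x0 - composite f \<phi> xs \<le> ereal S"
    assume S1: "1 \<le> S" and \<epsilon>: "0 < \<epsilon>" "\<epsilon> < 1" and run: "alg6_run E B f \<phi> p \<nu> \<theta> ?\<delta> x0 \<epsilon> y u g"
    note df = delta_choice_facts[OF assms(1,2) S1 \<epsilon>, folded s_eq, folded q_def]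
    interpret composite_minimization E B f \<phi> p \<nu> \<theta> ?\<delta> H x0 xs S
      by unfold_locales (use assms hyp df(1) in auto)
    have s_locale: "composite_problem.s p \<nu> = s" unfolding s_def s_eq ..
    \<comment> \<open>The leading 1 keeps K positive even when the logarithm vanishes, since the
      test can succeed only at a positive counter.\<close>
    define K where "K = 1 + nat \<lceil>log 2 (c1 * (S powr q / \<epsilon>)) / q\<rceil>"
    have c1_\<kappa>: "3 * \<kappa> powr (1 / s) * 2 powr q \<le> c1"
    proof -
      have "\<kappa> \<le> km" using \<kappa>_le[OF df(2)] unfolding s_locale km_def .
      then have "3 * \<kappa> powr (1 / s) * 2 powr q \<le> 3 * km powr (1 / s) * 2 powr q"
        using \<kappa>_pos s2 by (intro mult_right_mono mult_left_mono powr_mono2) auto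
      then show ?thesis unfolding c1_def by (rule max.coboundedI2)
    qed
    have arg1: "0 \<le> log 2 (c1 * (S powr q / \<epsilon>)) / q"
    proof -
      have "1 \<le> S powr q" using S1 q by (intro ge_one_powr_ge_zero) auto
      then have "1 \<le> S powr q / \<epsilon>" using \<epsilon> by simp
      then have "1 \<le> c1 * (S powr q / \<epsilon>)" using c1 mult_mono[of 1 c1 1 "S powr q / \<epsilon>"] by simp
      then show ?thesis using q by simp
    qed
    have K: "0 < K" "log 2 (c1 * (S powr q / \<epsilon>)) / q \<le> real K" "real K \<le> 2 + log 2 (c1 * (S powr q / \<epsilon>)) / q"
      using arg1 unfolding K_def by linarith+
    have "3 / 2 * \<kappa> * (2 * (S / 2 ^ K) / \<kappa>) powr q \<le> \<epsilon> / 2"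
      using enough_rounds[OF S1 \<epsilon>(1), unfolded s_locale, folded q_def, OF c1_\<kappa> K(2)] .
    then obtain T where T: "T \<le> K" "alg6_stops_at E B f p \<nu> ?\<delta> x0 \<epsilon> u g T"
      using alg6_stops[OF run K(1), unfolded s_locale, folded q_def] by blast
    have acc: "dual_nrm E B (\<lambda>h. grad E f (u T) h + g T h) \<le> \<epsilon>"
      using alg6_accuracy[OF run T(2), unfolded s_locale, folded q_def] df(3) by blast
    have "real (alg5_iterations E B f p \<nu> \<theta> ?\<delta> T) \<le> C * (log 2 (S / \<epsilon> powr q) * (S powr q / \<epsilon>))" if "2 \<le> S / \<epsilon>"
    proof -
      have "real (alg6_m E B f p \<nu> \<theta> ?\<delta>) \<le> 2 + c2 * (c3 * (S powr q / \<epsilon>))"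
        using alg6_m_le[OF df(2)] unfolding s_locale c2_def[symmetric] df(4) c3_def .
      \<comment> \<open>c3 S^q / \<epsilon> is at least 1, so the additive 2 turns into a multiple
        of it.\<close>
      also have "\<dots> \<le> 2 * (c3 * (S powr q / \<epsilon>)) + c2 * (c3 * (S powr q / \<epsilon>))" using df(5) by (simp add: c3_def)
      also have "\<dots> = (2 + c2) * c3 * (S powr q / \<epsilon>)" by (simp only: distrib_right mult.assoc)
      finally have "real T * real (alg6_m E B f p \<nu> \<theta> ?\<delta>)
        \<le> ((2 + log 2 c1 / q) / q + 1 / q\<^sup>2) * ((2 + c2) * c3) * (log 2 (S / \<epsilon> powr q) * (S powr q / \<epsilon>))"
        using T(1) K(3) c2 c3 by (intro iteration_count[OF q S1 \<epsilon> that c1]) auto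
      then show ?thesis by (simp add: alg5_iterations_def C_def)
    qed
    with T(2) acc show "\<exists>T. alg6_stops_at E B f p \<nu> ?\<delta> x0 \<epsilon> u g T
          \<and> dual_nrm E B (\<lambda>h. grad E f (u T) h + g T h) \<le> \<epsilon>
          \<and> (2 \<le> S / \<epsilon> \<longrightarrow> real (alg5_iterations E B f p \<nu> \<theta> ?\<delta> T)
                 \<le> C * (log 2 (S / \<epsilon> powr q) * (S powr q / \<epsilon>)))"
      by blast
  qed
qed

end
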